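(* Let $q$ be a prime power, let $SE_6(q)$ be the group of $\mathbb{F}_q$-linear maps of the $27$-dimensional space $\mathbb{J}=\mathbb{J}_{\mathbb{F}_q}$ which preserve the cubic form $\det$ (the Dickson--Freudenthal determinant), and let $E_6(q)$ be the quotient of $SE_6(q)$ by the subgroup of all scalars it contains. Then $E_6(q)$ is simple.
   Context: Split octonions. For a field $F$, the split octonion algebra $\mathbb{O}=\mathbb{O}_F$ is the $8$-dimensional $F$-vector space with basis $\{e_i : i\in\pm I\}$, where $I=\{0,1,\omega,\bar\omega\}$ and $\pm I=\{\pm0,\pm1,\pm\omega,\pm\bar\omega\}$ ($8$ distinct labels, $0$ and $-0$ being different), with bilinear multiplication given by (1) $e_1e_\omega=-e_\omega e_1=e_{-\bar\omega}$; (2) $e_1e_0=e_{-0}e_1=e_1$; (3) $e_{-1}e_1=-e_0$ and $e_0e_0=e_0$; together with all the images of these rules under negating all subscripts (including $0\leftrightarrow -0$) and under multiplying all subscripts by $\omega$ (that is $1\mapsto\omega\mapsto\bar\omega\mapsto1$, $-1\mapsto-\omega\mapsto-\bar\omega\mapsto-1$, fixing $0$ and $-0$). All other products of basis vectors are $0$. The identity is $1=e_0+e_{-0}$, and $F$ is identified with $F\cdot 1$. The conjugation $x\mapsto\overline{x}$ is the linear map $e_0\leftrightarrow e_{-0}$, $e_i\mapsto -e_i$ for $i\ne\pm0$; it is an anti-automorphism. The trace is $\mathrm{Tr}(\sum\lambda_ie_i)=\lambda_0+\lambda_{-0}$, so $\mathrm{Tr}(x)=x+\overline{x}$, and $x\overline{x}=\sum_{i\in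 I}\lambda_i\lambda_{-i}\in F$ for $x=\sum\lambda_ie_i$. One has $\mathrm{Tr}(x(yz))=\mathrm{Tr}((xy)z)$, written $\mathrm{Tr}(xyz)$. The space $\mathbb{J}=\mathbb{J}_F$ is the $27$-dimensional $F$-space of Hermitian matrices $(a,b,c\mid A,B,C)=\begin{pmatrix}a&C&\overline{B}\\ \overline{C}&b&A\\ B&\overline{A}&c\end{pmatrix}$ with $a,b,c\in F$ and $A,B,C\in\mathbb{O}_F$. The Dickson--Freudenthal determinant is the cubic form (homogeneous polynomial of degree $3$ in the $27$ coordinates) $\det(a,b,c\mid A,B,C)=abc-aA\overline{A}-bB\overline{B}-cC\overline{C}+\mathrm{Tr}(ABC)$. A linear map preserves $\det$ if it preserves it as a cubic form (polynomial). *)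

theory Defs
  imports
    "HOL-Analysis.Cartesian_Space"
    "HOL-Algebra.SimpleGroups"
    "HOL-Library.Poly_Mapping"
    "HOL-Number_Theory.Prime_Powers"
begin

section \<open>Split octonions\<close>

text \<open>
  The index set \<open>I = {0, 1, \<omega>, \<omega>-bar}\<close> and the set \<open>\<plusminus>I\<close> of eight labels. The labels
  \<open>0 = Pos Zero\<close> and \<open>-0 = Neg Zero\<close> are different.
\<close>

datatype base = Zero | One | Om | Omb

datatype label = Pos base | Neg base

lemma UNIV_base: "(UNIV :: base set) = {Zero, One, Om, Omb}"
  using base.exhaust by blast

instance base :: finite
  by standard (simp add: UNIV_base)

lemma UNIV_label: "(UNIV :: label set) = Pos ` UNIV \<union> Neg ` UNIV"
proof -
  have "i \<in> Pos ` UNIV \<union> Neg ` UNIV" for i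
    by (cases i) simp_all
  then show ?thesis by blast
qed

instance label :: finite
  by standard (simp add: UNIV_label)

fun neg :: "label \<Rightarrow> label" where
  "neg (Pos i) = Neg i"
| "neg (Neg i) = Pos i"

fun base_times_om :: "base \<Rightarrow> base" where
  "base_times_om Zero = Zero"
| "base_times_om One = Om"
| "base_times_om Om = Omb"
| "base_times_om Omb = One"

fun times_om :: "label \<Rightarrow> label" where
  "times_om (Pos i) = Pos (base_times_om i)"
| "times_om (Neg i) = Neg (base_times_om i)"

text \<open>\<open>oct_table i j k s\<close> says \<open>e\<^sub>i e\<^sub>j = s e\<^sub>k\<close>, where \<open>s\<close> is \<open>1\<close> or \<open>-1\<close>.\<close>

inductive oct_table :: "label \<Rightarrow> label \<Rightarrow> label \<Rightarrow> int \<Rightarrow> bool" where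
  e1_eom: "oct_table (Pos One) (Pos Om) (Neg Omb) 1"
| eom_e1: "oct_table (Pos Om) (Pos One) (Neg Omb) (-1)"
| e1_e0: "oct_table (Pos One) (Pos Zero) (Pos One) 1"
| em0_e1: "oct_table (Neg Zero) (Pos One) (Pos One) 1"
| em1_e1: "oct_table (Neg One) (Pos One) (Pos Zero) (-1)"
| e0_e0: "oct_table (Pos Zero) (Pos Zero) (Pos Zero) 1"
| negate: "oct_table i j k s \<Longrightarrow> oct_table (neg i) (neg j) (neg k) s"
| rotate: "oct_table i j k s \<Longrightarrow> oct_table (times_om i) (times_om j) (times_om k) s"

definition oct_coeff :: "label \<Rightarrow> label \<Rightarrow> label \<Rightarrow> 'a::comm_ring_1" where
  "oct_coeff i j k =
     (if oct_table i j k 1 then 1 else if oct_table i j k (-1) then -1 else 0)"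

text \<open>
  Everything up to the determinant is defined over an arbitrary commutative ring, because the
  determinant is also needed over a polynomial ring. Note that \<open>(*)\<close> and \<open>1\<close> on the library
  type \<open>('a, label) vec\<close> are componentwise; they are not the octonion operations.
\<close>

type_synonym 'a oct = "('a, label) vec"

definition oct_mult :: "'a::comm_ring_1 oct \<Rightarrow> 'a oct \<Rightarrow> 'a oct" (infixl \<open>\<odot>\<close> 70) where
  "x \<odot> y = (\<chi> k. \<Sum>i\<in>UNIV. \<Sum>j\<in>UNIV. x $ i * y $ j * oct_coeff i j k)"

definition oct_scalar :: "'a::comm_ring_1 \<Rightarrow> 'a oct" where
  "oct_scalar c = c *s (axis (Pos Zero) 1 + axis (Neg Zero) 1)"

definition oct_conj :: "'a::comm_ring_1 oct \<Rightarrow> 'a oct" where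
  "oct_conj x = (\<chi> i. if i = Pos Zero then x $ Neg Zero
                      else if i = Neg Zero then x $ Pos Zero
                      else - x $ i)"

definition oct_tr :: "'a::comm_ring_1 oct \<Rightarrow> 'a" where
  "oct_tr x = x $ Pos Zero + x $ Neg Zero"

definition oct_norm :: "'a::comm_ring_1 oct \<Rightarrow> 'a" where
  "oct_norm x = (\<Sum>i\<in>UNIV. x $ Pos i * x $ Neg i)"


subsection \<open>The full multiplication table and basic identities\<close>

text \<open>The closure of the rules contains exactly these 32 products.\<close>

definition oct_products :: "(label \<times> label \<times> label \<times> int) set" where
  "oct_products =
    {(Pos One, Pos Om, Neg Omb, 1), (Neg One, Neg Om, Pos Omb, 1),
     (Pos Om, Pos Omb, Neg One, 1), (Neg Om, Neg Omb, Pos One, 1),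
     (Pos Omb, Pos One, Neg Om, 1), (Neg Omb, Neg One, Pos Om, 1),
     (Pos Om, Pos One, Neg Omb, -1), (Neg Om, Neg One, Pos Omb, -1),
     (Pos Omb, Pos Om, Neg One, -1), (Neg Omb, Neg Om, Pos One, -1),
     (Pos One, Pos Omb, Neg Om, -1), (Neg One, Neg Omb, Pos Om, -1),
     (Pos One, Pos Zero, Pos One, 1), (Neg One, Neg Zero, Neg One, 1),
     (Pos Om, Pos Zero, Pos Om, 1), (Neg Om, Neg Zero, Neg Om, 1),
     (Pos Omb, Pos Zero, Pos Omb, 1), (Neg Omb, Neg Zero, Neg Omb, 1),
     (Neg Zero, Pos One, Pos One, 1), (Pos Zero, Neg One, Neg One, 1),
     (Neg Zero, Pos Om, Pos Om, 1), (Pos Zero, Neg Om, Neg Om, 1),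
     (Neg Zero, Pos Omb, Pos Omb, 1), (Pos Zero, Neg Omb, Neg Omb, 1),
     (Neg One, Pos One, Pos Zero, -1), (Pos One, Neg One, Neg Zero, -1),
     (Neg Om, Pos Om, Pos Zero, -1), (Pos Om, Neg Om, Neg Zero, -1),
     (Neg Omb, Pos Omb, Pos Zero, -1), (Pos Omb, Neg Omb, Neg Zero, -1),
     (Pos Zero, Pos Zero, Pos Zero, 1), (Neg Zero, Neg Zero, Neg Zero, 1)}"

lemma oct_table_imp: "oct_table i j k s \<Longrightarrow> (i, j, k, s) \<in> oct_products"
proof (induction rule: oct_table.induct)
  case (negate i j k s)
  then show ?case unfolding oct_products_def by (elim insertE emptyE) simp_all
next
  case (rotate i j k s)
  then show ?case unfolding oct_products_def by (elim insertE emptyE) simp_all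
qed (simp_all add: oct_products_def)

lemmas oct_rules = e1_eom eom_e1 e1_e0 em0_e1 em1_e1 e0_e0

lemmas oct_rules_rotated = oct_rules oct_rules[THEN rotate] oct_rules[THEN rotate, THEN rotate]

lemmas oct_rules_all =
  oct_rules_rotated[simplified] oct_rules_rotated[THEN negate, simplified]

lemma imp_oct_table: "(i, j, k, s) \<in> oct_products \<Longrightarrow> oct_table i j k s"
  unfolding oct_products_def by (elim insertE emptyE) (simp_all add: oct_rules_all)

lemma oct_table_iff: "oct_table i j k s \<longleftrightarrow> (i, j, k, s) \<in> oct_products"
  using oct_table_imp imp_oct_table by blast

lemma oct_table_target:
  "oct_table i j (Pos Zero) s \<longleftrightarrow> (i, j, s) \<in>
     {(Neg One, Pos One, -1), (Neg Om, Pos Om, -1), (Neg Omb, Pos Omb, -1), (Pos Zero, Pos Zero, 1)}"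
  "oct_table i j (Neg Zero) s \<longleftrightarrow> (i, j, s) \<in>
     {(Pos One, Neg One, -1), (Pos Om, Neg Om, -1), (Pos Omb, Neg Omb, -1), (Neg Zero, Neg Zero, 1)}"
  "oct_table i j (Pos One) s \<longleftrightarrow> (i, j, s) \<in>
     {(Neg Om, Neg Omb, 1), (Neg Omb, Neg Om, -1), (Pos One, Pos Zero, 1), (Neg Zero, Pos One, 1)}"
  "oct_table i j (Pos Om) s \<longleftrightarrow> (i, j, s) \<in>
     {(Neg Omb, Neg One, 1), (Neg One, Neg Omb, -1), (Pos Om, Pos Zero, 1), (Neg Zero, Pos Om, 1)}"
  "oct_table i j (Pos Omb) s \<longleftrightarrow> (i, j, s) \<in>
     {(Neg One, Neg Om, 1), (Neg Om, Neg One, -1), (Pos Omb, Pos Zero, 1), (Neg Zero, Pos Omb, 1)}"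
  "oct_table i j (Neg One) s \<longleftrightarrow> (i, j, s) \<in>
     {(Pos Om, Pos Omb, 1), (Pos Omb, Pos Om, -1), (Neg One, Neg Zero, 1), (Pos Zero, Neg One, 1)}"
  "oct_table i j (Neg Om) s \<longleftrightarrow> (i, j, s) \<in>
     {(Pos Omb, Pos One, 1), (Pos One, Pos Omb, -1), (Neg Om, Neg Zero, 1), (Pos Zero, Neg Om, 1)}"
  "oct_table i j (Neg Omb) s \<longleftrightarrow> (i, j, s) \<in>
     {(Pos One, Pos Om, 1), (Pos Om, Pos One, -1), (Neg Omb, Neg Zero, 1), (Pos Zero, Neg Omb, 1)}"
  by (simp_all add: oct_table_iff oct_products_def)

lemma sum_base: "(\<Sum>i\<in>UNIV. f i) = f Zero + f One + f Om + (f Omb :: 'b::comm_monoid_add)"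
  by (simp add: UNIV_base ac_simps)

lemma sum_label:
  "(\<Sum>i\<in>UNIV. f i) = (\<Sum>i\<in>UNIV. f (Pos i)) + (\<Sum>i\<in>UNIV. f (Neg i) :: 'b::comm_monoid_add)"
  unfolding UNIV_label
  by (subst sum.union_disjoint) (auto simp: sum.reindex inj_on_def)

lemma oct_mult_nth:
  fixes x y :: "'a::comm_ring_1 oct"
  shows
    "(x \<odot> y) $ Pos Zero = x $ Pos Zero * y $ Pos Zero - x $ Neg One * y $ Pos One
       - x $ Neg Om * y $ Pos Om - x $ Neg Omb * y $ Pos Omb"
    "(x \<odot> y) $ Neg Zero = x $ Neg Zero * y $ Neg Zero - x $ Pos One * y $ Neg One
       - x $ Pos Om * y $ Neg Om - x $ Pos Omb * y $ Neg Omb"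
    "(x \<odot> y) $ Pos One = x $ Pos One * y $ Pos Zero + x $ Neg Zero * y $ Pos One
       + x $ Neg Om * y $ Neg Omb - x $ Neg Omb * y $ Neg Om"
    "(x \<odot> y) $ Pos Om = x $ Pos Om * y $ Pos Zero + x $ Neg Zero * y $ Pos Om
       + x $ Neg Omb * y $ Neg One - x $ Neg One * y $ Neg Omb"
    "(x \<odot> y) $ Pos Omb = x $ Pos Omb * y $ Pos Zero + x $ Neg Zero * y $ Pos Omb
       + x $ Neg One * y $ Neg Om - x $ Neg Om * y $ Neg One"
    "(x \<odot> y) $ Neg One = x $ Neg One * y $ Neg Zero + x $ Pos Zero * y $ Neg One
       + x $ Pos Om * y $ Pos Omb - x $ Pos Omb * y $ Pos Om"
    "(x \<odot> y) $ Neg Om = x $ Neg Om * y $ Neg Zero + x $ Pos Zero * y $ Neg Om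
       + x $ Pos Omb * y $ Pos One - x $ Pos One * y $ Pos Omb"
    "(x \<odot> y) $ Neg Omb = x $ Neg Omb * y $ Neg Zero + x $ Pos Zero * y $ Neg Omb
       + x $ Pos One * y $ Pos Om - x $ Pos Om * y $ Pos One"
  by (simp_all add: oct_mult_def oct_coeff_def oct_table_target sum_label sum_base)

lemma oct_eq_iff:
  fixes x y :: "'a oct"
  shows "x = y \<longleftrightarrow>
    x $ Pos Zero = y $ Pos Zero \<and> x $ Neg Zero = y $ Neg Zero \<and>
    x $ Pos One = y $ Pos One \<and> x $ Neg One = y $ Neg One \<and>
    x $ Pos Om = y $ Pos Om \<and> x $ Neg Om = y $ Neg Om \<and>
    x $ Pos Omb = y $ Pos Omb \<and> x $ Neg Omb = y $ Neg Omb"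
proof -
  have all_base: "(\<forall>i. P i) \<longleftrightarrow> P Zero \<and> P One \<and> P Om \<and> P Omb" for P
    by (metis (full_types) base.exhaust)
  have "(\<forall>i. P i) \<longleftrightarrow> (\<forall>i. P (Pos i)) \<and> (\<forall>i. P (Neg i))" for P
    by (metis (full_types) label.exhaust)
  then show ?thesis
    by (auto simp: vec_eq_iff all_base)
qed

lemma oct_scalar_mult: "oct_scalar c \<odot> x = c *s x" "x \<odot> oct_scalar c = c *s x"
  by (simp_all add: oct_eq_iff oct_mult_nth oct_scalar_def axis_def mult.commute)

lemma oct_mult_conj: "x \<odot> oct_conj x = oct_scalar (oct_norm x)"
  by (simp add: oct_eq_iff oct_mult_nth oct_conj_def oct_scalar_def oct_norm_def axis_def
      sum_base algebra_simps)

lemma oct_add_conj: "x + oct_conj x = oct_scalar (oct_tr x)"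
  by (simp add: oct_eq_iff oct_conj_def oct_scalar_def oct_tr_def axis_def algebra_simps)

lemma oct_conj_mult: "oct_conj (x \<odot> y) = oct_conj y \<odot> oct_conj x"
  by (simp add: oct_eq_iff oct_mult_nth oct_conj_def algebra_simps)

lemma oct_tr_assoc: "oct_tr (x \<odot> (y \<odot> z)) = oct_tr ((x \<odot> y) \<odot> z)"
  by (simp add: oct_tr_def oct_mult_nth algebra_simps)


section \<open>The 27-dimensional space and the Dickson--Freudenthal determinant\<close>

text \<open>
  The 27 coordinates of the Hermitian matrix \<open>(a, b, c | A, B, C)\<close>, whose rows are
  \<open>(a, C, conj B)\<close>, \<open>(conj C, b, A)\<close> and \<open>(B, conj A, c)\<close>.
\<close>

datatype coord = Ca | Cb | Cc | CA label | CB label | CC label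

lemma UNIV_coord:
  "(UNIV :: coord set) = {Ca, Cb, Cc} \<union> CA ` UNIV \<union> CB ` UNIV \<union> CC ` UNIV"
proof -
  have "i \<in> {Ca, Cb, Cc} \<union> CA ` UNIV \<union> CB ` UNIV \<union> CC ` UNIV" for i
    by (cases i) simp_all
  then show ?thesis by blast
qed

instance coord :: finite
  by standard (simp add: UNIV_coord)

type_synonym 'a albert = "('a, coord) vec"

definition A_part :: "'a albert \<Rightarrow> 'a oct" where "A_part x = (\<chi> i. x $ CA i)"
definition B_part :: "'a albert \<Rightarrow> 'a oct" where "B_part x = (\<chi> i. x $ CB i)"
definition C_part :: "'a albert \<Rightarrow> 'a oct" where "C_part x = (\<chi> i. x $ CC i)"

definition df_det :: "'a::comm_ring_1 albert \<Rightarrow> 'a" where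
  "df_det x = x $ Ca * x $ Cb * x $ Cc
     - x $ Ca * oct_norm (A_part x) - x $ Cb * oct_norm (B_part x) - x $ Cc * oct_norm (C_part x)
     + oct_tr (A_part x \<odot> (B_part x \<odot> C_part x))"


section \<open>Preservation of the determinant as a cubic form\<close>

text \<open>
  The library type \<open>(coord \<Rightarrow>\<^sub>0 nat) \<Rightarrow>\<^sub>0 'a\<close> is the polynomial ring over \<open>'a\<close> in the 27
  coordinates. Over a small field, equality of polynomials is stronger than equality of the
  functions they define, so the cubic form has to be treated as an element of this ring.
\<close>

type_synonym 'a cpoly = "(coord \<Rightarrow>\<^sub>0 nat) \<Rightarrow>\<^sub>0 'a"

definition cconst :: "'a::zero \<Rightarrow> 'a cpoly" where
  "cconst c = Poly_Mapping.single 0 c"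

definition cvar :: "coord \<Rightarrow> 'a::zero_neq_one cpoly" where
  "cvar i = Poly_Mapping.single (Poly_Mapping.single i 1) 1"

definition det_form :: "'a::comm_ring_1 cpoly" where
  "det_form = df_det (\<chi> i. cvar i)"

text \<open>
  For a linear map \<open>f\<close>, the polynomial \<open>det_form\<close> with \<open>f\<close> substituted: the \<open>i\<close>-th variable is
  replaced by the linear form giving the \<open>i\<close>-th coordinate of \<open>f\<close>.
\<close>

definition det_form_subst :: "('a::comm_ring_1 albert \<Rightarrow> 'a albert) \<Rightarrow> 'a cpoly" where
  "det_form_subst f = df_det (\<chi> i. \<Sum>j\<in>UNIV. cconst (f (axis j 1) $ i) * cvar j)"

definition preserves_det :: "('a::comm_ring_1 albert \<Rightarrow> 'a albert) \<Rightarrow> bool" where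
  "preserves_det f \<longleftrightarrow> det_form_subst f = det_form"


section \<open>The groups\<close>

text \<open>
  Invertibility need not be required: the determinant is a nondegenerate form, so a linear map
  preserving it is injective.
\<close>

definition SE6 :: "('a::field albert \<Rightarrow> 'a albert) monoid" where
  "SE6 = \<lparr>carrier = {f. Vector_Spaces.linear (*s) (*s) f \<and> preserves_det f},
          monoid.mult = (\<circ>), one = id\<rparr>"

definition SE6_scalars :: "('a::field albert \<Rightarrow> 'a albert) set" where
  "SE6_scalars = {f \<in> carrier SE6. \<exists>c. f = (*s) c}"

definition E6 :: "('a::field albert \<Rightarrow> 'a albert) set monoid" where
  "E6 = SE6 Mod SE6_scalars"

end

theory Submission
  imports Defs "HOL-Computational_Algebra.Polynomial" "HOL-Algebra.Zassenhaus"
begin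

text \<open>
  Iwasawa's criterion is applied to the action on white vectors, the nonzero vectors at which the
  derivative of the determinant vanishes. The Hermitian matrices are acted upon by elementary row
  operations \<open>X \<mapsto> M X M\<^sup>*\<close>, where \<open>M\<close> is the identity plus one off-diagonal octonion entry.
  These generate the whole isometry group: they are transitive on white vectors, on pairs of white
  vectors in general position and on diagonal frames, and the stabilizer of a frame consists of
  triality triples of isometries of the octonion norm, which are reduced to the identity by
  commutators of elementary operations, acting as Siegel transformations. The elements of a point
  stabilizer that act trivially on its three-step flag form an abelian group whose conjugates contain
  all elementary operations, and each elementary operation is a commutator. A normal subgroup with a
  nonscalar element moves some white vector to general position, so it is transitive on white
  vectors; hence it supplements the abelian group, contains all commutators, and is everything.
\<close>

section \<open>Octonion identities\<close>

text \<open>The obstacle is generation. Iwasawa's argument alone would treat the subgroup generated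
  by the elementary maps, whereas the isometry group is given by a condition and not by generators.
  It has to be exhausted by a chain of pointwise stabilizers that ends at the identity, and each
  link asks for an orbit statement proved with maps that fix all earlier vectors. The second
  constraint is that characteristics 2 and 3 and the field with two elements get no separate
  treatment. Hence the polynomial identity is turned into identities for \<open>df_det\<close> and
  \<open>det_deriv\<close>, never for the trilinear form alone. Rescaling uses no diagonal matrices
  either: the octonion norm takes every value, so an entry is normalized by creating a 1 elsewhere
  in the matrix and clearing with it.\<close>

definition oct_inner :: "'a::comm_ring_1 oct \<Rightarrow> 'a oct \<Rightarrow> 'a" where
  "oct_inner x y = (\<Sum>i\<in>UNIV. x $ i * y $ neg i)"

lemma oct_mult_add: "(x + y) \<odot> z = x \<odot> z + y \<odot> z" "x \<odot> (y + z) = x \<odot> y + x \<odot> z"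
  by (simp_all add: oct_eq_iff oct_mult_nth algebra_simps)

lemma oct_mult_scale: "(c *s x) \<odot> y = c *s (x \<odot> y)" "x \<odot> (c *s y) = c *s (x \<odot> y)"
  by (simp_all add: oct_eq_iff oct_mult_nth algebra_simps)

lemma oct_mult_zero [simp]: "0 \<odot> x = 0" "x \<odot> 0 = 0"
  by (simp_all add: oct_eq_iff oct_mult_nth)

lemma oct_mult_minus [simp]: "(- x) \<odot> y = - (x \<odot> y)" "x \<odot> (- y) = - (x \<odot> y)"
  by (simp_all add: oct_eq_iff oct_mult_nth algebra_simps)

lemma oct_mult_diff: "(x - y) \<odot> z = x \<odot> z - y \<odot> z" "x \<odot> (y - z) = x \<odot> y - x \<odot> z"
  by (simp_all add: oct_eq_iff oct_mult_nth algebra_simps)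

lemma oct_conj_linear [simp]:
  "oct_conj (x + y) = oct_conj x + oct_conj y" "oct_conj (c *s x) = c *s oct_conj x"
  "oct_conj (- x) = - oct_conj x" "oct_conj (x - y) = oct_conj x - oct_conj y"
  "oct_conj 0 = 0" "oct_conj (oct_conj x) = x"
  by (simp_all add: oct_eq_iff oct_conj_def algebra_simps)

lemma oct_tr_linear [simp]:
  "oct_tr (x + y) = oct_tr x + oct_tr y" "oct_tr (c *s x) = c * oct_tr x"
  "oct_tr (- x) = - oct_tr x" "oct_tr (x - y) = oct_tr x - oct_tr y" "oct_tr 0 = 0"
  by (simp_all add: oct_tr_def algebra_simps)

lemma oct_tr_conj [simp]: "oct_tr (oct_conj x) = oct_tr x"
  by (simp add: oct_tr_def oct_conj_def)

lemma oct_inner_add: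
  "oct_inner (x + y) z = oct_inner x z + oct_inner y z"
  "oct_inner x (y + z) = oct_inner x y + oct_inner x z"
  by (simp_all add: oct_inner_def sum.distrib algebra_simps)

lemma oct_inner_scale [simp]:
  "oct_inner (c *s x) y = c * oct_inner x y" "oct_inner x (c *s y) = c * oct_inner x y"
  by (simp_all add: oct_inner_def sum_distrib_left algebra_simps)

lemma oct_inner_minus [simp]:
  "oct_inner (- x) y = - oct_inner x y" "oct_inner x (- y) = - oct_inner x y"
  by (simp_all add: oct_inner_def sum_negf)

lemma oct_inner_zero [simp]: "oct_inner 0 x = 0" "oct_inner x 0 = 0"
  by (simp_all add: oct_inner_def)

lemma oct_inner_commute: "oct_inner x y = oct_inner y x"
  by (simp add: oct_inner_def sum_label sum_base algebra_simps)

lemma oct_inner_diff: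
  "oct_inner (x - y) z = oct_inner x z - oct_inner y z"
  "oct_inner x (y - z) = oct_inner x y - oct_inner x z"
  by (simp_all add: oct_inner_def sum_subtractf algebra_simps)

lemma oct_inner_conj [simp]: "oct_inner (oct_conj x) (oct_conj y) = oct_inner x y"
  by (simp add: oct_inner_def oct_conj_def sum_label sum_base)

lemma oct_norm_add: "oct_norm (x + y) = oct_norm x + oct_norm y + oct_inner x y"
  by (simp add: oct_norm_def oct_inner_def sum_label sum_base algebra_simps)

lemma oct_norm_scale [simp]: "oct_norm (c *s x) = c\<^sup>2 * oct_norm x"
  by (simp add: oct_norm_def sum_base power2_eq_square algebra_simps)

lemma oct_norm_basic [simp]:
  "oct_norm 0 = 0" "oct_norm (- x) = oct_norm x" "oct_norm (oct_conj x) = oct_norm x"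
  by (simp_all add: oct_norm_def oct_conj_def sum_base mult.commute)

lemma oct_norm_mult: "oct_norm (x \<odot> y) = oct_norm x * oct_norm y"
  by (simp add: oct_norm_def oct_mult_nth sum_base algebra_simps)

lemma oct_inner_self: "oct_inner x x = 2 * oct_norm x"
  by (simp add: oct_norm_def oct_inner_def sum_label sum_base algebra_simps)

lemma oct_tr_mult_conj: "oct_tr (x \<odot> oct_conj y) = oct_inner x y"
  by (simp add: oct_tr_def oct_mult_nth oct_inner_def oct_conj_def sum_label sum_base algebra_simps)

lemma oct_tr_mult_eq_inner: "oct_tr (x \<odot> y) = oct_inner x (oct_conj y)"
  by (metis oct_tr_mult_conj oct_conj_linear(6))

lemma oct_tr_mult_commute: "oct_tr (x \<odot> y) = oct_tr (y \<odot> x)"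
  by (simp add: oct_tr_def oct_mult_nth algebra_simps)

lemma oct_tr_rotate: "oct_tr (x \<odot> (y \<odot> z)) = oct_tr (y \<odot> (z \<odot> x))"
  by (metis oct_tr_assoc oct_tr_mult_commute)

lemma oct_alternative_left: "oct_conj x \<odot> (x \<odot> y) = oct_norm x *s y"
  by (simp add: oct_eq_iff oct_mult_nth oct_conj_def oct_norm_def sum_base algebra_simps)

lemma oct_alternative_left': "x \<odot> (oct_conj x \<odot> y) = oct_norm x *s y"
  using oct_alternative_left[of "oct_conj x" y] by simp

lemma oct_alternative_right: "(y \<odot> x) \<odot> oct_conj x = oct_norm x *s y"
  by (simp add: oct_eq_iff oct_mult_nth oct_conj_def oct_norm_def sum_base algebra_simps)

lemma oct_alternative_right': "(y \<odot> oct_conj x) \<odot> x = oct_norm x *s y"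
  using oct_alternative_right[of y "oct_conj x"] by simp

lemma oct_alternative_left_linearized:
  "x \<odot> (oct_conj y \<odot> z) + y \<odot> (oct_conj x \<odot> z) = oct_inner x y *s z"
proof -
  have "(x + y) \<odot> (oct_conj (x + y) \<odot> z) = oct_norm (x + y) *s z"
    by (rule oct_alternative_left')
  then show ?thesis
    by (simp add: oct_mult_add oct_norm_add oct_alternative_left' vector_sadd_rdistrib add_ac)
qed

lemma neg_neg [simp]: "neg (neg i) = i"
  by (cases i) simp_all

lemma neg_eq_iff [simp]: "neg i = neg j \<longleftrightarrow> i = j"
  by (metis neg_neg)

lemma neg_neq [simp]: "neg i \<noteq> i" "i \<noteq> neg i"
  by (cases i; simp)+

lemma oct_inner_axis [simp]:
  "oct_inner x (axis i c) = x $ neg i * c" "oct_inner (axis i c) x = c * x $ neg i"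
proof -
  show *: "oct_inner x (axis i c) = x $ neg i * c" for x :: "'a oct"
  proof -
    have "x $ j * axis i c $ neg j = (if j = neg i then x $ j * c else 0)" for j
      by (cases "j = neg i") (auto simp: axis_def)
    then show ?thesis
      by (simp add: oct_inner_def)
  qed
  show "oct_inner (axis i c) x = c * x $ neg i"
    using *[of x] by (simp add: oct_inner_commute mult.commute)
qed

lemma oct_nondegenerate: "(\<And>y. oct_inner x y = 0) \<Longrightarrow> x = 0"
  by (metis mult.right_neutral neg_neg oct_inner_axis(1) vec_eq_iff zero_index)

lemma oct_norm_axis [simp]: "oct_norm (axis i c) = 0"
  by (cases i) (auto simp: oct_norm_def sum_base axis_def)

section \<open>The derivative of the determinant\<close>

definition herm :: "'a \<Rightarrow> 'a \<Rightarrow> 'a \<Rightarrow> 'a oct \<Rightarrow> 'a oct \<Rightarrow> 'a oct \<Rightarrow> 'a albert" where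
  "herm a b c A B C = (\<chi> i. case i of Ca \<Rightarrow> a | Cb \<Rightarrow> b | Cc \<Rightarrow> c
                        | CA l \<Rightarrow> A $ l | CB l \<Rightarrow> B $ l | CC l \<Rightarrow> C $ l)"

lemma herm_sel [simp]:
  "herm a b c A B C $ Ca = a" "herm a b c A B C $ Cb = b" "herm a b c A B C $ Cc = c"
  "herm a b c A B C $ CA l = A $ l" "herm a b c A B C $ CB l = B $ l" "herm a b c A B C $ CC l = C $ l"
  "A_part (herm a b c A B C) = A" "B_part (herm a b c A B C) = B" "C_part (herm a b c A B C) = C"
  by (simp_all add: herm_def A_part_def B_part_def C_part_def)

lemma part_nth: "A_part x $ l = x $ CA l" "B_part x $ l = x $ CB l" "C_part x $ l = x $ CC l"
  by (simp_all add: A_part_def B_part_def C_part_def)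

lemma albert_eq_iff:
  "x = y \<longleftrightarrow> x $ Ca = y $ Ca \<and> x $ Cb = y $ Cb \<and> x $ Cc = y $ Cc \<and>
     A_part x = A_part y \<and> B_part x = B_part y \<and> C_part x = C_part y"
proof -
  have "x $ i = y $ i" if "x $ Ca = y $ Ca" "x $ Cb = y $ Cb" "x $ Cc = y $ Cc"
    "A_part x = A_part y" "B_part x = B_part y" "C_part x = C_part y" for i
    using that by (cases i) (metis part_nth)+
  then show ?thesis
    by (metis vec_eq_iff)
qed

lemma herm_collapse [simp]:
  "herm (x $ Ca) (x $ Cb) (x $ Cc) (A_part x) (B_part x) (C_part x) = x"
  by (simp add: albert_eq_iff)

lemma herm_exhaust: obtains a b c A B C where "x = herm a b c A B C"
  by (metis herm_collapse)

lemma herm_eq_iff [simp]: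
  "herm a b c A B C = herm a' b' c' A' B' C' \<longleftrightarrow>
     a = a' \<and> b = b' \<and> c = c' \<and> A = A' \<and> B = B' \<and> C = C'"
  by (simp add: albert_eq_iff)

lemma part_linear [simp]:
  "A_part (x + y) = A_part x + A_part y" "B_part (x + y) = B_part x + B_part y"
  "C_part (x + y) = C_part x + C_part y"
  "A_part (r *s x) = r *s A_part x" "B_part (r *s x) = r *s B_part x" "C_part (r *s x) = r *s C_part x"
  "A_part 0 = 0" "B_part 0 = 0" "C_part 0 = 0"
  by (simp_all add: vec_eq_iff part_nth)

lemma herm_linear:
  "herm a b c A B C + herm a' b' c' A' B' C' = herm (a + a') (b + b') (c + c') (A + A') (B + B') (C + C')"
  "r *s herm a b c A B C = herm (r * a) (r * b) (r * c) (r *s A) (r *s B) (r *s C)"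
  "herm 0 0 0 0 0 0 = 0"
  by (simp_all add: albert_eq_iff)

lemma axis_eq_herm:
  "axis Ca r = herm r 0 0 0 0 0" "axis Cb r = herm 0 r 0 0 0 0" "axis Cc r = herm 0 0 r 0 0 0"
  "axis (CA l) r = herm 0 0 0 (axis l r) 0 0" "axis (CB l) r = herm 0 0 0 0 (axis l r) 0"
  "axis (CC l) r = herm 0 0 0 0 0 (axis l r)"
  by (simp_all add: albert_eq_iff vec_eq_iff part_nth axis_def)

text \<open>As a linear functional of \<open>y\<close> this is the pairing with the Freudenthal
  adjoint of \<open>x\<close>. It is the part of \<open>df_det (x + y)\<close> that is quadratic in
  \<open>x\<close>, written out so that nothing is divided by 2 or 3.\<close>

definition det_deriv :: "'a::comm_ring_1 albert \<Rightarrow> 'a albert \<Rightarrow> 'a" where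
  "det_deriv x y =
     y $ Ca * (x $ Cb * x $ Cc - oct_norm (A_part x)) +
     y $ Cb * (x $ Cc * x $ Ca - oct_norm (B_part x)) +
     y $ Cc * (x $ Ca * x $ Cb - oct_norm (C_part x)) -
     x $ Ca * oct_inner (A_part x) (A_part y) - x $ Cb * oct_inner (B_part x) (B_part y) -
     x $ Cc * oct_inner (C_part x) (C_part y) +
     oct_tr (A_part y \<odot> (B_part x \<odot> C_part x)) + oct_tr (A_part x \<odot> (B_part y \<odot> C_part x)) +
     oct_tr (A_part x \<odot> (B_part x \<odot> C_part y))"

text \<open>The polarization of \<open>det_deriv\<close> in its first argument. On the diagonal it
  is 6 times the determinant, so in characteristics 2 and 3 the cubic form cannot be recovered from
  it.\<close>

definition det_tri :: "'a::comm_ring_1 albert \<Rightarrow> 'a albert \<Rightarrow> 'a albert \<Rightarrow> 'a" where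
  "det_tri x y z =
     z $ Ca * (x $ Cb * y $ Cc + y $ Cb * x $ Cc - oct_inner (A_part x) (A_part y)) +
     z $ Cb * (x $ Cc * y $ Ca + y $ Cc * x $ Ca - oct_inner (B_part x) (B_part y)) +
     z $ Cc * (x $ Ca * y $ Cb + y $ Ca * x $ Cb - oct_inner (C_part x) (C_part y)) -
     x $ Ca * oct_inner (A_part y) (A_part z) - y $ Ca * oct_inner (A_part x) (A_part z) -
     x $ Cb * oct_inner (B_part y) (B_part z) - y $ Cb * oct_inner (B_part x) (B_part z) -
     x $ Cc * oct_inner (C_part y) (C_part z) - y $ Cc * oct_inner (C_part x) (C_part z) +
     oct_tr (A_part z \<odot> (B_part x \<odot> C_part y)) + oct_tr (A_part z \<odot> (B_part y \<odot> C_part x)) +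
     oct_tr (A_part x \<odot> (B_part z \<odot> C_part y)) + oct_tr (A_part y \<odot> (B_part z \<odot> C_part x)) +
     oct_tr (A_part x \<odot> (B_part y \<odot> C_part z)) + oct_tr (A_part y \<odot> (B_part x \<odot> C_part z))"

lemmas oct_linear = oct_mult_add oct_mult_scale oct_inner_add oct_norm_add

lemma df_det_add: "df_det (x + y) = df_det x + det_deriv x y + det_deriv y x + df_det y"
  by (simp add: df_det_def det_deriv_def oct_linear oct_inner_commute algebra_simps)

lemma df_det_scale: "df_det (r *s x) = r ^ 3 * df_det x"
  by (simp add: df_det_def oct_linear algebra_simps power2_eq_square power3_eq_cube)

lemma det_deriv_add: "det_deriv (x + y) z = det_deriv x z + det_deriv y z + det_tri x y z"
  by (simp add: det_deriv_def det_tri_def oct_linear oct_inner_commute algebra_simps)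

lemma det_deriv_linear:
  "det_deriv x (y + z) = det_deriv x y + det_deriv x z" "det_deriv x (r *s y) = r * det_deriv x y"
  by (simp_all add: det_deriv_def oct_linear algebra_simps)

lemma det_deriv_scale: "det_deriv (r *s x) y = r\<^sup>2 * det_deriv x y"
  by (simp add: det_deriv_def oct_linear algebra_simps power2_eq_square)

lemma det_zero [simp]:
  "df_det 0 = 0" "det_deriv 0 y = 0" "det_deriv x 0 = 0"
  "det_tri 0 y z = 0" "det_tri x 0 z = 0" "det_tri x y 0 = 0"
  by (simp_all add: df_det_def det_deriv_def det_tri_def)

lemma det_tri_add:
  "det_tri (x + x') y z = det_tri x y z + det_tri x' y z"
  "det_tri x (y + y') z = det_tri x y z + det_tri x y' z"
  "det_tri x y (z + z') = det_tri x y z + det_tri x y z'"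
  by (simp_all add: det_tri_def oct_linear algebra_simps)

lemma det_tri_scale:
  "det_tri (r *s x) y z = r * det_tri x y z"
  "det_tri x (r *s y) z = r * det_tri x y z"
  "det_tri x y (r *s z) = r * det_tri x y z"
  by (simp_all add: det_tri_def oct_linear algebra_simps)

lemma det_tri_commute: "det_tri x y z = det_tri y x z" "det_tri x y z = det_tri x z y"
  by (simp_all add: det_tri_def oct_inner_commute algebra_simps)

section \<open>Root elements\<close>

text \<open>Here \<open>M\<close> has \<open>x\<close> in position (1,2). The new entry in position
  (1,3) is \<open>oct_conj B + x \<odot> A\<close>, which explains the conjugate in the
  \<open>B\<close> part.\<close>

definition E12 :: "'a::comm_ring_1 oct \<Rightarrow> 'a albert \<Rightarrow> 'a albert" where
  "E12 x v = herm (v $ Ca + oct_inner x (C_part v) + v $ Cb * oct_norm x) (v $ Cb) (v $ Cc)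
     (A_part v) (B_part v + oct_conj (x \<odot> A_part v)) (C_part v + v $ Cb *s x)"

text \<open>Here the entry of \<open>M\<close> in position (2,1) is \<open>oct_conj x\<close>, so
  that the \<open>C\<close> part changes by a multiple of \<open>x\<close> itself.\<close>

definition E21 :: "'a::comm_ring_1 oct \<Rightarrow> 'a albert \<Rightarrow> 'a albert" where
  "E21 x v = herm (v $ Ca) (v $ Cb + oct_inner x (C_part v) + v $ Ca * oct_norm x) (v $ Cc)
     (A_part v + oct_conj (B_part v \<odot> x)) (B_part v) (C_part v + v $ Ca *s x)"

text \<open>Conjugation by a cyclic permutation matrix; the remaining elementary maps are obtained
  from \<open>E12\<close> and \<open>E21\<close> by conjugating with it.\<close>

definition rot :: "'a albert \<Rightarrow> 'a albert" where
  "rot v = herm (v $ Cb) (v $ Cc) (v $ Ca) (B_part v) (C_part v) (A_part v)"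

text \<open>Once the conjugate of the product is expanded, the linearized alternative law removes
  \<open>A\<close> and \<open>A'\<close> together. The result cancels the term
  \<open>oct_inner x C\<close> that \<open>E12\<close> adds to the coordinate
  \<open>Ca\<close>.\<close>

lemma tr_conj_left: "oct_tr (A' \<odot> (oct_conj (x \<odot> A) \<odot> C)) + oct_tr (A \<odot> (oct_conj (x \<odot> A') \<odot> C))
    = oct_inner A A' * oct_inner x C"
proof -
  have "oct_tr ((A' \<odot> (oct_conj A \<odot> oct_conj x) + A \<odot> (oct_conj A' \<odot> oct_conj x)) \<odot> C) =
      oct_inner A' A * oct_tr (oct_conj x \<odot> C)"
    by (simp add: oct_alternative_left_linearized oct_mult_scale)
  moreover have "oct_tr (oct_conj x \<odot> C) = oct_inner x C"
    by (metis oct_tr_mult_commute oct_tr_mult_conj oct_inner_commute)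
  ultimately show ?thesis
    by (simp add: oct_conj_mult oct_tr_assoc oct_mult_add oct_inner_commute)
qed

lemma tr_conj_left_same: "oct_tr (A \<odot> (oct_conj (x \<odot> A) \<odot> C)) = oct_norm A * oct_inner x C"
proof -
  have "oct_tr (A \<odot> (oct_conj (x \<odot> A) \<odot> C)) = oct_tr ((A \<odot> (oct_conj A \<odot> oct_conj x)) \<odot> C)"
    by (simp add: oct_conj_mult oct_tr_assoc)
  also have "\<dots> = oct_norm A * oct_tr (oct_conj x \<odot> C)"
    by (simp add: oct_alternative_left' oct_mult_scale)
  also have "oct_tr (oct_conj x \<odot> C) = oct_inner x C"
    by (metis oct_tr_mult_commute oct_tr_mult_conj oct_inner_commute)
  finally show ?thesis .
qed

lemma tr_conj_right: "oct_tr (A' \<odot> (oct_conj (x \<odot> A) \<odot> x)) = oct_norm x * oct_inner A' A"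
  by (simp add: oct_conj_mult oct_alternative_right' oct_mult_scale oct_tr_mult_conj)

lemma inner_conj_mult: "oct_inner B (oct_conj (x \<odot> A)) = oct_tr (A \<odot> (B \<odot> x))"
  by (metis oct_tr_mult_eq_inner oct_tr_rotate oct_conj_linear(6))

lemma df_det_E12: "df_det (E12 x v) = df_det v"
  by (simp add: df_det_def E12_def oct_linear tr_conj_left_same tr_conj_right inner_conj_mult
      oct_norm_mult oct_inner_self power2_eq_square oct_inner_commute[of _ x] algebra_simps)

lemma det_deriv_E12: "det_deriv (E12 x v) (E12 x w) = det_deriv v w"
  using tr_conj_left[of "A_part w" x "A_part v" "C_part v"]
  by (simp add: det_deriv_def E12_def oct_linear tr_conj_right inner_conj_mult tr_conj_left_same
      oct_norm_mult oct_inner_self power2_eq_square oct_inner_commute[of _ x] algebra_simps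
      oct_inner_commute[of "A_part w"] oct_inner_commute[of "oct_conj _"])

text \<open>Conjugation by the permutation matrix that exchanges the first two indices. It
  interchanges the two kinds of elementary maps, so invariance under one gives invariance under the
  other.\<close>

definition herm_transpose :: "'a::comm_ring_1 albert \<Rightarrow> 'a albert" where
  "herm_transpose v = herm (v $ Cb) (v $ Ca) (v $ Cc)
     (oct_conj (B_part v)) (oct_conj (A_part v)) (oct_conj (C_part v))"

lemma E21_eq: "E21 x = herm_transpose \<circ> E12 (oct_conj x) \<circ> herm_transpose"
proof
  fix v :: "'a albert"
  show "E21 x v = (herm_transpose \<circ> E12 (oct_conj x) \<circ> herm_transpose) v"
    by (simp add: E21_def E12_def herm_transpose_def oct_conj_mult)
qed

lemma tr_conj_reverse: "oct_tr (oct_conj B \<odot> (oct_conj A \<odot> oct_conj C)) = oct_tr (A \<odot> (B \<odot> C))"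
  by (metis oct_conj_mult oct_tr_assoc oct_tr_conj oct_tr_rotate)

lemma det_herm_transpose:
  "df_det (herm_transpose v) = df_det v"
  "det_deriv (herm_transpose v) (herm_transpose w) = det_deriv v w"
  by (simp_all add: df_det_def det_deriv_def herm_transpose_def tr_conj_reverse algebra_simps)

lemma det_E21:
  "df_det (E21 x v) = df_det v" "det_deriv (E21 x v) (E21 x w) = det_deriv v w"
  by (simp_all add: E21_eq det_herm_transpose df_det_E12 det_deriv_E12)

lemma det_rot:
  "df_det (rot v) = df_det v" "det_deriv (rot v) (rot w) = det_deriv v w"
  by (simp_all add: df_det_def det_deriv_def rot_def algebra_simps
      oct_tr_rotate[of "A_part v"] oct_tr_rotate[of "A_part w"])

section \<open>Preservation of the cubic form, in terms of functions\<close>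

lemma poly_mapping_add_single_induct:
  assumes "P 0" and "\<And>f k v. P f \<Longrightarrow> P (f + Poly_Mapping.single k v)"
  shows "P (f :: 'b \<Rightarrow>\<^sub>0 'c::monoid_add)"
proof (induction f rule: update_induct)
  case const
  then show ?case by (rule assms(1))
next
  case (update f k v)
  have "Poly_Mapping.update k v f = f + Poly_Mapping.single k v"
    using update(1)
    by (intro poly_mapping_eqI) (auto simp: lookup_update lookup_add lookup_single in_keys_iff when_def)
  then show ?case
    using assms(2) update by metis
qed

text \<open>The values are univariate polynomials and not field elements: substituting a pencil
  \<open>x + t y\<close> extracts the derivative even when the field has few elements.\<close>

definition cpoly_eval :: "(coord \<Rightarrow> 'a poly) \<Rightarrow> 'a::comm_ring_1 cpoly \<Rightarrow> 'a poly" where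
  "cpoly_eval X p = (\<Sum>m\<in>Poly_Mapping.keys p.
     [:Poly_Mapping.lookup p m:] * (\<Prod>i\<in>UNIV. X i ^ Poly_Mapping.lookup m i))"

lemma cpoly_eval_add: "cpoly_eval X (p + q) = cpoly_eval X p + cpoly_eval X q"
proof -
  have "[:a + b:] * c = [:a:] * c + [:b:] * c" for a b :: 'a and c
    by (metis add_0 add_pCons distrib_right)
  then show ?thesis
    unfolding cpoly_eval_def
    by (intro setsum_keys_plus_distrib[where f = "\<lambda>m c. [:c:] * (\<Prod>i\<in>UNIV. X i ^ Poly_Mapping.lookup m i)"]) auto
qed

lemma cpoly_eval_single:
  "cpoly_eval X (Poly_Mapping.single m c) = [:c:] * (\<Prod>i\<in>UNIV. X i ^ Poly_Mapping.lookup m i)"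
  by (cases "c = 0") (simp_all add: cpoly_eval_def)

lemma cpoly_eval_zero: "cpoly_eval X 0 = 0"
  by (simp add: cpoly_eval_def)

lemma cpoly_eval_mult: "cpoly_eval X (p * q) = cpoly_eval X p * cpoly_eval X q"
proof (induction p rule: poly_mapping_add_single_induct)
  case 1
  then show ?case by (simp add: cpoly_eval_zero)
next
  case (2 p m c)
  have "cpoly_eval X (Poly_Mapping.single m c * q) = cpoly_eval X (Poly_Mapping.single m c) * cpoly_eval X q"
  proof (induction q rule: poly_mapping_add_single_induct)
    case 1
    then show ?case by (simp add: cpoly_eval_zero)
  next
    case (2 q n d)
    then show ?case
      by (simp add: distrib_left cpoly_eval_add mult_single cpoly_eval_single lookup_add power_add
          prod.distrib mult_ac)
  qed
  with 2 show ?case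
    by (simp add: distrib_right cpoly_eval_add)
qed

lemma cpoly_eval_uminus: "cpoly_eval X (- p) = - cpoly_eval X p"
  using cpoly_eval_add[of X p "- p"] by (simp add: cpoly_eval_zero eq_neg_iff_add_eq_0 add.commute)

lemma cpoly_eval_diff: "cpoly_eval X (p - q) = cpoly_eval X p - cpoly_eval X q"
  using cpoly_eval_add[of X p "- q"] by (simp add: cpoly_eval_uminus)

lemma cpoly_eval_sum: "cpoly_eval X (\<Sum>j\<in>S. g j) = (\<Sum>j\<in>S. cpoly_eval X (g j))"
  by (induction S rule: infinite_finite_induct) (simp_all add: cpoly_eval_zero cpoly_eval_add)

lemma cpoly_eval_const: "cpoly_eval X (cconst c) = [:c:]"
  by (simp add: cconst_def cpoly_eval_single)

lemma cpoly_eval_var: "cpoly_eval X (cvar i) = X i"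
proof -
  have "(\<Prod>j\<in>UNIV. X j ^ Poly_Mapping.lookup (Poly_Mapping.single i 1) j) = (\<Prod>j\<in>UNIV. if j = i then X j else 1)"
    by (intro prod.cong) (auto simp: lookup_single when_def)
  then show ?thesis
    by (simp add: cvar_def cpoly_eval_single)
qed

text \<open>Both forms have integer coefficients, so they commute with maps of rings. This serves
  the evaluation of polynomials as well as the embeddings of constants.\<close>

lemma df_det_hom:
  fixes \<phi> :: "'a::comm_ring_1 \<Rightarrow> 'b::comm_ring_1"
  assumes "\<And>x y. \<phi> (x + y) = \<phi> x + \<phi> y" "\<And>x y. \<phi> (x * y) = \<phi> x * \<phi> y"
    "\<And>x y. \<phi> (x - y) = \<phi> x - \<phi> y"
  shows "df_det (\<chi> i. \<phi> (v $ i)) = \<phi> (df_det v)"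
    and "det_deriv (\<chi> i. \<phi> (v $ i)) (\<chi> i. \<phi> (w $ i)) = \<phi> (det_deriv v w)"
  by (simp_all add: df_det_def det_deriv_def oct_norm_def oct_tr_def oct_inner_def sum_label sum_base
      oct_mult_nth part_nth assms)

text \<open>The vector is \<open>u + t v\<close> over the univariate polynomials, and the
  coefficients are those of the expansion in \<open>t\<close>.\<close>

lemma df_det_pencil:
  "df_det (\<chi> i. [:u $ i, v $ i:]) = [:df_det u, det_deriv u v, det_deriv v u, df_det v:]"
proof -
  have "(\<chi> i. [:u $ i, v $ i:]) = (\<chi> i. [:u $ i:]) + [:0, 1:] *s (\<chi> i. [:v $ i:])"
    by (simp add: vec_eq_iff)
  then show ?thesis
    by (simp add: df_det_add df_det_scale det_deriv_scale det_deriv_linear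
        df_det_hom[where \<phi> = "\<lambda>x. [:x:]"] power2_eq_square power3_eq_cube)
qed

text \<open>Expanding one summand at a time expresses the cubic form of a linear combination by
  these three kinds of values, without any division. The ring is general because the coefficients
  \<open>X j\<close> will be the 27 variables.\<close>

lemma df_det_sum_cong:
  fixes w w' :: "'i \<Rightarrow> 'r::comm_ring_1 albert"
  assumes "\<And>j. df_det (w j) = df_det (w' j)"
    and "\<And>j k. det_deriv (w j) (w k) = det_deriv (w' j) (w' k)"
    and "\<And>j k l. det_tri (w j) (w k) (w l) = det_tri (w' j) (w' k) (w' l)"
  shows "df_det (\<Sum>j\<in>S. X j *s w j) = df_det (\<Sum>j\<in>S. X j *s w' j)"
proof -
  have tri: "det_tri (\<Sum>j\<in>S. X j *s w j) (w k) (w l) = det_tri (\<Sum>j\<in>S. X j *s w' j) (w' k) (w' l)" for S k l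
    by (induction S rule: infinite_finite_induct) (simp_all add: det_tri_add det_tri_scale assms)
  have tri': "det_tri (w k) (\<Sum>j\<in>S. X j *s w j) (w l) = det_tri (w' k) (\<Sum>j\<in>S. X j *s w' j) (w' l)" for S k l
    by (subst (1 2) det_tri_commute(1)) (rule tri)
  have quad: "det_deriv (\<Sum>j\<in>S. X j *s w j) (w k) = det_deriv (\<Sum>j\<in>S. X j *s w' j) (w' k)" for S k
    by (induction S rule: infinite_finite_induct)
      (simp_all add: det_deriv_add det_deriv_scale det_tri_scale assms tri')
  have lin: "det_deriv (w k) (\<Sum>j\<in>S. X j *s w j) = det_deriv (w' k) (\<Sum>j\<in>S. X j *s w' j)" for S k
    by (induction S rule: infinite_finite_induct) (simp_all add: det_deriv_linear assms)
  show ?thesis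
    by (induction S rule: infinite_finite_induct)
      (simp_all add: df_det_add df_det_scale det_deriv_linear det_deriv_scale assms quad lin)
qed

lemma cconst_hom:
  "cconst (x + y) = cconst x + cconst y" "cconst (x * y) = cconst x * cconst y"
  "cconst (x - y) = cconst x - (cconst y :: 'a::comm_ring_1 cpoly)"
  by (simp_all add: cconst_def single_add mult_single single_diff)

lemma det_tri_eq: "det_tri x y z = det_deriv (x + y) z - det_deriv x z - det_deriv y z"
  by (simp add: det_deriv_add)

abbreviation albert_linear :: "('a::field albert \<Rightarrow> 'a albert) \<Rightarrow> bool" where
  "albert_linear \<equiv> Vector_Spaces.linear (*s) (*s)"

lemma albert_linear_expand:
  assumes "albert_linear f"
  shows "f x $ i = (\<Sum>j\<in>UNIV. f (axis j 1) $ i * x $ j)"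
proof -
  have "f x = f (\<Sum>j\<in>UNIV. x $ j *s axis j 1)"
    by (simp only: basis_expansion)
  also have "\<dots> = (\<Sum>j\<in>UNIV. x $ j *s f (axis j 1))"
    using assms by (simp add: vec.linear_sum vec.linear_scale)
  finally show ?thesis
    by (simp add: mult.commute)
qed

text \<open>The identity of polynomials is evaluated at the pencil \<open>x + t y\<close>; the
  coefficients of 1 and of \<open>t\<close> are compared.\<close>

lemma preserves_det_imp:
  assumes "albert_linear f" "preserves_det f"
  shows "df_det (f x) = df_det x" "det_deriv (f x) (f y) = det_deriv x y"
proof -
  let ?ev = "cpoly_eval (\<lambda>i. [:x $ i, y $ i:])"
  have "[:df_det x, det_deriv x y, det_deriv y x, df_det y:] = df_det (\<chi> i. ?ev ((\<chi> i. cvar i) $ i))"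
    by (simp add: cpoly_eval_var df_det_pencil)
  also have "\<dots> = ?ev det_form"
    by (simp only: det_form_def df_det_hom[of ?ev] cpoly_eval_add cpoly_eval_mult cpoly_eval_diff)
  also have "\<dots> = ?ev (det_form_subst f)"
    using assms(2) by (simp add: preserves_det_def)
  also have "\<dots> = df_det (\<chi> i. ?ev ((\<chi> i. \<Sum>j\<in>UNIV. cconst (f (axis j 1) $ i) * cvar j) $ i))"
    by (simp only: det_form_subst_def df_det_hom[of ?ev] cpoly_eval_add cpoly_eval_mult cpoly_eval_diff)
  also have "(\<chi> i. ?ev ((\<chi> i. \<Sum>j\<in>UNIV. cconst (f (axis j 1) $ i) * cvar j) $ i)) = (\<chi> i. [:f x $ i, f y $ i:])"
  proof -
    have "(\<Sum>j\<in>S. [:x $ j * g j, y $ j * g j:]) = [:\<Sum>j\<in>S. x $ j * g j, \<Sum>j\<in>S. y $ j * g j:]" for g S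
      by (induction S rule: infinite_finite_induct) simp_all
    then show ?thesis
      by (simp add: cpoly_eval_sum cpoly_eval_mult cpoly_eval_const cpoly_eval_var
          albert_linear_expand[OF assms(1), of x] albert_linear_expand[OF assms(1), of y] mult.commute[of "f _ $ _"])
  qed
  finally show "df_det (f x) = df_det x" "det_deriv (f x) (f y) = det_deriv x y"
    by (simp_all add: df_det_pencil)
qed

text \<open>\<open>det_form_subst f\<close> is the determinant of the combination of the images of
  the basis vectors whose coefficients are the variables, so \<open>df_det_sum_cong\<close> applies.
  Its trilinear hypothesis follows from linearity, since \<open>det_tri\<close> is a difference of
  derivatives.\<close>

lemma preserves_detI:
  assumes "albert_linear f"
    and "\<And>x. df_det (f x) = df_det x" "\<And>x y. det_deriv (f x) (f y) = det_deriv x y"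
  shows "preserves_det f"
proof -
  let ?c = "\<lambda>v :: 'a albert. \<chi> i. (cconst (v $ i) :: 'a cpoly)"
  have det: "df_det (?c u) = cconst (df_det u)" "det_deriv (?c u) (?c v) = cconst (det_deriv u v)" for u v
    by (simp_all add: df_det_hom[where \<phi> = cconst] cconst_hom)
  have tri: "det_tri (?c u) (?c v) (?c w) = cconst (det_tri u v w)" for u v w
  proof -
    have "?c u + ?c v = ?c (u + v)"
      by (simp add: vec_eq_iff cconst_hom)
    then show ?thesis
      by (simp only: det_tri_eq det cconst_hom)
  qed
  have "det_tri (f u) (f v) (f w) = det_tri u v w" for u v w
    using assms by (simp add: det_tri_eq flip: vec.linear_add)
  then have "df_det (\<Sum>j\<in>UNIV. cvar j *s ?c (f (axis j 1))) = df_det (\<Sum>j\<in>UNIV. cvar j *s ?c (axis j 1))"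
    by (intro df_det_sum_cong) (simp_all add: det tri assms)
  moreover have "(\<Sum>j\<in>UNIV. cvar j *s ?c (f (axis j 1))) =
      (\<chi> i. \<Sum>j\<in>UNIV. cconst (f (axis j 1) $ i) * cvar j)"
    by (simp add: vec_eq_iff mult.commute)
  moreover have "(\<Sum>j\<in>UNIV. cvar j *s ?c (axis j 1)) = (\<chi> i. cvar i)"
  proof -
    have "?c (axis j 1) = axis j 1" for j
      by (auto simp: vec_eq_iff axis_def cconst_def)
    then show ?thesis
      by (simp only: basis_expansion[of "(\<chi> i. cvar i) :: 'a cpoly albert", simplified])
  qed
  ultimately show ?thesis
    by (simp add: preserves_det_def det_form_subst_def det_form_def)
qed

section \<open>The group\<close>

lemma SE6_iff:
  "f \<in> carrier SE6 \<longleftrightarrow> albert_linear f \<and> (\<forall>x. df_det (f x) = df_det x) \<and>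
     (\<forall>x y. det_deriv (f x) (f y) = det_deriv x y)"
  using preserves_det_imp[of f] preserves_detI[of f] by (auto simp: SE6_def)

lemma SE6_mult [simp]: "f \<otimes>\<^bsub>SE6\<^esub> g = f \<circ> g" and SE6_one [simp]: "\<one>\<^bsub>SE6\<^esub> = id"
  by (simp_all add: SE6_def)

lemma albert_linearI:
  assumes "\<And>x y. f (x + y) = f x + f y" "\<And>r x. f (r *s x) = r *s f x"
  shows "albert_linear f"
  using assms vec.vector_space_axioms
  by (simp add: Vector_Spaces.linear_def module_hom_def module_hom_axioms_def vec.module_axioms vector_space_def)

lemma SE6_linear:
  assumes "f \<in> carrier SE6"
  shows "albert_linear f" "f (x + y) = f x + f y" "f (c *s x) = c *s f x" "f 0 = 0"
    "f (x - y) = f x - f y"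
  using assms by (simp_all add: SE6_iff vec.linear_add vec.linear_scale vec.linear_0 vec.linear_diff)

lemma SE6_det:
  assumes "f \<in> carrier SE6"
  shows "df_det (f x) = df_det x" "det_deriv (f x) (f y) = det_deriv x y"
    "det_tri (f x) (f y) (f z) = det_tri x y z"
  using assms by (simp_all add: SE6_iff det_tri_eq flip: vec.linear_add)

text \<open>The derivative at a sum of two diagonal units reads off the third diagonal coordinate.
  Adding an octonion \<open>y\<close> off the diagonal to one unit then reads off an inner product
  with \<open>y\<close>. This is what makes isometries injective.\<close>

lemma det_deriv_nondegenerate:
  assumes "\<And>y. det_deriv y x = 0"
  shows "x = 0"
proof -
  have 1: "x $ Ca = 0"
    using assms[of "herm 0 1 1 0 0 0"] by (simp add: det_deriv_def)
  have 2: "x $ Cb = 0"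
    using assms[of "herm 1 0 1 0 0 0"] by (simp add: det_deriv_def)
  have 3: "x $ Cc = 0"
    using assms[of "herm 1 1 0 0 0 0"] by (simp add: det_deriv_def)
  have "oct_inner (A_part x) y = 0" "oct_inner (B_part x) y = 0" "oct_inner (C_part x) y = 0" for y
    using assms[of "herm 1 0 0 y 0 0"] assms[of "herm 0 1 0 0 y 0"] assms[of "herm 0 0 1 0 0 y"] 1 2 3
    by (simp_all add: det_deriv_def oct_inner_commute)
  then have "A_part x = 0" "B_part x = 0" "C_part x = 0"
    using oct_nondegenerate by blast+
  with 1 2 3 show ?thesis
    by (simp add: albert_eq_iff)
qed

lemma SE6_bij:
  assumes "f \<in> carrier SE6"
  shows "bij f"
proof -
  have "inj f"
  proof (subst vec.linear_inj_iff_eq_0)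
    show "\<forall>x. f x = 0 \<longrightarrow> x = 0"
    proof (intro allI impI)
      fix x
      assume "f x = 0"
      then have "det_deriv y x = 0" for y
        using SE6_det(2)[OF assms, of y x] by simp
      then show "x = 0"
        by (rule det_deriv_nondegenerate)
    qed
  qed (use assms in \<open>simp add: SE6_linear\<close>)
  then show ?thesis
    using vec.linear_inj_imp_surj[OF SE6_linear(1)[OF assms]] by (simp add: bij_def)
qed

lemma SE6_inv_into:
  assumes "f \<in> carrier SE6"
  shows "inv_into UNIV f \<in> carrier SE6" "inv_into UNIV f (f x) = x" "f (inv_into UNIV f x) = x"
proof -
  have bij: "bij f" by (rule SE6_bij[OF assms])
  show *: "inv_into UNIV f (f x) = x" "f (inv_into UNIV f x) = x" for x
    using bij by (simp_all add: bij_is_inj bij_is_surj surj_f_inv_f)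
  show "inv_into UNIV f \<in> carrier SE6"
    using vec.inj_linear_imp_inv_linear[OF SE6_linear(1)[OF assms] bij_is_inj[OF bij]]
      SE6_det(1)[OF assms, of "inv_into UNIV f _"] SE6_det(2)[OF assms, of "inv_into UNIV f _" "inv_into UNIV f _"]
    by (simp add: SE6_iff *)
qed

lemma SE6_comp: "f \<in> carrier SE6 \<Longrightarrow> g \<in> carrier SE6 \<Longrightarrow> f \<circ> g \<in> carrier SE6"
  by (auto simp: SE6_iff intro!: Vector_Spaces.linear_compose)

lemma SE6_id: "id \<in> carrier SE6"
  using vec.linear_id by (simp add: SE6_iff id_def)

lemma SE6_group: "group SE6"
proof (rule groupI)
  fix f :: "'a albert \<Rightarrow> 'a albert"
  assume f: "f \<in> carrier SE6"
  then have "inv_into UNIV f \<circ> f = id"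
    by (auto simp: SE6_inv_into)
  with f show "\<exists>g\<in>carrier SE6. g \<otimes>\<^bsub>SE6\<^esub> f = \<one>\<^bsub>SE6\<^esub>"
    by (auto intro: SE6_inv_into)
qed (auto simp: SE6_id comp_assoc intro: SE6_comp)

lemma SE6_inv: "f \<in> carrier SE6 \<Longrightarrow> inv\<^bsub>SE6\<^esub> f = inv_into UNIV f"
proof (rule group.inv_equality[OF SE6_group])
  assume "f \<in> carrier SE6"
  then show "inv_into UNIV f \<otimes>\<^bsub>SE6\<^esub> f = \<one>\<^bsub>SE6\<^esub>"
    by (auto simp: SE6_inv_into)
qed (auto intro: SE6_inv_into)

lemma E12_SE6: "E12 x \<in> carrier SE6"
proof -
  have "albert_linear (E12 x)"
    by (intro albert_linearI)
       (simp_all add: E12_def herm_linear oct_linear vector_sadd_rdistrib vector_ssub_ldistrib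
          vec.scale_right_distrib algebra_simps)
  then show ?thesis
    by (simp add: SE6_iff df_det_E12 det_deriv_E12)
qed

lemma E21_SE6: "E21 x \<in> carrier SE6"
proof -
  have "albert_linear (E21 x)"
    by (intro albert_linearI)
       (simp_all add: E21_def herm_linear oct_linear vector_sadd_rdistrib
          vec.scale_right_distrib algebra_simps)
  then show ?thesis
    by (simp add: SE6_iff det_E21)
qed

lemma rot_SE6: "rot \<in> carrier SE6"
proof -
  have "albert_linear rot"
    by (intro albert_linearI) (simp_all add: rot_def herm_linear)
  then show ?thesis
    by (simp add: SE6_iff det_rot)
qed

text \<open>Under the cyclic symmetry \<open>E12\<close>, \<open>E23\<close> and \<open>E31\<close>
  carry their parameter as the matrix entry, while \<open>E21\<close>, \<open>E32\<close> and
  \<open>E13\<close> carry its conjugate.\<close>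

definition E23 :: "'a::comm_ring_1 oct \<Rightarrow> 'a albert \<Rightarrow> 'a albert" where "E23 x = rot \<circ> rot \<circ> E12 x \<circ> rot"
definition E32 :: "'a::comm_ring_1 oct \<Rightarrow> 'a albert \<Rightarrow> 'a albert" where "E32 x = rot \<circ> rot \<circ> E21 x \<circ> rot"
definition E31 :: "'a::comm_ring_1 oct \<Rightarrow> 'a albert \<Rightarrow> 'a albert" where "E31 x = rot \<circ> E12 x \<circ> (rot \<circ> rot)"
definition E13 :: "'a::comm_ring_1 oct \<Rightarrow> 'a albert \<Rightarrow> 'a albert" where "E13 x = rot \<circ> E21 x \<circ> (rot \<circ> rot)"

lemma elementary_herm [simp]:
  "E12 x (herm a b c A B C) =
     herm (a + oct_inner x C + b * oct_norm x) b c A (B + oct_conj (x \<odot> A)) (C + b *s x)"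
  "E21 x (herm a b c A B C) =
     herm a (b + oct_inner x C + a * oct_norm x) c (A + oct_conj (B \<odot> x)) B (C + a *s x)"
  "E23 x (herm a b c A B C) =
     herm a (b + oct_inner x A + c * oct_norm x) c (A + c *s x) B (C + oct_conj (x \<odot> B))"
  "E32 x (herm a b c A B C) =
     herm a b (c + oct_inner x A + b * oct_norm x) (A + b *s x) (B + oct_conj (C \<odot> x)) C"
  "E31 x (herm a b c A B C) =
     herm a b (c + oct_inner x B + a * oct_norm x) (A + oct_conj (x \<odot> C)) (B + a *s x) C"
  "E13 x (herm a b c A B C) =
     herm (a + oct_inner x B + c * oct_norm x) b c A (B + c *s x) (C + oct_conj (A \<odot> x))"
  by (simp_all add: E12_def E21_def E23_def E32_def E31_def E13_def rot_def)

lemma elementary_SE6: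
  "E12 x \<in> carrier SE6" "E21 x \<in> carrier SE6" "E23 x \<in> carrier SE6"
  "E32 x \<in> carrier SE6" "E31 x \<in> carrier SE6" "E13 x \<in> carrier SE6"
  by (simp_all add: E23_def E32_def E31_def E13_def E12_SE6 E21_SE6 rot_SE6 SE6_comp)

section \<open>White vectors\<close>

text \<open>These are the elements of rank one; up to scalars they are the points of the Cayley
  plane.\<close>

definition white :: "'a::comm_ring_1 albert \<Rightarrow> bool" where
  "white w \<longleftrightarrow> w \<noteq> 0 \<and> (\<forall>y. det_deriv w y = 0)"

text \<open>By cyclicity of the trace the derivative is the pairing with one fixed vector, the
  adjoint. Nondegeneracy makes its six components vanish separately.\<close>

lemma white_herm:
  "white (herm a b c A B C) \<longleftrightarrow> herm a b c A B C \<noteq> 0 \<and>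
     b * c = oct_norm A \<and> c * a = oct_norm B \<and> a * b = oct_norm C \<and>
     B \<odot> C = a *s oct_conj A \<and> C \<odot> A = b *s oct_conj B \<and> A \<odot> B = c *s oct_conj C"
  (is "?l \<longleftrightarrow> ?n \<and> ?r")
proof -
  have tr: "oct_tr (x \<odot> y) = oct_inner (oct_conj y) x" for x y :: "'a oct"
    by (simp add: oct_tr_mult_eq_inner oct_inner_commute)
  have *: "det_deriv (herm a b c A B C) y =
      y $ Ca * (b * c - oct_norm A) + y $ Cb * (c * a - oct_norm B) + y $ Cc * (a * b - oct_norm C) +
      oct_inner (oct_conj (B \<odot> C) - a *s A) (A_part y) +
      oct_inner (oct_conj (C \<odot> A) - b *s B) (B_part y) +
      oct_inner (oct_conj (A \<odot> B) - c *s C) (C_part y)" for y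
  proof -
    have "oct_tr (A \<odot> (B_part y \<odot> C)) = oct_tr (B_part y \<odot> (C \<odot> A))"
      "oct_tr (A \<odot> (B \<odot> C_part y)) = oct_tr (C_part y \<odot> (A \<odot> B))"
      by (metis oct_tr_rotate)+
    then show ?thesis
      by (simp only: det_deriv_def herm_sel) (simp add: tr oct_inner_diff algebra_simps)
  qed
  have conj_eq: "oct_conj x = r *s z \<longleftrightarrow> x = r *s oct_conj z" for x z :: "'a oct" and r
    by (metis oct_conj_linear(2,6))
  have "(\<forall>y. det_deriv (herm a b c A B C) y = 0) \<longleftrightarrow> ?r"
  proof
    assume d: "\<forall>y. det_deriv (herm a b c A B C) y = 0"
    have "oct_conj (B \<odot> C) - a *s A = 0" "oct_conj (C \<odot> A) - b *s B = 0" "oct_conj (A \<odot> B) - c *s C = 0"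
      using d[unfolded *, rule_format, of "herm 0 0 0 _ 0 0"] d[unfolded *, rule_format, of "herm 0 0 0 0 _ 0"]
        d[unfolded *, rule_format, of "herm 0 0 0 0 0 _"]
      by (auto simp del: right_minus_eq eq_iff_diff_eq_0[symmetric] intro!: oct_nondegenerate)
    then show ?r
      using d[unfolded *, rule_format, of "herm 1 0 0 0 0 0"] d[unfolded *, rule_format, of "herm 0 1 0 0 0 0"]
        d[unfolded *, rule_format, of "herm 0 0 1 0 0 0"]
      by (simp add: conj_eq)
  next
    assume ?r
    then show "\<forall>y. det_deriv (herm a b c A B C) y = 0"
      by (simp add: *)
  qed
  then show ?thesis
    by (simp add: white_def)
qed

lemma white_SE6:
  assumes "f \<in> carrier SE6" "white w"
  shows "white (f w)"
proof -
  have "det_deriv (f w) y = 0" for y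
    using SE6_det(2)[OF assms(1), of w "inv_into UNIV f y"] assms by (simp add: SE6_inv_into white_def)
  moreover have "f w \<noteq> 0"
    using assms SE6_inv_into(2)[OF assms(1), of w] SE6_inv_into(2)[OF assms(1), of 0]
    by (auto simp: white_def SE6_linear)
  ultimately show ?thesis
    by (simp add: white_def)
qed

lemma herm_eq_0_iff: "herm a b c A B C = 0 \<longleftrightarrow> a = 0 \<and> b = 0 \<and> c = 0 \<and> A = 0 \<and> B = 0 \<and> C = 0"
  by (simp flip: herm_linear(3))

text \<open>The hyperbolic plane spanned by \<open>e_0\<close> and \<open>e_{-0}\<close> already
  takes every value.\<close>

lemma oct_norm_surj: "\<exists>x :: 'a::comm_ring_1 oct. oct_norm x = s"
  by (rule exI[of _ "axis (Pos Zero) 1 + axis (Neg Zero) s"]) (simp add: oct_norm_add)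

lemma oct_inner_surj: "x \<noteq> 0 \<Longrightarrow> \<exists>y :: 'a::field oct. oct_inner y x = s"
proof -
  assume "x \<noteq> 0"
  then obtain z where "oct_inner x z \<noteq> 0"
    using oct_nondegenerate by blast
  then have "oct_inner ((s / oct_inner x z) *s z) x = s"
    by (simp add: oct_inner_commute)
  then show ?thesis ..
qed

section \<open>Siegel transformations of the norm form\<close>

lemma neg_eq_label [simp]:
  "neg j = Pos b \<longleftrightarrow> j = Neg b" "Pos b = neg j \<longleftrightarrow> j = Neg b"
  "neg j = Neg b \<longleftrightarrow> j = Pos b" "Neg b = neg j \<longleftrightarrow> j = Pos b"
  by (cases j; auto)+

text \<open>Since \<open>X $ k\<close> and \<open>X $ neg j\<close> are the inner products of
  \<open>X\<close> with \<open>e_{-k}\<close> and \<open>e_j\<close>, this is a Siegel (Eichler)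
  transformation for a pair of basis vectors. It adds \<open>t\<close> times coordinate
  \<open>k\<close> to coordinate \<open>j\<close> and compensates at coordinate
  \<open>-k\<close>.\<close>

definition siegel :: "label \<Rightarrow> label \<Rightarrow> 'a::comm_ring_1 \<Rightarrow> 'a oct \<Rightarrow> 'a oct" where
  "siegel j k t X = X + axis j (t * X $ k) - axis (neg k) (t * X $ neg j)"

lemma siegel_nth: "siegel j k t X $ l =
    X $ l + (if l = j then t * X $ k else 0) - (if l = neg k then t * X $ neg j else 0)"
  by (simp add: siegel_def axis_def)

lemma oct_norm_siegel:
  assumes "j \<noteq> k" "j \<noteq> neg k"
  shows "oct_norm (siegel j k t X) = oct_norm X"
proof -
  have "axis j (t * X $ k) $ k = 0"
    using assms by (simp add: axis_def)
  then show ?thesis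
    by (simp add: siegel_def diff_conv_add_uminus oct_norm_add oct_inner_add del: add_uminus_conv_diff)
qed

text \<open>An abstract elimination with pivot \<open>k\<close>. \<open>R\<close> is reachability in
  some stabilizer, \<open>P\<close> an invariant such as singularity or a support condition,
  \<open>J\<close> the labels that may be cleared, and \<open>final\<close> says that
  \<open>P\<close> settles all other coordinates. Each link of the stabilizer chain brings its own
  instance.\<close>

locale siegel_moves =
  fixes R :: "'a::field oct \<Rightarrow> 'a oct \<Rightarrow> bool" and P :: "'a oct \<Rightarrow> bool" and J :: "label set" and k
  assumes R_refl: "R X X" and R_trans: "R X Y \<Longrightarrow> R Y Z \<Longrightarrow> R X Z"
    and J: "k \<notin> J" "neg k \<notin> J"
    and move: "j \<in> J \<Longrightarrow> P X \<Longrightarrow> R X (siegel j k t X)" "j \<in> J \<Longrightarrow> P X \<Longrightarrow> P (siegel j k t X)"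
    and final: "P X \<Longrightarrow> X $ k = 1 \<Longrightarrow> (\<And>j. j \<in> J \<Longrightarrow> X $ j = 0) \<Longrightarrow> X = axis k 1"
begin

text \<open>Subtracting multiples of the pivot clears the labels in \<open>J\<close> one by one. The
  compensating term falls on \<open>neg k\<close>, which is outside \<open>J\<close>, so nothing
  already cleared is disturbed.\<close>

lemma clear:
  assumes "P X" "X $ k = 1"
  shows "R X (axis k 1)"
proof -
  have "\<exists>Y. R X Y \<and> P Y \<and> Y $ k = 1 \<and> (\<forall>j\<in>I. Y $ j = 0)" if "finite I" "I \<subseteq> J" for I
    using that
  proof induction
    case empty
    show ?case
      using assms R_refl by blast
  next
    case (insert j I)
    then obtain Y where Y: "R X Y" "P Y" "Y $ k = 1" "\<forall>i\<in>I. Y $ i = 0"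
      by blast
    let ?Z = "siegel j k (- Y $ j) Y"
    have j: "j \<in> J" "j \<noteq> k" "j \<noteq> neg k" and k: "k \<noteq> j" "\<And>i. i \<in> I \<Longrightarrow> i \<noteq> neg k"
      using insert.prems J by blast+
    have "?Z $ i = 0" if "i \<in> insert j I" for i
      using that j k Y(3,4) by (auto simp: siegel_nth)
    moreover have "?Z $ k = 1"
      using Y(3) k(1) by (simp add: siegel_nth)
    moreover have "R X ?Z" "P ?Z"
      using R_trans[OF Y(1) move(1)[OF j(1) Y(2)]] move(2)[OF j(1) Y(2)] by blast+
    ultimately show ?case
      by blast
  qed
  from this[of J] show ?thesis
    using final finite[of J] by blast
qed

end

locale siegel_moves_sym = siegel_moves +
  assumes J_nonempty: "J \<noteq> {}"
    and move': "j \<in> J \<Longrightarrow> P X \<Longrightarrow> R X (siegel k j t X)" "j \<in> J \<Longrightarrow> P X \<Longrightarrow> P (siegel k j t X)"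
begin

lemma reach_axis_if_J:
  assumes "P X" "j \<in> J" "X $ j \<noteq> 0"
  shows "R X (axis k 1)"
proof -
  \<comment> \<open>The factor is chosen so that the pivot coordinate becomes 1.\<close>
  let ?Y = "siegel k j ((1 - X $ k) / X $ j) X"
  have "k \<noteq> neg j"
    using J assms(2) by auto
  then have "?Y $ k = 1"
    using assms by (simp add: siegel_nth)
  then show ?thesis
    using R_trans[OF move'(1)[OF assms(2,1)] clear] move'(2)[OF assms(2,1)] by blast
qed

lemma reach_axis:
  assumes "P X" "i \<in> insert k J" "X $ i \<noteq> 0"
  shows "R X (axis k 1)"
proof (cases "\<exists>j\<in>J. X $ j \<noteq> 0")
  case False
  then have "X $ k \<noteq> 0"
    using assms by auto
  obtain j where j: "j \<in> J"
    using J_nonempty by blast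
  with False J \<open>X $ k \<noteq> 0\<close> have "siegel j k 1 X $ j \<noteq> 0"
    by (auto simp: siegel_nth)
  then show ?thesis
    using R_trans[OF move(1)[OF j assms(1)] reach_axis_if_J[OF move(2)[OF j assms(1)] j]] by blast
qed (use assms reach_axis_if_J in blast)

end

text \<open>Such a vector is \<open>e_k + s e_{-k}\<close>, and its norm is
  \<open>s\<close>.\<close>

lemma oct_norm_eq_0_axis:
  assumes "oct_norm X = 0" "X $ k = 1" "\<And>j. j \<noteq> k \<Longrightarrow> j \<noteq> neg k \<Longrightarrow> X $ j = 0"
  shows "X = axis k (1 :: 'a::field)"
proof -
  have eq: "X = axis k 1 + axis (neg k) (X $ neg k)"
    using assms(2,3) by (auto simp: vec_eq_iff axis_def)
  have "oct_norm X = X $ neg k"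
    by (subst eq) (simp add: oct_norm_add)
  with assms(1) have "axis (neg k) (X $ neg k) = 0"
    by (auto simp: vec_eq_iff axis_def)
  with eq show ?thesis
    by simp
qed

lemma singular_reach:
  fixes X :: "'a::field oct"
  assumes "\<And>X. R X X" "\<And>X Y Z. R X Y \<Longrightarrow> R Y Z \<Longrightarrow> R X Z"
    and move: "\<And>X j k t. j \<noteq> k \<Longrightarrow> j \<noteq> neg k \<Longrightarrow> R X (siegel j k t X)"
    and X: "X \<noteq> 0" "oct_norm X = 0"
  shows "R X (axis (Pos Zero) 1)"
proof -
  interpret siegel_moves_sym R "\<lambda>X. oct_norm X = 0" "- {Pos Zero, Neg Zero}" "Pos Zero"
    by unfold_locales
      (use assms in \<open>auto simp: oct_norm_siegel intro!: oct_norm_eq_0_axis move exI[of _ "Pos One"]\<close>)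
  obtain i where i: "X $ i \<noteq> 0"
    using X by (auto simp: vec_eq_iff)
  show ?thesis
  proof (cases "i = Neg Zero")
    case False
    then show ?thesis
      using reach_axis[of X i] i X by auto
  next
    case True
    show ?thesis
    proof (cases "X $ Pos One = 0")
      case False
      then show ?thesis
        using reach_axis[of X "Pos One"] X by auto
    next
      case zero: True
      \<comment> \<open>The label \<open>Neg Zero\<close> is neither the pivot nor among the labels
        in the interpreted set, so its coordinate is first copied to \<open>Pos One\<close>.\<close>
      let ?Y = "siegel (Pos One) (Neg Zero) 1 X"
      have "?Y $ Pos One \<noteq> 0"
        using zero i True by (simp add: siegel_nth)
      then have "R ?Y (axis (Pos Zero) 1)"
        using reach_axis[of ?Y "Pos One"] X by (simp add: oct_norm_siegel)
      then show ?thesis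
        using assms(2)[OF assms(3)[of "Pos One" "Neg Zero"]] by simp
    qed
  qed
qed

section \<open>Transitivity of groups containing the elementary maps\<close>

abbreviation "ea \<equiv> herm 1 0 0 0 0 0"
abbreviation "eb \<equiv> herm 0 1 0 0 0 0"
abbreviation "ec \<equiv> herm 0 0 1 0 0 0"

text \<open>The subgroup is a parameter because the generation theorem is applied to three subgroups
  in turn: the whole group, to obtain transitivity, the product of a normal subgroup with
  \<open>unipotent ea\<close>, and the normal subgroup itself.\<close>

locale elementary_group =
  fixes H :: "('a::field albert \<Rightarrow> 'a albert) set"
  assumes H_subset: "H \<subseteq> carrier SE6"
    and H_id: "id \<in> H"
    and H_comp: "f \<in> H \<Longrightarrow> g \<in> H \<Longrightarrow> f \<circ> g \<in> H"
    and H_inv: "f \<in> H \<Longrightarrow> inv_into UNIV f \<in> H"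
    and H_elementary: "E12 x \<in> H" "E21 x \<in> H" "E23 x \<in> H" "E32 x \<in> H" "E31 x \<in> H" "E13 x \<in> H"
begin

text \<open>The set \<open>V\<close> holds the vectors already fixed in the stabilizer
  chain.\<close>

definition reach :: "'a albert set \<Rightarrow> 'a albert \<Rightarrow> 'a albert \<Rightarrow> bool" where
  "reach V v w \<longleftrightarrow> (\<exists>h\<in>H. (\<forall>u\<in>V. h u = u) \<and> h v = w)"

lemma reachI: "h \<in> H \<Longrightarrow> (\<And>u. u \<in> V \<Longrightarrow> h u = u) \<Longrightarrow> h v = w \<Longrightarrow> reach V v w"
  by (auto simp: reach_def)

lemma reach_refl: "reach V v v"
  by (rule reachI[OF H_id]) simp_all

lemma reach_trans:
  assumes "reach V u v" "reach V v w"
  shows "reach V u w"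
proof -
  obtain f g where "f \<in> H" "\<forall>u\<in>V. f u = u" "f u = v" "g \<in> H" "\<forall>u\<in>V. g u = u" "g v = w"
    using assms by (auto simp: reach_def)
  then show ?thesis
    by (intro reachI[OF H_comp[of g f]]) auto
qed

lemma reach_mono: "reach V v w \<Longrightarrow> W \<subseteq> V \<Longrightarrow> reach W v w"
  by (auto simp: reach_def)

lemma reach_sym:
  assumes "reach V v w"
  shows "reach V w v"
proof -
  obtain f where f: "f \<in> H" "\<forall>u\<in>V. f u = u" "f v = w"
    using assms by (auto simp: reach_def)
  then have "\<forall>u\<in>V. inv_into UNIV f u = u" "inv_into UNIV f w = v"
    using H_subset by (metis SE6_inv_into(2) subset_iff)+
  then show ?thesis
    using f H_inv by (auto simp: reach_def)
qed

lemma reach_white: "reach V v w \<Longrightarrow> white v \<Longrightarrow> white w"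
  using H_subset white_SE6 by (auto simp: reach_def)

text \<open>Gaussian elimination with pivot \<open>a\<close>: two elementary maps remove
  \<open>B\<close> and \<open>C\<close>, and the equations of a white vector force the other entries
  to vanish. The maps in the next two lemmas also fix the diagonal units listed there.\<close>

lemma reach_clear_a:
  assumes "white (herm a b c A B C)" "a \<noteq> 0"
  shows "reach {} (herm a b c A B C) (herm a 0 0 0 0 0)"
proof (rule reachI)
  show "(E31 (- (1 / a) *s B) \<circ> E21 (- (1 / a) *s C)) (herm a b c A B C) = herm a 0 0 0 0 0"
    using assms by (simp add: white_herm oct_inner_self oct_mult_scale field_simps power2_eq_square)
qed (rule H_comp[OF H_elementary(5) H_elementary(2)], auto)

lemma reach_clear_b:
  assumes "white (herm a b c A B C)" "b \<noteq> 0"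
  shows "reach {ea} (herm a b c A B C) (herm 0 b 0 0 0 0)"
proof (rule reachI)
  show "(E32 (- (1 / b) *s A) \<circ> E12 (- (1 / b) *s C)) (herm a b c A B C) = herm 0 b 0 0 0 0"
    using assms by (simp add: white_herm oct_inner_self oct_mult_scale field_simps power2_eq_square)
qed (rule H_comp[OF H_elementary(4) H_elementary(1)], auto)

lemma reach_clear_c:
  assumes "white (herm a b c A B C)" "c \<noteq> 0"
  shows "reach {ea, eb} (herm a b c A B C) (herm 0 0 c 0 0 0)"
proof (rule reachI)
  show "(E13 (- (1 / c) *s B) \<circ> E23 (- (1 / c) *s A)) (herm a b c A B C) = herm 0 0 c 0 0 0"
    using assms by (simp add: white_herm oct_inner_self oct_mult_scale field_simps power2_eq_square)
qed (rule H_comp[OF H_elementary(6) H_elementary(3)], auto)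

lemma reach_elementary:
  "reach {} v (E12 x v)" "reach {} v (E21 x v)" "reach {} v (E23 x v)"
  "reach {} v (E32 x v)" "reach {} v (E31 x v)" "reach {} v (E13 x v)"
  "reach {ea} v (E12 x v)" "reach {ea} v (E23 x v)" "reach {ea} v (E32 x v)" "reach {ea} v (E13 x v)"
  by (rule reachI, rule H_elementary; simp)+

text \<open>A norm of \<open>1 / s\<close> puts the entry 1 into the position \<open>Ca\<close>,
  which then serves as the pivot.\<close>

lemma reach_ea_of_eb: "s \<noteq> 0 \<Longrightarrow> reach {} (herm 0 s 0 0 0 0) ea"
proof -
  assume s: "s \<noteq> 0"
  obtain x :: "'a oct" where x: "oct_norm x = 1 / s"
    using oct_norm_surj by blast
  have *: "reach {} (herm 0 s 0 0 0 0) (herm 1 s 0 0 0 (s *s x))"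
    using reach_elementary(1)[of "herm 0 s 0 0 0 0" x] x s by simp
  have "white (herm 0 s 0 0 0 0)"
    using s by (simp add: white_herm herm_eq_0_iff)
  then have "white (herm 1 s 0 0 0 (s *s x))"
    using * reach_white by blast
  then show ?thesis
    using reach_trans[OF * reach_clear_a] by simp
qed

lemma reach_eb_of_ec: "s \<noteq> 0 \<Longrightarrow> reach {ea} (herm 0 0 s 0 0 0) eb"
proof -
  assume s: "s \<noteq> 0"
  obtain x :: "'a oct" where x: "oct_norm x = 1 / s"
    using oct_norm_surj by blast
  have *: "reach {ea} (herm 0 0 s 0 0 0) (herm 0 1 s (s *s x) 0 0)"
    using reach_elementary(8)[of "herm 0 0 s 0 0 0" x] x s by simp
  have "white (herm 0 0 s 0 0 0)"
    using s by (simp add: white_herm herm_eq_0_iff)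
  then have "white (herm 0 1 s (s *s x) 0 0)"
    using * reach_white by blast
  then show ?thesis
    using reach_trans[OF * reach_clear_b] by simp
qed

text \<open>Passing through \<open>ec\<close> and back replaces the factor \<open>s\<close> by 1
  while \<open>ea\<close> stays fixed.\<close>

lemma reach_eb_of_eb: "s \<noteq> 0 \<Longrightarrow> reach {ea} (herm 0 s 0 0 0 0) eb"
proof -
  assume s: "s \<noteq> 0"
  obtain x :: "'a oct" where x: "oct_norm x = 1 / s"
    using oct_norm_surj by blast
  have *: "reach {ea} (herm 0 s 0 0 0 0) (herm 0 s 1 (s *s x) 0 0)"
    using reach_elementary(9)[of "herm 0 s 0 0 0 0" x] x s by simp
  have "white (herm 0 s 0 0 0 0)"
    using s by (simp add: white_herm herm_eq_0_iff)
  then have "white (herm 0 s 1 (s *s x) 0 0)"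
    using * reach_white by blast
  then have "reach {ea, eb} (herm 0 s 1 (s *s x) 0 0) ec"
    using reach_clear_c by simp
  then have "reach {ea} (herm 0 s 1 (s *s x) 0 0) ec"
    by (rule reach_mono) simp
  from reach_trans[OF * reach_trans[OF this reach_eb_of_ec]] show ?thesis
    by simp
qed

text \<open>The second hypothesis is general position with respect to \<open>ea\<close>. A nonzero
  \<open>b\<close> is a pivot; otherwise a nonzero \<open>c\<close> leads to \<open>eb\<close>, or
  \<open>E23\<close> creates the entry 1 in position \<open>Cb\<close> from
  \<open>A\<close>.\<close>

theorem white_transitive_opposite:
  assumes "white (herm a b c A B C)" "b \<noteq> 0 \<or> c \<noteq> 0 \<or> A \<noteq> 0"
  shows "reach {ea} (herm a b c A B C) eb"
proof -
  have b: "reach {ea} (herm a b c A B C) eb" if "white (herm a b c A B C)" "b \<noteq> 0" for a b c A B C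
    by (rule reach_trans[OF reach_clear_b[OF that] reach_eb_of_eb[OF that(2)]])
  show ?thesis
  proof (cases "b = 0 \<and> c = 0")
    case False
    then show ?thesis
    proof (cases "b = 0")
      case True
      with False assms(1) have "reach {ea} (herm a b c A B C) (herm 0 0 c 0 0 0)" "c \<noteq> 0"
        using reach_mono[OF reach_clear_c] by auto
      from reach_trans[OF this(1) reach_eb_of_ec[OF this(2)]] show ?thesis .
    qed (use b assms(1) in blast)
  next
    case True
    with assms(2) obtain x where "oct_inner x A = 1"
      using oct_inner_surj by blast
    with True have *: "reach {ea} (herm a b c A B C) (herm a 1 0 A B (C + oct_conj (x \<odot> B)))"
      using reach_elementary(8)[of "herm a b c A B C" x] by simp
    from reach_trans[OF this b[OF reach_white[OF * assms(1)]]] show ?thesis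
      by simp
  qed
qed

theorem white_transitive:
  assumes "white w"
  shows "reach {} w ea"
proof -
  obtain a b c A B C where w: "w = herm a b c A B C"
    by (rule herm_exhaust)
  show ?thesis
  proof (cases "b \<noteq> 0 \<or> c \<noteq> 0 \<or> A \<noteq> 0")
    case True
    then have "reach {} w eb"
      using white_transitive_opposite assms reach_mono w by (metis empty_subsetI)
    from reach_trans[OF this reach_ea_of_eb] show ?thesis
      by simp
  next
    case zero: False
    \<comment> \<open>Clearing leaves an arbitrary multiple of \<open>ea\<close>; the detour through
      \<open>eb\<close> normalizes the factor.\<close>
    have a: "reach {} (herm a b c A B C) ea" if "white (herm a b c A B C)" "a \<noteq> 0" for a b c A B C
    proof -
      obtain x :: "'a oct" where x: "oct_norm x = 1 / a"
        using oct_norm_surj by blast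
      have *: "reach {} (herm a 0 0 0 0 0) (herm a 1 0 0 0 (a *s x))"
        using reach_elementary(2)[of "herm a 0 0 0 0 0" x] x that(2) by simp
      have "white (herm a 1 0 0 0 (a *s x))"
        using reach_white[OF *] that(2) by (simp add: white_herm herm_eq_0_iff)
      then have "reach {ea} (herm a 1 0 0 0 (a *s x)) eb"
        using reach_clear_b by simp
      then have "reach {} (herm a 1 0 0 0 (a *s x)) eb"
        by (rule reach_mono) simp
      from reach_trans[OF reach_trans[OF reach_clear_a[OF that] *] reach_trans[OF this reach_ea_of_eb]]
      show ?thesis
        by simp
    qed
    show ?thesis
    proof (cases "a = 0")
      case True
      show ?thesis
      proof (cases "C = 0")
        case False
        then obtain x where "oct_inner x C = 1"
          using oct_inner_surj by blast
        with True zero have *: "reach {} w (herm 1 b c A (B + oct_conj (x \<odot> A)) C)"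
          using reach_elementary(1)[of "herm a b c A B C" x] w by simp
        from reach_trans[OF this a[OF reach_white[OF * assms]]] show ?thesis
          by simp
      next
        case C: True
        with True zero assms have "B \<noteq> 0"
          using w by (auto simp: white_def herm_eq_0_iff)
        then obtain x where "oct_inner x B = 1"
          using oct_inner_surj by blast
        with True zero have *: "reach {} w (herm 1 b c A B (C + oct_conj (A \<odot> x)))"
          using reach_elementary(6)[of "herm a b c A B C" x] w by simp
        from reach_trans[OF this a[OF reach_white[OF * assms]]] show ?thesis
          by simp
      qed
    qed (use a w assms in blast)
  qed
qed

end

section \<open>Commutators acting on the off-diagonal octonions by triality\<close>

text \<open>In the linearized alternative law the second summand acquires the factor
  \<open>oct_norm x\<close>, the right side the factor \<open>oct_inner x y\<close>. This removes
  the terms of higher degree from the commutators below.\<close>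

lemma oct_null_triple:
  assumes "oct_norm x = 0" "oct_inner x y = 0"
  shows "x \<odot> (oct_conj y \<odot> (x \<odot> z)) = 0"
  using oct_alternative_left_linearized[of x y "x \<odot> z"] assms by (simp add: oct_alternative_left)

lemma oct_null_triple_right:
  assumes "oct_norm x = 0" "oct_inner x y = 0"
  shows "((z \<odot> oct_conj x) \<odot> y) \<odot> oct_conj x = 0"
  using arg_cong[OF oct_null_triple[OF assms, of "oct_conj z"], of oct_conj] by (simp add: oct_conj_mult)

text \<open>A commutator of two opposite elementary maps. For singular orthogonal \<open>x\<close>
  and \<open>y\<close> it fixes the diagonal and acts on one octonion part as a Siegel
  transformation, on the other two by the corresponding half-spin transformations.\<close>

definition spin_A :: "'a::comm_ring_1 oct \<Rightarrow> 'a oct \<Rightarrow> 'a albert \<Rightarrow> 'a albert" where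
  "spin_A x y = E23 x \<circ> E32 y \<circ> (E23 (- x) \<circ> E32 (- y))"
definition spin_B :: "'a::comm_ring_1 oct \<Rightarrow> 'a oct \<Rightarrow> 'a albert \<Rightarrow> 'a albert" where
  "spin_B x y = E31 x \<circ> E13 y \<circ> (E31 (- x) \<circ> E13 (- y))"
definition spin_C :: "'a::comm_ring_1 oct \<Rightarrow> 'a oct \<Rightarrow> 'a albert \<Rightarrow> 'a albert" where
  "spin_C x y = E12 x \<circ> E21 y \<circ> (E12 (- x) \<circ> E21 (- y))"

lemma spin_herm:
  assumes "oct_norm x = 0" "oct_norm y = 0" "oct_inner x y = 0"
  shows "spin_A x y (herm a b c A B C) = herm a b c (A + oct_inner y A *s x - oct_inner x A *s y)
           (B - oct_conj y \<odot> (x \<odot> B)) (C + (C \<odot> y) \<odot> oct_conj x)"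
    and "spin_B x y (herm a b c A B C) = herm a b c (A + (A \<odot> y) \<odot> oct_conj x)
           (B + oct_inner y B *s x - oct_inner x B *s y) (C - oct_conj y \<odot> (x \<odot> C))"
    and "spin_C x y (herm a b c A B C) = herm a b c (A - oct_conj y \<odot> (x \<odot> A))
           (B + (B \<odot> y) \<odot> oct_conj x) (C + oct_inner y C *s x - oct_inner x C *s y)"
proof -
  have [simp]: "oct_inner y x = 0" "oct_inner x x = 0" "oct_inner y y = 0"
    using assms by (simp_all add: oct_inner_commute oct_inner_self)
  have "oct_conj y \<odot> (oct_conj (oct_conj x) \<odot> (oct_conj y \<odot> z)) = 0" for z
    by (rule oct_null_triple) (use assms in \<open>simp_all add: oct_inner_commute\<close>)
  then have [simp]: "oct_conj y \<odot> (x \<odot> (oct_conj y \<odot> z)) = 0" for z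
    by simp
  note [simp] = oct_null_triple[OF assms(1,3)] oct_null_triple_right[OF assms(1,3)]
  show "spin_A x y (herm a b c A B C) = herm a b c (A + oct_inner y A *s x - oct_inner x A *s y)
           (B - oct_conj y \<odot> (x \<odot> B)) (C + (C \<odot> y) \<odot> oct_conj x)"
    by (simp add: spin_A_def oct_conj_mult oct_linear oct_mult_diff oct_inner_diff assms)
       (simp add: vec_eq_iff algebra_simps)
  show "spin_B x y (herm a b c A B C) = herm a b c (A + (A \<odot> y) \<odot> oct_conj x)
           (B + oct_inner y B *s x - oct_inner x B *s y) (C - oct_conj y \<odot> (x \<odot> C))"
    by (simp add: spin_B_def oct_conj_mult oct_linear oct_mult_diff oct_inner_diff assms)
       (simp add: vec_eq_iff algebra_simps)
  show "spin_C x y (herm a b c A B C) = herm a b c (A - oct_conj y \<odot> (x \<odot> A))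
           (B + (B \<odot> y) \<odot> oct_conj x) (C + oct_inner y C *s x - oct_inner x C *s y)"
    by (simp add: spin_C_def oct_conj_mult oct_linear oct_mult_diff oct_inner_diff assms)
       (simp add: vec_eq_iff algebra_simps)
qed

text \<open>The vectors \<open>e_j\<close> and \<open>t e_{-k}\<close> are singular, and they are
  orthogonal for \<open>j \<noteq> k\<close>; the resulting Siegel transformation is
  \<open>siegel j k t\<close>.\<close>

definition root_A :: "label \<Rightarrow> label \<Rightarrow> 'a::comm_ring_1 \<Rightarrow> 'a albert \<Rightarrow> 'a albert" where
  "root_A j k t = spin_A (axis j 1) (axis (neg k) t)"
definition root_B :: "label \<Rightarrow> label \<Rightarrow> 'a::comm_ring_1 \<Rightarrow> 'a albert \<Rightarrow> 'a albert" where
  "root_B j k t = spin_B (axis j 1) (axis (neg k) t)"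
definition root_C :: "label \<Rightarrow> label \<Rightarrow> 'a::comm_ring_1 \<Rightarrow> 'a albert \<Rightarrow> 'a albert" where
  "root_C j k t = spin_C (axis j 1) (axis (neg k) t)"

lemma root_herm:
  fixes j k :: label and t :: "'a::comm_ring_1"
  assumes "j \<noteq> k"
  defines "L \<equiv> \<lambda>X. X - oct_conj (axis (neg k) t) \<odot> (axis j 1 \<odot> X)"
    and "M \<equiv> \<lambda>X. X + (X \<odot> axis (neg k) t) \<odot> oct_conj (axis j 1)"
  shows "root_A j k t (herm a b c A B C) = herm a b c (siegel j k t A) (L B) (M C)"
    and "root_B j k t (herm a b c A B C) = herm a b c (M A) (siegel j k t B) (L C)"
    and "root_C j k t (herm a b c A B C) = herm a b c (L A) (M B) (siegel j k t C)"
proof -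
  have [simp]: "X + (t * X $ k) *s axis j 1 - X $ neg j *s axis (neg k) t = siegel j k t X" for X
    by (simp add: siegel_def vec_eq_iff axis_def mult.commute)
  have [simp]: "axis j 1 $ k = (0 :: 'a)"
    using assms by (simp add: axis_def)
  show "root_A j k t (herm a b c A B C) = herm a b c (siegel j k t A) (L B) (M C)"
    "root_B j k t (herm a b c A B C) = herm a b c (M A) (siegel j k t B) (L C)"
    "root_C j k t (herm a b c A B C) = herm a b c (L A) (M B) (siegel j k t C)"
    by (simp_all add: root_A_def root_B_def root_C_def spin_herm L_def M_def)
qed

section \<open>The stabilizer of the diagonal frame\<close>

text \<open>A related triple of isometries. By nondegeneracy the trace condition says that
  \<open>\<alpha> X \<odot> \<beta> Y\<close> is the conjugate of
  \<open>\<gamma> (oct_conj (X \<odot> Y))\<close>.\<close>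

locale triality =
  fixes \<alpha> \<beta> \<gamma> :: "'a::field oct \<Rightarrow> 'a oct"
  assumes add: "\<alpha> (X + Y) = \<alpha> X + \<alpha> Y" "\<beta> (X + Y) = \<beta> X + \<beta> Y" "\<gamma> (X + Y) = \<gamma> X + \<gamma> Y"
    and scale: "\<alpha> (r *s X) = r *s \<alpha> X" "\<beta> (r *s X) = r *s \<beta> X" "\<gamma> (r *s X) = r *s \<gamma> X"
    and norm: "oct_norm (\<alpha> X) = oct_norm X" "oct_norm (\<beta> X) = oct_norm X" "oct_norm (\<gamma> X) = oct_norm X"
    and tr: "oct_tr (\<alpha> X \<odot> (\<beta> Y \<odot> \<gamma> Z)) = oct_tr (X \<odot> (Y \<odot> Z))"
    and surj: "surj \<alpha>" "surj \<beta>" "surj \<gamma>"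
begin

lemma inner:
  "oct_inner (\<alpha> X) (\<alpha> Y) = oct_inner X Y" "oct_inner (\<beta> X) (\<beta> Y) = oct_inner X Y"
  "oct_inner (\<gamma> X) (\<gamma> Y) = oct_inner X Y"
  using norm[of "X + Y"] by (simp_all add: add norm oct_norm_add)

lemma zero: "\<alpha> 0 = 0" "\<beta> 0 = 0" "\<gamma> 0 = 0"
  using scale[of 0 0] by simp_all

text \<open>Pairing with the whole image of \<open>\<gamma>\<close> turns the trace condition into a
  statement about the product. In this way vectors fixed in the \<open>A\<close> part restrict the
  \<open>B\<close> part.\<close>

lemma annihilator: "X \<odot> Y = 0 \<Longrightarrow> \<alpha> X \<odot> \<beta> Y = 0"
proof (rule oct_nondegenerate)
  fix Z
  assume "X \<odot> Y = 0"
  obtain W where "\<gamma> W = oct_conj Z"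
    using surj by (metis surjD)
  with tr[of X Y W] \<open>X \<odot> Y = 0\<close> show "oct_inner (\<alpha> X \<odot> \<beta> Y) Z = 0"
    by (simp add: oct_tr_assoc flip: oct_tr_mult_conj)
qed

text \<open>Putting the identity for one factor of the trace condition identifies both
  \<open>\<alpha>\<close> and \<open>\<beta>\<close> with the conjugate of \<open>\<gamma>\<close>
  under \<open>oct_conj\<close>. An isometry fixing the identity commutes with
  \<open>oct_conj\<close>, so all three maps agree and the trace condition becomes
  multiplicativity.\<close>

lemma automorphism:
  assumes "\<alpha> (oct_scalar 1) = oct_scalar 1" "\<beta> (oct_scalar 1) = oct_scalar 1"
  shows "\<beta> X = \<alpha> X" "\<gamma> X = \<alpha> X" "\<alpha> (X \<odot> Y) = \<alpha> X \<odot> \<alpha> Y"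
proof -
  have eqI: "X = Y" if "\<And>Z. oct_inner (\<alpha> Z) X = oct_inner (\<alpha> Z) Y" for X Y
  proof -
    have "oct_inner (X - Y) W = 0" for W
      using that surj(1) by (metis oct_inner_diff(2) oct_inner_commute right_minus_eq surjD)
    then show ?thesis
      using oct_nondegenerate eq_iff_diff_eq_0 by metis
  qed
  have eqI': "X = Y" if "\<And>Z. oct_inner (\<beta> Z) X = oct_inner (\<beta> Z) Y" for X Y
  proof -
    have "oct_inner (X - Y) W = 0" for W
      using that surj(2) by (metis oct_inner_diff(2) oct_inner_commute right_minus_eq surjD)
    then show ?thesis
      using oct_nondegenerate eq_iff_diff_eq_0 by metis
  qed
  have \<beta>: "oct_conj (\<gamma> (oct_conj X)) = \<beta> X" for X
  proof (rule eqI')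
    fix Z
    show "oct_inner (\<beta> Z) (oct_conj (\<gamma> (oct_conj X))) = oct_inner (\<beta> Z) (\<beta> X)"
      using tr[of "oct_scalar 1" Z "oct_conj X"]
      by (simp add: assms oct_scalar_mult inner flip: oct_tr_mult_eq_inner) (simp add: oct_tr_mult_conj)
  qed
  have \<alpha>: "oct_conj (\<gamma> (oct_conj X)) = \<alpha> X" for X
  proof (rule eqI)
    fix Z
    show "oct_inner (\<alpha> Z) (oct_conj (\<gamma> (oct_conj X))) = oct_inner (\<alpha> Z) (\<alpha> X)"
      using tr[of Z "oct_scalar 1" "oct_conj X"]
      by (simp add: assms oct_scalar_mult inner flip: oct_tr_mult_eq_inner) (simp add: oct_tr_mult_conj)
  qed
  show \<beta>_eq: "\<beta> X = \<alpha> X" for X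
    using \<alpha> \<beta> by metis
  have conj: "oct_conj (\<alpha> X) = \<alpha> (oct_conj X)" for X
  proof -
    have c: "oct_conj X = oct_inner X (oct_scalar 1) *s oct_scalar 1 - X" for X :: "'a oct"
      by (simp add: oct_eq_iff oct_conj_def oct_scalar_def oct_inner_def sum_label sum_base axis_def)
    have "\<alpha> (oct_conj X) = oct_inner X (oct_scalar 1) *s oct_scalar 1 - \<alpha> X"
      using add(1)[of "oct_conj X" X] by (subst (asm) c) (simp add: scale assms algebra_simps)
    moreover have "oct_inner (\<alpha> X) (oct_scalar 1) = oct_inner X (oct_scalar 1)"
      using inner(1)[of X "oct_scalar 1"] by (simp add: assms)
    ultimately show ?thesis
      by (simp add: c[of "\<alpha> X"])
  qed
  show \<gamma>_eq: "\<gamma> X = \<alpha> X" for X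
    using \<alpha>[of "oct_conj X"] conj by (metis oct_conj_linear(6))
  show "\<alpha> (X \<odot> Y) = \<alpha> X \<odot> \<alpha> Y"
  proof (rule eqI)
    fix Z
    have "oct_tr (\<alpha> X \<odot> (\<alpha> Y \<odot> \<alpha> (oct_conj Z))) = oct_tr (X \<odot> (Y \<odot> oct_conj Z))"
      using tr[of X Y "oct_conj Z"] by (simp add: \<beta>_eq \<gamma>_eq)
    then have "oct_inner (\<alpha> X \<odot> \<alpha> Y) (\<alpha> Z) = oct_inner (X \<odot> Y) Z"
      by (simp add: oct_tr_assoc oct_tr_mult_conj flip: conj)
    then show "oct_inner (\<alpha> Z) (\<alpha> (X \<odot> Y)) = oct_inner (\<alpha> Z) (\<alpha> X \<odot> \<alpha> Y)"
      by (simp add: inner oct_inner_commute)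
  qed
qed

end

text \<open>The diagonal coordinates, and up to diagonal terms the inner products of the octonion
  parts, are values of \<open>det_tri\<close> with diagonal units inserted. They are therefore
  preserved, and each octonion block is mapped to itself.\<close>

lemma frame_stabilizer_triality:
  assumes g: "g \<in> carrier SE6" and fix_g: "g ea = ea" "g eb = eb" "g ec = ec"
  obtains \<alpha> \<beta> \<gamma> where "triality \<alpha> \<beta> \<gamma>"
    "\<And>a b c A B C. g (herm a b c A B C) = herm a b c (\<alpha> A) (\<beta> B) (\<gamma> C)"
proof -
  let ?\<alpha> = "\<lambda>A. A_part (g (herm 0 0 0 A 0 0))"
  let ?\<beta> = "\<lambda>B. B_part (g (herm 0 0 0 0 B 0))"
  let ?\<gamma> = "\<lambda>C. C_part (g (herm 0 0 0 0 0 C))"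
  have diag: "g v $ Ca = v $ Ca" "g v $ Cb = v $ Cb" "g v $ Cc = v $ Cc" for v
    using SE6_det(3)[OF g, of eb ec v] SE6_det(3)[OF g, of ec ea v] SE6_det(3)[OF g, of ea eb v]
    by (simp_all add: fix_g det_tri_def)
  have inner: "oct_inner (A_part (g v)) (A_part (g w)) = oct_inner (A_part v) (A_part w)"
    "oct_inner (B_part (g v)) (B_part (g w)) = oct_inner (B_part v) (B_part w)"
    "oct_inner (C_part (g v)) (C_part (g w)) = oct_inner (C_part v) (C_part w)" for v w
    using SE6_det(3)[OF g, of ea v w] SE6_det(3)[OF g, of eb v w] SE6_det(3)[OF g, of ec v w]
    by (simp_all add: fix_g det_tri_def diag)
  \<comment> \<open>Such a part is orthogonal to the parts of all vectors \<open>g w\<close>, hence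
    to every octonion, because \<open>g\<close> is onto.\<close>
  have part0: "A_part v = 0 \<Longrightarrow> A_part (g v) = 0" "B_part v = 0 \<Longrightarrow> B_part (g v) = 0"
    "C_part v = 0 \<Longrightarrow> C_part (g v) = 0" for v
    using inner[of v "inv_into UNIV g (herm 0 0 0 _ 0 0)"] inner[of v "inv_into UNIV g (herm 0 0 0 0 _ 0)"]
      inner[of v "inv_into UNIV g (herm 0 0 0 0 0 _)"]
    by (auto simp: SE6_inv_into[OF g] intro!: oct_nondegenerate)
  have A: "g (herm 0 0 0 A 0 0) = herm 0 0 0 (?\<alpha> A) 0 0" for A
    by (simp add: albert_eq_iff diag part0)
  have B: "g (herm 0 0 0 0 B 0) = herm 0 0 0 0 (?\<beta> B) 0" for B
    by (simp add: albert_eq_iff diag part0)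
  have C: "g (herm 0 0 0 0 0 C) = herm 0 0 0 0 0 (?\<gamma> C)" for C
    by (simp add: albert_eq_iff diag part0)
  have eq: "g (herm a b c A B C) = herm a b c (?\<alpha> A) (?\<beta> B) (?\<gamma> C)" for a b c A B C
  proof -
    have "herm a b c A B C = herm a b c 0 0 0 + herm 0 0 0 A 0 0 + herm 0 0 0 0 B 0 + herm 0 0 0 0 0 C"
      by (simp add: herm_linear)
    then have "g (herm a b c A B C) =
        g (herm a b c 0 0 0) + g (herm 0 0 0 A 0 0) + g (herm 0 0 0 0 B 0) + g (herm 0 0 0 0 0 C)"
      by (simp only: SE6_linear(2)[OF g])
    moreover have "g (herm a b c 0 0 0) = herm a b c 0 0 0"
      by (simp add: albert_eq_iff diag part0)
    ultimately show ?thesis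
      by (subst (asm) A, subst (asm) B, subst (asm) C) (simp add: herm_linear)
  qed
  have "triality ?\<alpha> ?\<beta> ?\<gamma>"
  proof
    fix X Y Z r
    show "?\<alpha> (X + Y) = ?\<alpha> X + ?\<alpha> Y" "?\<beta> (X + Y) = ?\<beta> X + ?\<beta> Y" "?\<gamma> (X + Y) = ?\<gamma> X + ?\<gamma> Y"
      by (simp_all flip: part_linear SE6_linear(2)[OF g] add: herm_linear)
    show "?\<alpha> (r *s X) = r *s ?\<alpha> X" "?\<beta> (r *s X) = r *s ?\<beta> X" "?\<gamma> (r *s X) = r *s ?\<gamma> X"
      by (simp_all flip: part_linear SE6_linear(3)[OF g] add: herm_linear)
    \<comment> \<open>The norm is read off \<open>det_deriv\<close>; in characteristic 2 the inner
      products would not determine it.\<close>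
    show "oct_norm (?\<alpha> X) = oct_norm X" "oct_norm (?\<beta> X) = oct_norm X" "oct_norm (?\<gamma> X) = oct_norm X"
      using SE6_det(2)[OF g, of "herm 0 0 0 X 0 0" ea] SE6_det(2)[OF g, of "herm 0 0 0 0 X 0" eb]
        SE6_det(2)[OF g, of "herm 0 0 0 0 0 X" ec]
      by (simp_all add: fix_g det_deriv_def diag part0)
    show "oct_tr (?\<alpha> X \<odot> (?\<beta> Y \<odot> ?\<gamma> Z)) = oct_tr (X \<odot> (Y \<odot> Z))"
      using SE6_det(3)[OF g, of "herm 0 0 0 X 0 0" "herm 0 0 0 0 Y 0" "herm 0 0 0 0 0 Z"]
      by (simp add: det_tri_def diag part0)
    have "\<exists>x. X = ?\<alpha> x" "\<exists>x. X = ?\<beta> x" "\<exists>x. X = ?\<gamma> x" for X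
    proof -
      obtain a b c A B C where v: "inv_into UNIV g (herm 0 0 0 X X X) = herm a b c A B C"
        by (rule herm_exhaust)
      have "herm 0 0 0 X X X = g (herm a b c A B C)"
        using SE6_inv_into(3)[OF g, of "herm 0 0 0 X X X"] unfolding v by (rule sym)
      also have "\<dots> = herm a b c (?\<alpha> A) (?\<beta> B) (?\<gamma> C)"
        by (rule eq)
      finally have "herm 0 0 0 X X X = herm a b c (?\<alpha> A) (?\<beta> B) (?\<gamma> C)" .
      then show "\<exists>x. X = ?\<alpha> x" "\<exists>x. X = ?\<beta> x" "\<exists>x. X = ?\<gamma> x"
        unfolding herm_eq_iff by blast+
    qed
    then show "surj ?\<alpha>" "surj ?\<beta>" "surj ?\<gamma>"
      unfolding surj_def by blast+
  qed
  then show thesis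
    using eq that by blast
qed

section \<open>The elementary maps generate the group\<close>

abbreviation eA :: "label \<Rightarrow> 'a::comm_ring_1 albert" where "eA l \<equiv> herm 0 0 0 (axis l 1) 0 0"
abbreviation eB :: "label \<Rightarrow> 'a::comm_ring_1 albert" where "eB l \<equiv> herm 0 0 0 0 (axis l 1) 0"

lemma axis_zero [simp]: "axis i 0 = 0"
  by (simp add: axis_def vec_eq_iff)

lemma axis_label_nth: "axis k c $ l = (if l = k then c else 0)"
  by (auto simp: axis_def)

context elementary_group
begin

section \<open>Orbit statements for the stabilizer chain below the diagonal frame\<close>

lemma root_H: "root_A j k t \<in> H" "root_B j k t \<in> H" "root_C j k t \<in> H"
  by (simp_all add: root_A_def root_B_def root_C_def spin_A_def spin_B_def spin_C_def H_comp H_elementary)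

text \<open>One link of the chain: composing with an element of \<open>H\<close> that moves
  \<open>g v\<close> back to \<open>v\<close> leaves a map that fixes one more vector.\<close>

lemma reduce:
  assumes "g \<in> carrier SE6" "\<And>u. u \<in> V \<Longrightarrow> g u = u" "reach V (g v) v"
    and "\<And>g. g \<in> carrier SE6 \<Longrightarrow> (\<And>u. u \<in> insert v V \<Longrightarrow> g u = u) \<Longrightarrow> g \<in> H"
  shows "g \<in> H"
proof -
  obtain h where h: "h \<in> H" "\<forall>u\<in>V. h u = u" "h (g v) = v"
    using assms(3) by (auto simp: reach_def)
  then have "h \<circ> g \<in> H"
    using assms(1,2) H_subset by (intro assms(4)) (auto intro: SE6_comp)
  then have "inv_into UNIV h \<circ> (h \<circ> g) \<in> H"
    using h H_comp H_inv by blast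
  moreover have "inv_into UNIV h \<circ> (h \<circ> g) = g"
    using SE6_inv_into(2)[of h] h(1) H_subset by (auto simp: fun_eq_iff)
  ultimately show ?thesis
    by simp
qed

definition frame :: "'a albert set" where "frame = {ea, eb, ec}"

lemma reach_siegel_A:
  assumes "j \<noteq> k" "\<And>u. u \<in> V \<Longrightarrow> root_A j k t u = u"
  shows "reach V (herm 0 0 0 X 0 0) (herm 0 0 0 (siegel j k t X) 0 0)"
  by (rule reachI[OF root_H(1)[of j k t]]) (use assms in \<open>simp_all add: root_herm\<close>)

lemma reach_siegel_B:
  assumes "j \<noteq> k" "\<And>u. u \<in> V \<Longrightarrow> root_B j k t u = u"
  shows "reach V (herm 0 0 0 0 X 0) (herm 0 0 0 0 (siegel j k t X) 0)"
  by (rule reachI[OF root_H(2)[of j k t]]) (use assms in \<open>simp_all add: root_herm\<close>)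

lemma singular_reach_A:
  assumes "X \<noteq> 0" "oct_norm X = 0"
  shows "reach frame (herm 0 0 0 X 0 0) (eA (Pos Zero))"
proof (rule singular_reach[of "\<lambda>X Y. reach frame (herm 0 0 0 X 0 0) (herm 0 0 0 Y 0 0)"])
  show "reach frame (herm 0 0 0 X 0 0) (herm 0 0 0 (siegel j k t X) 0 0)" if "j \<noteq> k" for j k t X
    using that by (intro reach_siegel_A) (auto simp: frame_def root_herm siegel_def)
qed (use assms reach_refl reach_trans in blast)+

text \<open>Siegel moves with pivot \<open>Neg Zero\<close> read only coordinates that vanish at
  \<open>e_0\<close>, so they keep it fixed.\<close>

lemma reach_A_minus:
  assumes "X $ Neg Zero = 1" "oct_norm X = 0"
  shows "reach (insert (eA (Pos Zero)) frame) (herm 0 0 0 X 0 0) (eA (Neg Zero))"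
proof -
  interpret siegel_moves "\<lambda>X Y. reach (insert (eA (Pos Zero)) frame) (herm 0 0 0 X 0 0) (herm 0 0 0 Y 0 0)"
    "\<lambda>X. oct_norm X = 0" "- {Pos Zero, Neg Zero}" "Neg Zero"
  proof unfold_locales
    fix j and X :: "'a oct" and t
    assume j: "j \<in> - {Pos Zero, Neg Zero}" and X: "oct_norm X = 0"
    show "reach (insert (eA (Pos Zero)) frame) (herm 0 0 0 X 0 0) (herm 0 0 0 (siegel j (Neg Zero) t X) 0 0)"
      using j by (intro reach_siegel_A) (auto simp: frame_def root_herm siegel_def axis_label_nth)
    show "oct_norm (siegel j (Neg Zero) t X) = 0"
      using j X by (auto simp: oct_norm_siegel)
  qed (auto intro: reach_refl reach_trans oct_norm_eq_0_axis)
  show ?thesis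
    using clear assms by blast
qed

text \<open>The idempotents \<open>e_0\<close> and \<open>e_{-0}\<close> add up to the identity, so
  fixing both in one part fixes the identity of that part.\<close>

definition frame_A :: "'a albert set" where
  "frame_A = insert (eA (Neg Zero)) (insert (eA (Pos Zero)) frame)"

text \<open>The four labels span the solutions of \<open>e_{-0} X = 0\<close>, where the image of
  \<open>e_0\<close> must lie once \<open>e_{-0}\<close> is fixed in the \<open>A\<close> part. This
  space is totally singular, so the Siegel moves act on it as transvections. The next lemma treats
  \<open>e_0 X = 0\<close> in the same way.\<close>

lemma reach_B_plus:
  assumes "X \<noteq> 0" "\<And>l. l \<notin> {Pos Zero, Neg One, Neg Om, Neg Omb} \<Longrightarrow> X $ l = 0"
  shows "reach frame_A (herm 0 0 0 0 X 0) (eB (Pos Zero))"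
proof -
  let ?J = "{Neg One, Neg Om, Neg Omb}"
  interpret siegel_moves_sym "\<lambda>X Y. reach frame_A (herm 0 0 0 0 X 0) (herm 0 0 0 0 Y 0)"
    "\<lambda>X. \<forall>l. l \<notin> insert (Pos Zero) ?J \<longrightarrow> X $ l = 0" ?J "Pos Zero"
  proof unfold_locales
    fix j and X :: "'a oct" and t
    assume j: "j \<in> ?J" and X: "\<forall>l. l \<notin> insert (Pos Zero) ?J \<longrightarrow> X $ l = 0"
    show "reach frame_A (herm 0 0 0 0 X 0) (herm 0 0 0 0 (siegel j (Pos Zero) t X) 0)"
      using j by (intro reach_siegel_B)
        (auto simp: frame_A_def frame_def root_herm siegel_def oct_eq_iff oct_mult_nth axis_label_nth oct_conj_def)
    show "reach frame_A (herm 0 0 0 0 X 0) (herm 0 0 0 0 (siegel (Pos Zero) j t X) 0)"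
      using j by (intro reach_siegel_B)
        (auto simp: frame_A_def frame_def root_herm siegel_def oct_eq_iff oct_mult_nth axis_label_nth oct_conj_def)
    show "\<forall>l. l \<notin> insert (Pos Zero) ?J \<longrightarrow> siegel j (Pos Zero) t X $ l = 0"
      "\<forall>l. l \<notin> insert (Pos Zero) ?J \<longrightarrow> siegel (Pos Zero) j t X $ l = 0"
      using j X by (auto simp: siegel_nth)
  next
    fix X :: "'a oct"
    assume "\<forall>l. l \<notin> insert (Pos Zero) ?J \<longrightarrow> X $ l = 0" "X $ Pos Zero = 1" "\<And>j. j \<in> ?J \<Longrightarrow> X $ j = 0"
    then show "X = axis (Pos Zero) 1"
      by (auto simp: vec_eq_iff axis_label_nth)
  qed (auto intro: reach_refl reach_trans)
  obtain i where "X $ i \<noteq> 0"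
    using assms(1) by (auto simp: vec_eq_iff)
  then show ?thesis
    using reach_axis[of X i] assms(2) by blast
qed

lemma reach_B_minus:
  assumes "X $ Neg Zero = 1" "\<And>l. l \<notin> {Neg Zero, Pos One, Pos Om, Pos Omb} \<Longrightarrow> X $ l = 0"
  shows "reach (insert (eB (Pos Zero)) frame_A) (herm 0 0 0 0 X 0) (eB (Neg Zero))"
proof -
  let ?J = "{Pos One, Pos Om, Pos Omb}" and ?V = "insert (eB (Pos Zero)) frame_A"
  interpret siegel_moves "\<lambda>X Y. reach ?V (herm 0 0 0 0 X 0) (herm 0 0 0 0 Y 0)"
    "\<lambda>X. \<forall>l. l \<notin> insert (Neg Zero) ?J \<longrightarrow> X $ l = 0" ?J "Neg Zero"
  proof unfold_locales
    fix j and X :: "'a oct" and t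
    assume j: "j \<in> ?J" and X: "\<forall>l. l \<notin> insert (Neg Zero) ?J \<longrightarrow> X $ l = 0"
    show "reach ?V (herm 0 0 0 0 X 0) (herm 0 0 0 0 (siegel j (Neg Zero) t X) 0)"
      using j by (intro reach_siegel_B)
        (auto simp: frame_A_def frame_def root_herm siegel_def oct_eq_iff oct_mult_nth axis_label_nth oct_conj_def)
    show "\<forall>l. l \<notin> insert (Neg Zero) ?J \<longrightarrow> siegel j (Neg Zero) t X $ l = 0"
      using j X by (auto simp: siegel_nth)
  next
    fix X :: "'a oct"
    assume "\<forall>l. l \<notin> insert (Neg Zero) ?J \<longrightarrow> X $ l = 0" "X $ Neg Zero = 1" "\<And>j. j \<in> ?J \<Longrightarrow> X $ j = 0"
    then show "X = axis (Neg Zero) 1"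
      by (auto simp: vec_eq_iff axis_label_nth)
  qed (auto intro: reach_refl reach_trans)
  show ?thesis
    using clear[of X] assms by blast
qed

definition frame_AB :: "'a albert set" where
  "frame_AB = insert (eB (Neg Zero)) (insert (eB (Pos Zero)) frame_A)"

text \<open>These root elements fix \<open>frame_AB\<close> and act on the span of the three
  positive nonzero labels as elementary matrices of SL3. They read coordinate \<open>k\<close>, so
  the vectors with index in \<open>I\<close> stay fixed.\<close>

lemma reach_siegel_pos:
  assumes "j \<in> {One, Om, Omb}" "k \<in> {One, Om, Omb}" "j \<noteq> k" "I \<subseteq> {One, Om, Omb}" "k \<notin> I"
  shows "reach (frame_AB \<union> (\<lambda>i. eA (Pos i)) ` I) (herm 0 0 0 X 0 0) (herm 0 0 0 (siegel (Pos j) (Pos k) t X) 0 0)"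
proof (rule reach_siegel_A)
  fix u
  assume "u \<in> frame_AB \<union> (\<lambda>i. eA (Pos i)) ` I"
  then consider "u \<in> frame_AB" | i where "i \<in> I" "u = eA (Pos i)"
    by blast
  then show "root_A (Pos j) (Pos k) t u = u"
  proof cases
    case 1
    with assms show ?thesis
      by (auto simp: frame_AB_def frame_A_def frame_def root_herm siegel_def oct_eq_iff oct_mult_nth axis_label_nth oct_conj_def)
  next
    case 2
    with assms have "i \<noteq> k"
      by blast
    with 2 assms show ?thesis
      by (auto simp: root_herm siegel_def axis_label_nth)
  qed
qed (use assms in auto)

lemma siegel_support_pos:
  assumes "j \<in> {One, Om, Omb}" "k \<in> {One, Om, Omb}" "j \<noteq> k" "\<forall>l. l \<notin> Pos ` {One, Om, Omb} \<longrightarrow> X $ l = 0"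
  shows "\<forall>l. l \<notin> Pos ` {One, Om, Omb} \<longrightarrow> siegel (Pos j) (Pos k) t X $ l = 0"
  using assms by (auto simp: siegel_nth)

lemma siegel_moves_pos:
  assumes k: "k \<in> {One, Om, Omb}" and I: "I \<subseteq> {One, Om, Omb}" "k \<notin> I"
  shows "siegel_moves (\<lambda>X Y. reach (frame_AB \<union> (\<lambda>i. eA (Pos i)) ` I) (herm 0 0 0 X 0 0) (herm 0 0 0 Y 0 0))
    (\<lambda>X. \<forall>l. l \<notin> Pos ` {One, Om, Omb} \<longrightarrow> X $ l = 0) (Pos ` ({One, Om, Omb} - {k})) (Pos k)"
proof unfold_locales
  fix j X t
  assume j: "j \<in> Pos ` ({One, Om, Omb} - {k})" and X: "\<forall>l. l \<notin> Pos ` {One, Om, Omb} \<longrightarrow> X $ l = (0 :: 'a)"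
  then obtain j' where j': "j = Pos j'" "j' \<in> {One, Om, Omb}" "j' \<noteq> k"
    by blast
  show "reach (frame_AB \<union> (\<lambda>i. eA (Pos i)) ` I) (herm 0 0 0 X 0 0) (herm 0 0 0 (siegel j (Pos k) t X) 0 0)"
    unfolding j'(1) by (rule reach_siegel_pos[OF j'(2) k j'(3) I])
  show "\<forall>l. l \<notin> Pos ` {One, Om, Omb} \<longrightarrow> siegel j (Pos k) t X $ l = 0"
    unfolding j'(1) by (rule siegel_support_pos[OF j'(2) k j'(3) X])
next
  fix X :: "'a oct"
  assume "\<forall>l. l \<notin> Pos ` {One, Om, Omb} \<longrightarrow> X $ l = 0" "X $ Pos k = 1" "\<And>j. j \<in> Pos ` ({One, Om, Omb} - {k}) \<Longrightarrow> X $ j = 0"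
  then have "X $ l = axis (Pos k) 1 $ l" for l
    using k by (cases "l \<in> Pos ` {One, Om, Omb}"; cases "l = Pos k") (auto simp: axis_label_nth)
  then show "X = axis (Pos k) 1"
    by (simp add: vec_eq_iff)
qed (use I in \<open>auto intro: reach_refl reach_trans\<close>)

text \<open>The index \<open>i\<close> is a spare one. The coordinate that is read must have its
  index outside \<open>I\<close>; if \<open>k\<close> is the only nonzero one at hand, it is first
  copied to \<open>i\<close>.\<close>

lemma reach_pos:
  assumes k: "k \<in> {One, Om, Omb}" and I: "I \<subseteq> {One, Om, Omb}" "k \<notin> I"
    and X: "\<forall>l. l \<notin> Pos ` {One, Om, Omb} \<longrightarrow> X $ l = 0"
    and j: "j \<in> {One, Om, Omb}" "j \<notin> I" "X $ Pos j \<noteq> 0"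
    and i: "i \<in> {One, Om, Omb}" "i \<notin> I" "i \<noteq> k"
  shows "reach (frame_AB \<union> (\<lambda>i. eA (Pos i)) ` I) (herm 0 0 0 X 0 0) (eA (Pos k))"
proof -
  interpret siegel_moves "\<lambda>X Y. reach (frame_AB \<union> (\<lambda>i. eA (Pos i)) ` I) (herm 0 0 0 X 0 0) (herm 0 0 0 Y 0 0)"
    "\<lambda>X. \<forall>l. l \<notin> Pos ` {One, Om, Omb} \<longrightarrow> X $ l = 0" "Pos ` ({One, Om, Omb} - {k})" "Pos k"
    by (rule siegel_moves_pos[OF k I])
  have *: "reach (frame_AB \<union> (\<lambda>i. eA (Pos i)) ` I) (herm 0 0 0 X 0 0) (eA (Pos k))"
    if X: "\<forall>l. l \<notin> Pos ` {One, Om, Omb} \<longrightarrow> X $ l = 0"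
      and j: "j \<in> {One, Om, Omb}" "j \<notin> I" "X $ Pos j \<noteq> 0" "k \<noteq> j" for X j
  proof -
    let ?Y = "siegel (Pos k) (Pos j) ((1 - X $ Pos k) / X $ Pos j) X"
    have "?Y $ Pos k = 1"
      using j by (simp add: siegel_nth)
    with siegel_support_pos[OF k j(1,4) X] show ?thesis
      using R_trans[OF reach_siegel_pos[OF k j(1,4) I(1) j(2)] clear] by blast
  qed
  show ?thesis
  proof (cases "X $ Pos i = 0 \<and> k = j")
    case True
    let ?Y = "siegel (Pos i) (Pos k) 1 X"
    have "?Y $ Pos i \<noteq> 0"
      using True j by (simp add: siegel_nth)
    with R_trans[OF reach_siegel_pos[OF i(1) k i(3) I] *[OF siegel_support_pos[OF i(1) k i(3) X] i(1,2)]] i(3)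
    show ?thesis
      by blast
  next
    case False
    then show ?thesis
      using *[OF X j] *[OF X i(1,2)] i(3) by blast
  qed
qed

end

section \<open>Octonion automorphisms that fix both idempotents\<close>

context elementary_group
begin

text \<open>With the identity fixed in parts \<open>A\<close> and \<open>B\<close>, the triality
  triple is a single algebra automorphism, an element of G2. Fixing the two idempotents as well
  leaves an SL3 acting on \<open>e_1\<close>, \<open>e_om\<close>, \<open>e_omb\<close>, and these
  vectors are restored one at a time.\<close>

lemma frame_AB_fixer_subset:
  assumes g: "g \<in> carrier SE6" and fix_g: "\<And>u. u \<in> frame_AB \<Longrightarrow> g u = u"
  shows "g \<in> H"
proof -
  have frame_AB: "frame \<subseteq> frame_AB" "eA (Pos Zero) \<in> frame_AB" "eA (Neg Zero) \<in> frame_AB"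
    "eB (Pos Zero) \<in> frame_AB" "eB (Neg Zero) \<in> frame_AB" "ea \<in> frame_AB" "eb \<in> frame_AB" "ec \<in> frame_AB"
    by (auto simp: frame_AB_def frame_A_def frame_def)
  have tri: "\<exists>\<alpha>. triality \<alpha> \<alpha> \<alpha> \<and> (\<forall>a b c A B C. f (herm a b c A B C) = herm a b c (\<alpha> A) (\<alpha> B) (\<alpha> C)) \<and>
      (\<forall>X Y. \<alpha> (X \<odot> Y) = \<alpha> X \<odot> \<alpha> Y) \<and>
      \<alpha> (axis (Pos Zero) 1) = axis (Pos Zero) 1 \<and> \<alpha> (axis (Neg Zero) 1) = axis (Neg Zero) 1"
    if f: "f \<in> carrier SE6" "\<And>u. u \<in> frame_AB \<Longrightarrow> f u = u" for f
  proof -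
    obtain \<alpha> \<beta> \<gamma> where t: "triality \<alpha> \<beta> \<gamma>"
      and eq: "\<And>a b c A B C. f (herm a b c A B C) = herm a b c (\<alpha> A) (\<beta> B) (\<gamma> C)"
      using frame_stabilizer_triality[OF f(1)] f(2) frame_AB by metis
    interpret triality \<alpha> \<beta> \<gamma> by (rule t)
    have fixed: "\<alpha> (axis (Pos Zero) 1) = axis (Pos Zero) 1" "\<alpha> (axis (Neg Zero) 1) = axis (Neg Zero) 1"
      "\<beta> (axis (Pos Zero) 1) = axis (Pos Zero) 1" "\<beta> (axis (Neg Zero) 1) = axis (Neg Zero) 1"
      using f(2)[OF frame_AB(2)] f(2)[OF frame_AB(3)] f(2)[OF frame_AB(4)] f(2)[OF frame_AB(5)]
      by (simp_all add: eq)
    then have "\<alpha> (oct_scalar 1) = oct_scalar 1" "\<beta> (oct_scalar 1) = oct_scalar 1"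
      by (simp_all add: oct_scalar_def add)
    note auto = automorphism[OF this]
    then have "\<beta> = \<alpha>" "\<gamma> = \<alpha>"
      by (simp_all add: fun_eq_iff)
    with t eq auto fixed show ?thesis
      by blast
  qed
  have support: "\<forall>l. l \<notin> Pos ` {One, Om, Omb} \<longrightarrow> \<alpha> (axis (Pos i) 1) $ l = 0"
    if "\<And>X Y. \<alpha> (X \<odot> Y) = \<alpha> X \<odot> \<alpha> Y" "\<alpha> (axis (Pos Zero) 1) = axis (Pos Zero) 1"
      "triality \<alpha> \<alpha> \<alpha>" "i \<noteq> Zero" for i and \<alpha> :: "'a oct \<Rightarrow> 'a oct"
  proof -
    let ?p = "\<alpha> (axis (Pos i) 1)" and ?e = "axis (Pos Zero) 1 :: 'a oct"
    \<comment> \<open>The span of the three vectors is singled out by \<open>e_0\<close>: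
      multiplication by it is zero from the left and the identity from the right.\<close>
    have "?e \<odot> axis (Pos i) 1 = 0" "axis (Pos i) 1 \<odot> ?e = axis (Pos i) 1"
      using that(4) by (cases i; simp add: oct_eq_iff oct_mult_nth axis_label_nth)+
    then have "?e \<odot> ?p = 0" "?p \<odot> ?e = ?p"
      using that(1)[of ?e "axis (Pos i) 1"] that(1)[of "axis (Pos i) 1" ?e] that(2) triality.zero(1)[OF that(3)]
      by simp_all
    then have *: "?p $ Pos Zero = 0" "?p $ Neg Zero = 0" "?p $ Neg One = 0" "?p $ Neg Om = 0" "?p $ Neg Omb = 0"
      by (simp_all add: oct_eq_iff oct_mult_nth axis_label_nth)
    show ?thesis
    proof (intro allI impI)
      fix l
      assume l: "l \<notin> Pos ` {One, Om, Omb}"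
      show "?p $ l = 0"
      proof (cases l)
        case (Pos b)
        then show ?thesis using * l by (cases b) auto
      next
        case (Neg b)
        then show ?thesis using * l by (cases b) auto
      qed
    qed
  qed
  have 3: "f \<in> H" if f: "f \<in> carrier SE6" "\<And>u. u \<in> frame_AB \<union> (\<lambda>i. eA (Pos i)) ` {One, Om, Omb} \<Longrightarrow> f u = u" for f
  proof -
    obtain \<alpha> where t: "triality \<alpha> \<alpha> \<alpha>" and eq: "\<And>a b c A B C. f (herm a b c A B C) = herm a b c (\<alpha> A) (\<alpha> B) (\<alpha> C)"
      and mult: "\<And>X Y. \<alpha> (X \<odot> Y) = \<alpha> X \<odot> \<alpha> Y"
      and fixed: "\<alpha> (axis (Pos Zero) 1) = axis (Pos Zero) 1" "\<alpha> (axis (Neg Zero) 1) = axis (Neg Zero) 1"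
      using tri[of f] f by auto
    interpret triality \<alpha> \<alpha> \<alpha> by (rule t)
    have fixed': "\<alpha> (axis (Pos One) 1) = axis (Pos One) 1" "\<alpha> (axis (Pos Om) 1) = axis (Pos Om) 1"
        "\<alpha> (axis (Pos Omb) 1) = axis (Pos Omb) 1"
      using f(2)[of "eA (Pos One)"] f(2)[of "eA (Pos Om)"] f(2)[of "eA (Pos Omb)"] by (simp_all add: eq)
    \<comment> \<open>The three basis vectors still missing are products of fixed ones.\<close>
    have "axis (Neg Omb) 1 = axis (Pos One) 1 \<odot> (axis (Pos Om) 1 :: 'a oct)"
      "axis (Neg One) 1 = axis (Pos Om) 1 \<odot> (axis (Pos Omb) 1 :: 'a oct)"
      "axis (Neg Om) 1 = axis (Pos Omb) 1 \<odot> (axis (Pos One) 1 :: 'a oct)"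
      by (simp_all add: oct_eq_iff oct_mult_nth axis_label_nth)
    then have neg_fixed: "\<alpha> (axis (Neg Omb) 1) = axis (Neg Omb) 1" "\<alpha> (axis (Neg One) 1) = axis (Neg One) 1"
        "\<alpha> (axis (Neg Om) 1) = axis (Neg Om) 1"
      by (simp_all add: mult fixed')
    have "\<alpha> (axis l 1) = axis l 1" for l
    proof (cases l)
      case (Pos b)
      then show ?thesis using fixed fixed' by (cases b) auto
    next
      case (Neg b)
      then show ?thesis using fixed neg_fixed by (cases b) auto
    qed
    moreover have "\<alpha> (\<Sum>l\<in>S. X $ l *s axis l 1) = (\<Sum>l\<in>S. X $ l *s \<alpha> (axis l 1))" for X S
      by (induction S rule: infinite_finite_induct) (simp_all add: zero add scale)
    ultimately have "\<alpha> X = X" for X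
      using basis_expansion[of X] by (metis (no_types, lifting) sum.cong)
    then have "f v = v" for v
      by (metis eq herm_exhaust)
    then show ?thesis
      using H_id by (metis eq_id_iff)
  qed
  have 2: "f \<in> H" if f: "f \<in> carrier SE6" "\<And>u. u \<in> frame_AB \<union> (\<lambda>i. eA (Pos i)) ` {One, Om} \<Longrightarrow> f u = u" for f
  proof (rule reduce[where v = "eA (Pos Omb)"])
    obtain \<alpha> where t: "triality \<alpha> \<alpha> \<alpha>" and eq: "\<And>a b c A B C. f (herm a b c A B C) = herm a b c (\<alpha> A) (\<alpha> B) (\<alpha> C)"
      and mult: "\<And>X Y. \<alpha> (X \<odot> Y) = \<alpha> X \<odot> \<alpha> Y"
      and fixed: "\<alpha> (axis (Pos Zero) 1) = axis (Pos Zero) 1"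
      using tri[of f] f by auto
    interpret triality \<alpha> \<alpha> \<alpha> by (rule t)
    \<comment> \<open>No spare index is left for \<open>reach_pos\<close>. The coordinate at
      \<open>Omb\<close> is already 1, because the dual basis vector \<open>e_{-omb}\<close> is the
      product \<open>e_1 e_om\<close> and hence fixed; this is the determinant condition of
      SL3.\<close>
    interpret siegel_moves "\<lambda>X Y. reach (frame_AB \<union> (\<lambda>i. eA (Pos i)) ` {One, Om}) (herm 0 0 0 X 0 0) (herm 0 0 0 Y 0 0)"
      "\<lambda>X. \<forall>l. l \<notin> Pos ` {One, Om, Omb} \<longrightarrow> X $ l = 0" "Pos ` ({One, Om, Omb} - {Omb})" "Pos Omb"
      by (rule siegel_moves_pos) auto
    have "\<alpha> (axis (Pos One) 1) = axis (Pos One) 1" "\<alpha> (axis (Pos Om) 1) = axis (Pos Om) 1"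
      using f(2)[of "eA (Pos One)"] f(2)[of "eA (Pos Om)"] by (simp_all add: eq)
    moreover have *: "axis (Neg Omb) 1 = axis (Pos One) 1 \<odot> (axis (Pos Om) 1 :: 'a oct)"
      by (simp add: oct_eq_iff oct_mult_nth axis_label_nth)
    ultimately have "\<alpha> (axis (Neg Omb) 1) = axis (Neg Omb) 1"
      by (simp add: mult)
    then have "\<alpha> (axis (Pos Omb) 1) $ Pos Omb = 1"
      using inner(1)[of "axis (Pos Omb) 1" "axis (Neg Omb) 1"] by (simp add: axis_label_nth)
    from clear[OF support[OF mult fixed t] this]
    show "reach (frame_AB \<union> (\<lambda>i. eA (Pos i)) ` {One, Om}) (f (eA (Pos Omb))) (eA (Pos Omb))"
      by (simp add: eq zero)
  next
    fix f
    assume "f \<in> carrier SE6" and fix_f: "\<And>u. u \<in> insert (eA (Pos Omb)) (frame_AB \<union> (\<lambda>i. eA (Pos i)) ` {One, Om}) \<Longrightarrow> f u = u"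
    moreover have "insert (eA (Pos Omb)) (frame_AB \<union> (\<lambda>i. eA (Pos i)) ` {One, Om}) =
        frame_AB \<union> (\<lambda>i. eA (Pos i)) ` {One, Om, Omb}"
      by auto
    ultimately show "f \<in> H"
      using 3 by metis
  qed (use f in auto)
  have 1: "f \<in> H" if f: "f \<in> carrier SE6" "\<And>u. u \<in> frame_AB \<union> (\<lambda>i. eA (Pos i)) ` {One} \<Longrightarrow> f u = u" for f
  proof (rule reduce[where v = "eA (Pos Om)"])
    obtain \<alpha> where t: "triality \<alpha> \<alpha> \<alpha>" and eq: "\<And>a b c A B C. f (herm a b c A B C) = herm a b c (\<alpha> A) (\<alpha> B) (\<alpha> C)"
      and mult: "\<And>X Y. \<alpha> (X \<odot> Y) = \<alpha> X \<odot> \<alpha> Y"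
      and fixed: "\<alpha> (axis (Pos Zero) 1) = axis (Pos Zero) 1"
      using tri[of f] f by auto
    interpret triality \<alpha> \<alpha> \<alpha> by (rule t)
    let ?q = "\<alpha> (axis (Pos Om) 1)"
    have q: "\<forall>l. l \<notin> Pos ` {One, Om, Omb} \<longrightarrow> ?q $ l = 0"
      by (rule support[OF mult fixed t]) simp
    have "?q $ Pos Om \<noteq> 0 \<or> ?q $ Pos Omb \<noteq> 0"
    proof (rule ccontr)
      \<comment> \<open>Otherwise \<open>e_om\<close> goes to a multiple of the fixed vector
        \<open>e_1\<close>, which is incompatible with its inner product 1 with
        \<open>e_{-om}\<close>.\<close>
      assume n: "\<not> (?q $ Pos Om \<noteq> 0 \<or> ?q $ Pos Omb \<noteq> 0)"
      have one: "\<alpha> (axis (Pos One) 1) = axis (Pos One) 1"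
        using f(2)[of "eA (Pos One)"] by (simp add: eq)
      have "?q $ l = axis (Pos One) (?q $ Pos One) $ l" for l
        using q n by (cases "l \<in> Pos ` {One, Om, Omb}") (auto simp: axis_label_nth)
      then have "?q = axis (Pos One) (?q $ Pos One)"
        unfolding vec_eq_iff by blast
      also have "\<dots> = ?q $ Pos One *s \<alpha> (axis (Pos One) 1)"
        by (simp add: one vec_eq_iff axis_label_nth)
      finally have "oct_inner ?q (\<alpha> (axis (Neg Om) 1)) = ?q $ Pos One * oct_inner (axis (Pos One) 1) (axis (Neg Om) 1)"
        by (metis inner(1) oct_inner_scale(1))
      then show False
        by (simp add: inner axis_label_nth)
    qed
    then have "reach (frame_AB \<union> (\<lambda>i. eA (Pos i)) ` {One}) (herm 0 0 0 ?q 0 0) (eA (Pos Om))"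
      using q by (elim disjE; intro reach_pos[where i = Omb]) auto
    then show "reach (frame_AB \<union> (\<lambda>i. eA (Pos i)) ` {One}) (f (eA (Pos Om))) (eA (Pos Om))"
      by (simp add: eq zero)
  next
    fix f
    assume "f \<in> carrier SE6" and fix_f: "\<And>u. u \<in> insert (eA (Pos Om)) (frame_AB \<union> (\<lambda>i. eA (Pos i)) ` {One}) \<Longrightarrow> f u = u"
    moreover have "insert (eA (Pos Om)) (frame_AB \<union> (\<lambda>i. eA (Pos i)) ` {One}) =
        frame_AB \<union> (\<lambda>i. eA (Pos i)) ` {One, Om}"
      by auto
    ultimately show "f \<in> H"
      using 2 by metis
  qed (use f in auto)
  show ?thesis
  proof (rule reduce[where v = "eA (Pos One)"])
    obtain \<alpha> where t: "triality \<alpha> \<alpha> \<alpha>" and eq: "\<And>a b c A B C. g (herm a b c A B C) = herm a b c (\<alpha> A) (\<alpha> B) (\<alpha> C)"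
      and mult: "\<And>X Y. \<alpha> (X \<odot> Y) = \<alpha> X \<odot> \<alpha> Y"
      and fixed: "\<alpha> (axis (Pos Zero) 1) = axis (Pos Zero) 1"
      using tri[OF g fix_g] by auto
    interpret triality \<alpha> \<alpha> \<alpha> by (rule t)
    let ?p = "\<alpha> (axis (Pos One) 1)"
    have p: "\<forall>l. l \<notin> Pos ` {One, Om, Omb} \<longrightarrow> ?p $ l = 0"
      by (rule support[OF mult fixed t]) simp
    have "?p \<noteq> 0"
      using inner(1)[of "axis (Pos One) 1" "axis (Neg One) 1"] by (auto simp: axis_label_nth)
    then obtain l where l: "?p $ l \<noteq> 0"
      by (auto simp: vec_eq_iff)
    have "l \<in> Pos ` {One, Om, Omb}"
      using p l by metis
    with l obtain j where "j \<in> {One, Om, Omb}" "?p $ Pos j \<noteq> 0"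
      by (metis imageE)
    then have "reach (frame_AB \<union> (\<lambda>i. eA (Pos i)) ` {}) (herm 0 0 0 ?p 0 0) (eA (Pos One))"
      using p by (intro reach_pos[where i = Om and j = j]) auto
    then show "reach frame_AB (g (eA (Pos One))) (eA (Pos One))"
      by (simp add: eq zero)
  next
    fix f
    assume "f \<in> carrier SE6" "\<And>u. u \<in> insert (eA (Pos One)) frame_AB \<Longrightarrow> f u = u"
    then show "f \<in> H"
      using 1[of f] by auto
  qed (use g fix_g in auto)
qed

end

section \<open>From the idempotents up to the whole isometry group\<close>

context elementary_group
begin

lemma singular_reach_B:
  assumes "X \<noteq> 0" "oct_norm X = 0"
  shows "reach frame (herm 0 0 0 0 X 0) (herm 0 0 0 0 (axis (Pos Zero) 1) 0)"
proof (rule singular_reach[of "\<lambda>X Y. reach frame (herm 0 0 0 0 X 0) (herm 0 0 0 0 Y 0)"])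
  show "reach frame (herm 0 0 0 0 X 0) (herm 0 0 0 0 (siegel j k t X) 0)" if "j \<noteq> k" for j k t X
    using that by (intro reach_siegel_B) (auto simp: frame_def root_herm siegel_def)
qed (use assms reach_refl reach_trans in blast)+

lemma singular_reach_C:
  assumes "X \<noteq> 0" "oct_norm X = 0"
  shows "reach frame (herm 0 0 0 0 0 X) (herm 0 0 0 0 0 (axis (Pos Zero) 1))"
proof (rule singular_reach[of "\<lambda>X Y. reach frame (herm 0 0 0 0 0 X) (herm 0 0 0 0 0 Y)"])
  show "reach frame (herm 0 0 0 0 0 X) (herm 0 0 0 0 0 (siegel j k t X))" if "j \<noteq> k" for j k t X
    using that by (intro reachI[OF root_H(3)[of j k t]]) (auto simp: frame_def root_herm siegel_def)
qed (use assms reach_refl reach_trans in blast)+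

text \<open>The two idempotents annihilate each other. With both fixed in part \<open>A\<close>,
  their images in part \<open>B\<close> are confined to the annihilators handled by
  \<open>reach_B_plus\<close> and \<open>reach_B_minus\<close>.\<close>

lemma frame_A_fixer_subset:
  assumes g: "g \<in> carrier SE6" and fix_g: "\<And>u. u \<in> frame_A \<Longrightarrow> g u = u"
  shows "g \<in> H"
proof -
  have frame_A: "ea \<in> frame_A" "eb \<in> frame_A" "ec \<in> frame_A" "eA (Pos Zero) \<in> frame_A" "eA (Neg Zero) \<in> frame_A"
    by (auto simp: frame_A_def frame_def)
  have null: "axis (Pos Zero) 1 \<odot> axis (Neg Zero) 1 = (0 :: 'a oct)"
    "axis (Neg Zero) 1 \<odot> axis (Pos Zero) 1 = (0 :: 'a oct)"
    by (simp_all add: oct_eq_iff oct_mult_nth axis_label_nth)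
  have label_cases: "X $ l = 0" if "\<And>b. X $ Pos b = 0 \<or> Pos b \<in> S" "\<And>b. X $ Neg b = 0 \<or> Neg b \<in> S" "l \<notin> S"
    for X :: "'a oct" and S l
    using that by (cases l) auto
  have minus: "f \<in> H" if f: "f \<in> carrier SE6" "\<And>u. u \<in> insert (eB (Pos Zero)) frame_A \<Longrightarrow> f u = u" for f
  proof (rule reduce[where v = "eB (Neg Zero)"])
    obtain \<alpha> \<beta> \<gamma> where t: "triality \<alpha> \<beta> \<gamma>"
      and eq: "\<And>a b c A B C. f (herm a b c A B C) = herm a b c (\<alpha> A) (\<beta> B) (\<gamma> C)"
      using frame_stabilizer_triality[OF f(1)] f(2) frame_A by (metis insert_iff)
    interpret triality \<alpha> \<beta> \<gamma> by (rule t)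
    let ?X = "\<beta> (axis (Neg Zero) 1)"
    have fixed: "\<alpha> (axis (Pos Zero) 1) = axis (Pos Zero) 1" "\<beta> (axis (Pos Zero) 1) = axis (Pos Zero) 1"
      using f(2)[of "eA (Pos Zero)"] f(2)[of "eB (Pos Zero)"] frame_A by (simp_all add: eq)
    have 1: "?X $ Neg Zero = 1"
      using inner(2)[of "axis (Pos Zero) 1" "axis (Neg Zero) 1"] by (simp add: fixed axis_label_nth)
    have "axis (Pos Zero) 1 \<odot> ?X = 0"
      using annihilator[OF null(1)] by (simp add: fixed)
    then have *: "?X $ Pos Zero = 0" "?X $ Neg One = 0" "?X $ Neg Om = 0" "?X $ Neg Omb = 0"
      by (simp_all add: oct_eq_iff oct_mult_nth axis_label_nth)
    have 2: "?X $ l = 0" if "l \<notin> {Neg Zero, Pos One, Pos Om, Pos Omb}" for l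
    proof (rule label_cases[OF _ _ that])
      show "?X $ Pos b = 0 \<or> Pos b \<in> {Neg Zero, Pos One, Pos Om, Pos Omb}" for b
        using * by (cases b) auto
      show "?X $ Neg b = 0 \<or> Neg b \<in> {Neg Zero, Pos One, Pos Om, Pos Omb}" for b
        using * by (cases b) auto
    qed
    show "reach (insert (eB (Pos Zero)) frame_A) (f (eB (Neg Zero))) (eB (Neg Zero))"
      using reach_B_minus[OF 1 2] by (simp add: eq zero)
  next
    fix f :: "'a albert \<Rightarrow> 'a albert"
    assume "f \<in> carrier SE6" "\<And>u. u \<in> insert (eB (Neg Zero)) (insert (eB (Pos Zero)) frame_A) \<Longrightarrow> f u = u"
    then show "f \<in> H"
      by (intro frame_AB_fixer_subset) (simp_all add: frame_AB_def)
  qed (use f in auto)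
  show ?thesis
  proof (rule reduce[where v = "eB (Pos Zero)"])
    obtain \<alpha> \<beta> \<gamma> where t: "triality \<alpha> \<beta> \<gamma>"
      and eq: "\<And>a b c A B C. g (herm a b c A B C) = herm a b c (\<alpha> A) (\<beta> B) (\<gamma> C)"
      using frame_stabilizer_triality[OF g] fix_g frame_A by metis
    interpret triality \<alpha> \<beta> \<gamma> by (rule t)
    let ?X = "\<beta> (axis (Pos Zero) 1)"
    have fixed: "\<alpha> (axis (Neg Zero) 1) = axis (Neg Zero) 1"
      using fix_g[of "eA (Neg Zero)"] frame_A by (simp add: eq)
    have 1: "?X \<noteq> 0"
      using inner(2)[of "axis (Pos Zero) 1" "axis (Neg Zero) 1"] by (auto simp: axis_label_nth)
    have "axis (Neg Zero) 1 \<odot> ?X = 0"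
      using annihilator[OF null(2)] by (simp add: fixed)
    then have *: "?X $ Neg Zero = 0" "?X $ Pos One = 0" "?X $ Pos Om = 0" "?X $ Pos Omb = 0"
      by (simp_all add: oct_eq_iff oct_mult_nth axis_label_nth)
    have 2: "?X $ l = 0" if "l \<notin> {Pos Zero, Neg One, Neg Om, Neg Omb}" for l
    proof (rule label_cases[OF _ _ that])
      show "?X $ Pos b = 0 \<or> Pos b \<in> {Pos Zero, Neg One, Neg Om, Neg Omb}" for b
        using * by (cases b) auto
      show "?X $ Neg b = 0 \<or> Neg b \<in> {Pos Zero, Neg One, Neg Om, Neg Omb}" for b
        using * by (cases b) auto
    qed
    show "reach frame_A (g (eB (Pos Zero))) (eB (Pos Zero))"
      using reach_B_plus[OF 1 2] by (simp add: eq zero)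
  next
    fix f :: "'a albert \<Rightarrow> 'a albert"
    assume "f \<in> carrier SE6" "\<And>u. u \<in> insert (eB (Pos Zero)) frame_A \<Longrightarrow> f u = u"
    then show "f \<in> H"
      by (rule minus)
  qed (use g fix_g in auto)
qed

lemma frame_fixer_subset:
  assumes g: "g \<in> carrier SE6" and fix_g: "\<And>u. u \<in> frame \<Longrightarrow> g u = u"
  shows "g \<in> H"
proof -
  have frame: "ea \<in> frame" "eb \<in> frame" "ec \<in> frame"
    by (auto simp: frame_def)
  have minus: "f \<in> H" if f: "f \<in> carrier SE6" "\<And>u. u \<in> insert (eA (Pos Zero)) frame \<Longrightarrow> f u = u" for f
  proof (rule reduce[where v = "eA (Neg Zero)"])
    obtain \<alpha> \<beta> \<gamma> where t: "triality \<alpha> \<beta> \<gamma>"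
      and eq: "\<And>a b c A B C. f (herm a b c A B C) = herm a b c (\<alpha> A) (\<beta> B) (\<gamma> C)"
      using frame_stabilizer_triality[OF f(1)] f(2) frame by (metis insert_iff)
    interpret triality \<alpha> \<beta> \<gamma> by (rule t)
    have fixed: "\<alpha> (axis (Pos Zero) 1) = axis (Pos Zero) 1"
      using f(2)[of "eA (Pos Zero)"] by (simp add: eq)
    have "\<alpha> (axis (Neg Zero) 1) $ Neg Zero = 1"
      using inner(1)[of "axis (Pos Zero) 1" "axis (Neg Zero) 1"] by (simp add: fixed axis_label_nth)
    then show "reach (insert (eA (Pos Zero)) frame) (f (eA (Neg Zero))) (eA (Neg Zero))"
      using reach_A_minus by (simp add: eq zero norm)
  next
    fix f :: "'a albert \<Rightarrow> 'a albert"
    assume "f \<in> carrier SE6" "\<And>u. u \<in> insert (eA (Neg Zero)) (insert (eA (Pos Zero)) frame) \<Longrightarrow> f u = u"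
    then show "f \<in> H"
      by (intro frame_A_fixer_subset) (simp_all add: frame_A_def)
  qed (use f in auto)
  show ?thesis
  proof (rule reduce[where v = "eA (Pos Zero)"])
    obtain \<alpha> \<beta> \<gamma> where t: "triality \<alpha> \<beta> \<gamma>"
      and eq: "\<And>a b c A B C. g (herm a b c A B C) = herm a b c (\<alpha> A) (\<beta> B) (\<gamma> C)"
      using frame_stabilizer_triality[OF g] fix_g frame by metis
    interpret triality \<alpha> \<beta> \<gamma> by (rule t)
    have "\<alpha> (axis (Pos Zero) 1) \<noteq> 0"
      using inner(1)[of "axis (Pos Zero) 1" "axis (Neg Zero) 1"] by (auto simp: axis_label_nth)
    then show "reach frame (g (eA (Pos Zero))) (eA (Pos Zero))"
      using singular_reach_A by (simp add: eq zero norm)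
  next
    fix f :: "'a albert \<Rightarrow> 'a albert"
    assume "f \<in> carrier SE6" "\<And>u. u \<in> insert (eA (Pos Zero)) frame \<Longrightarrow> f u = u"
    then show "f \<in> H"
      by (rule minus)
  qed (use g fix_g in auto)
qed

lemma white_frame: "white ea" "white eb" "white ec"
  by (simp_all add: white_herm herm_eq_0_iff)

theorem SE6_subset: "carrier SE6 \<subseteq> H"
proof
  fix g :: "'a albert \<Rightarrow> 'a albert"
  assume g: "g \<in> carrier SE6"
  have 2: "f \<in> H" if f: "f \<in> carrier SE6" "\<And>u. u \<in> {ea, eb} \<Longrightarrow> f u = u" for f
  proof (rule reduce[where v = ec])
    obtain a b c A B C where w: "f ec = herm a b c A B C"
      by (rule herm_exhaust)
    \<comment> \<open>\<open>det_tri ea eb\<close> reads off the coordinate \<open>Cc\<close>, so no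
      rescaling is left to do.\<close>
    have "c = 1"
      using SE6_det(3)[OF f(1), of ea eb ec] f(2)[of ea] f(2)[of eb] by (simp add: w det_tri_def)
    then show "reach {ea, eb} (f ec) ec"
      using reach_clear_c[of a b c A B C] white_SE6[OF f(1) white_frame(3)] by (simp add: w)
  next
    fix f :: "'a albert \<Rightarrow> 'a albert"
    assume "f \<in> carrier SE6" "\<And>u. u \<in> insert ec {ea, eb} \<Longrightarrow> f u = u"
    then show "f \<in> H"
      by (intro frame_fixer_subset) (auto simp: frame_def)
  qed (use f in auto)
  have 1: "f \<in> H" if f: "f \<in> carrier SE6" "\<And>u. u \<in> {ea} \<Longrightarrow> f u = u" for f
  proof (rule reduce[where v = eb])
    obtain a b c A B C where w: "f eb = herm a b c A B C"
      by (rule herm_exhaust)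
    \<comment> \<open>The value would be 0 if \<open>f eb\<close> lacked general position to
      \<open>ea\<close>.\<close>
    have "det_tri ea (f eb) (f ec) = 1"
      using SE6_det(3)[OF f(1), of ea eb ec] f(2)[of ea] by (simp add: det_tri_def)
    then have "b \<noteq> 0 \<or> c \<noteq> 0 \<or> A \<noteq> 0"
      by (auto simp: w det_tri_def)
    then show "reach {ea} (f eb) eb"
      using white_transitive_opposite[of a b c A B C] white_SE6[OF f(1) white_frame(2)] by (simp add: w)
  next
    fix f :: "'a albert \<Rightarrow> 'a albert"
    assume "f \<in> carrier SE6" "\<And>u. u \<in> {eb, ea} \<Longrightarrow> f u = u"
    then show "f \<in> H"
      using 2 by auto
  qed (use f in auto)
  show "g \<in> H"
  proof (rule reduce[where v = ea and V = "{}"])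
    show "reach {} (g ea) ea"
      by (rule white_transitive[OF white_SE6[OF g white_frame(1)]])
  qed (use g 1 in auto)
qed

end

section \<open>The unipotent radical of a point stabilizer\<close>

abbreviation finv :: "('b \<Rightarrow> 'b) \<Rightarrow> 'b \<Rightarrow> 'b" where "finv \<equiv> inv_into UNIV"

lemma herm_minus:
  "herm a b c A B C - herm a' b' c' A' B' C' = herm (a - a') (b - b') (c - c') (A - A') (B - B') (C - C')"
  by (auto simp: albert_eq_iff vec_eq_iff part_nth)

text \<open>For a white \<open>e\<close> this is the 17-dimensional tangent space at
  \<open>e\<close> to the cone of white vectors. General position of a white vector to
  \<open>e\<close> means lying outside it.\<close>

definition tri_radical :: "'a::comm_ring_1 albert \<Rightarrow> 'a albert set" where
  "tri_radical e = {x. \<forall>y. det_tri e x y = 0}"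

text \<open>Describing the group by the flag, in place of products of \<open>E12 x\<close> and
  \<open>E13 y\<close>, makes it equivariant under conjugation, so \<open>unipotent ea\<close> is
  normal in the stabilizer of \<open>ea\<close> without any computation.\<close>

definition unipotent :: "'a::field albert \<Rightarrow> ('a albert \<Rightarrow> 'a albert) set" where
  "unipotent e = {f \<in> carrier SE6. f e = e \<and> (\<forall>x\<in>tri_radical e. \<exists>c. f x = x + c *s e) \<and>
     (\<forall>x. f x - x \<in> tri_radical e)}"

lemma herm_in_tri_radical: "herm a b c A B C \<in> tri_radical ea \<longleftrightarrow> b = 0 \<and> c = 0 \<and> A = 0"
proof
  assume "herm a b c A B C \<in> tri_radical ea"
  then have *: "det_tri ea (herm a b c A B C) y = 0" for y
    by (simp add: tri_radical_def)
  have "b = 0" "c = 0"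
    using *[of ec] *[of eb] by (simp_all add: det_tri_def)
  moreover have "oct_inner A y = 0" for y
    using *[of "herm 0 0 0 y 0 0"] by (simp add: det_tri_def)
  ultimately show "b = 0 \<and> c = 0 \<and> A = 0"
    using oct_nondegenerate by blast
qed (simp add: tri_radical_def det_tri_def)

lemma tri_radical_eaE:
  assumes "x \<in> tri_radical ea"
  obtains a B C where "x = herm a 0 0 0 B C"
  using assms herm_exhaust herm_in_tri_radical by metis

lemma tri_radical_SE6:
  assumes "g \<in> carrier SE6" "x \<in> tri_radical e"
  shows "g x \<in> tri_radical (g e)"
proof -
  have "det_tri (g e) (g x) y = 0" for y
    using SE6_det(3)[OF assms(1), of e x "finv g y"] assms by (simp add: SE6_inv_into tri_radical_def)
  then show ?thesis
    by (simp add: tri_radical_def)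
qed

lemma tri_radical_linear:
  "x \<in> tri_radical e \<Longrightarrow> y \<in> tri_radical e \<Longrightarrow> x + y \<in> tri_radical e"
  "x \<in> tri_radical e \<Longrightarrow> c *s x \<in> tri_radical e"
  by (simp_all add: tri_radical_def det_tri_add det_tri_scale)

lemma unipotent_on_radical: "f \<in> unipotent e \<Longrightarrow> x \<in> tri_radical e \<Longrightarrow> \<exists>c. f x = x + c *s e"
  by (simp add: unipotent_def)

lemma unipotent_conj:
  assumes "g \<in> carrier SE6" "f \<in> unipotent e"
  shows "g \<circ> f \<circ> finv g \<in> unipotent (g e)"
proof -
  note inv = SE6_inv_into[OF assms(1)]
  have f: "f \<in> carrier SE6" "f e = e"
    using assms(2) by (auto simp: unipotent_def)
  have "\<exists>c. g (f (finv g x)) = x + c *s g e" if "x \<in> tri_radical (g e)" for x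
  proof -
    have "finv g x \<in> tri_radical e"
      using tri_radical_SE6[OF inv(1) that] by (simp add: inv)
    then obtain c where "f (finv g x) = finv g x + c *s e"
      using unipotent_on_radical[OF assms(2)] by blast
    then show ?thesis
      using assms(1) by (auto simp: SE6_linear inv)
  qed
  moreover have "g (f (finv g x)) - x \<in> tri_radical (g e)" for x
  proof -
    have "f (finv g x) - finv g x \<in> tri_radical e"
      using assms(2) by (simp add: unipotent_def)
    then have "g (f (finv g x) - finv g x) \<in> tri_radical (g e)"
      by (rule tri_radical_SE6[OF assms(1)])
    then show ?thesis
      by (simp add: SE6_linear[OF assms(1)] inv)
  qed
  ultimately show ?thesis
    using f inv assms(1) by (auto simp: unipotent_def intro: SE6_comp)
qed

lemma unipotent_comp:
  assumes "f \<in> unipotent e" "g \<in> unipotent e"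
  shows "f \<circ> g \<in> unipotent e"
proof -
  have f: "f \<in> carrier SE6" "g \<in> carrier SE6" "f e = e" "g e = e"
    using assms by (auto simp: unipotent_def)
  have "\<exists>c. f (g x) = x + c *s e" if x: "x \<in> tri_radical e" for x
  proof -
    obtain c d where "f x = x + c *s e" "g x = x + d *s e"
      using unipotent_on_radical[OF assms(1) x] unipotent_on_radical[OF assms(2) x] by blast
    then have "f (g x) = x + (c + d) *s e"
      using f by (simp add: SE6_linear vector_sadd_rdistrib)
    then show ?thesis ..
  qed
  moreover have "f (g x) - x \<in> tri_radical e" for x
  proof -
    have "f (g x) - g x \<in> tri_radical e" "g x - x \<in> tri_radical e"
      using assms by (auto simp: unipotent_def)
    then show ?thesis
      using tri_radical_linear(1)[of "f (g x) - g x" e "g x - x"] by simp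
  qed
  ultimately show ?thesis
    using f by (auto simp: unipotent_def intro: SE6_comp)
qed

lemma unipotent_inv:
  assumes "f \<in> unipotent e"
  shows "finv f \<in> unipotent e"
proof -
  have f: "f \<in> carrier SE6" "f e = e"
    using assms by (auto simp: unipotent_def)
  note inv = SE6_inv_into[OF f(1)]
  have e: "finv f e = e"
    using inv(2)[of e] f(2) by simp
  have "\<exists>c. finv f x = x + c *s e" if x: "x \<in> tri_radical e" for x
  proof -
    obtain c where "f x = x + c *s e"
      using unipotent_on_radical[OF assms x] by blast
    then have "x = finv f x + c *s e"
      using inv(2)[of x] by (simp add: SE6_linear[OF inv(1)] e)
    then have "finv f x = x + (- c) *s e"
      by (simp add: algebra_simps)
    then show ?thesis ..
  qed
  moreover have "finv f x - x \<in> tri_radical e" for x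
  proof -
    have "f (finv f x) - finv f x \<in> tri_radical e"
      using assms by (simp add: unipotent_def)
    then have "(- 1) *s (x - finv f x) \<in> tri_radical e"
      by (intro tri_radical_linear) (simp add: inv)
    then show ?thesis
      by simp
  qed
  ultimately show ?thesis
    using inv(1) e by (auto simp: unipotent_def)
qed

lemma E12_unipotent: "E12 x \<in> unipotent ea"
proof -
  have "\<exists>c. E12 x v = v + c *s ea" if v: "v \<in> tri_radical ea" for v
  proof -
    obtain a B C where "v = herm a 0 0 0 B C"
      using v by (rule tri_radical_eaE)
    then have "E12 x v = v + oct_inner x C *s ea"
      by (simp add: herm_linear)
    then show ?thesis ..
  qed
  moreover have "E12 x v - v \<in> tri_radical ea" for v
    by (cases v rule: herm_exhaust) (simp add: herm_minus herm_in_tri_radical)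
  ultimately show ?thesis
    by (simp add: unipotent_def elementary_SE6)
qed

lemma E13_unipotent: "E13 x \<in> unipotent ea"
proof -
  have "\<exists>c. E13 x v = v + c *s ea" if v: "v \<in> tri_radical ea" for v
  proof -
    obtain a B C where "v = herm a 0 0 0 B C"
      using v by (rule tri_radical_eaE)
    then have "E13 x v = v + oct_inner x B *s ea"
      by (simp add: herm_linear)
    then show ?thesis ..
  qed
  moreover have "E13 x v - v \<in> tri_radical ea" for v
    by (cases v rule: herm_exhaust) (simp add: herm_minus herm_in_tri_radical)
  ultimately show ?thesis
    by (simp add: unipotent_def elementary_SE6)
qed

text \<open>Comparing \<open>det_deriv (f x) (f s)\<close> with \<open>det_deriv x s\<close> for \<open>s = g x - x\<close>, where
  \<open>f s = s + c *s ea\<close>, gives \<open>c\<close> as the value of a form symmetric in \<open>f\<close> and \<open>g\<close>,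
  divided by \<open>det_deriv x ea\<close>.\<close>

lemma unipotent_commute_at:
  assumes f: "f \<in> unipotent ea" and g: "g \<in> unipotent ea" and x: "det_deriv x ea \<noteq> 0"
  shows "f (g x) = g (f x)"
proof -
  have SE6: "f \<in> carrier SE6" "g \<in> carrier SE6"
    using f g by (auto simp: unipotent_def)
  define y z where "y = f x - x" and "z = g x - x"
  have rad: "y \<in> tri_radical ea" "z \<in> tri_radical ea"
    using f g by (auto simp: unipotent_def y_def z_def)
  have *: "c * det_deriv x ea = - det_tri x s t"
    if h: "h \<in> carrier SE6" "h x = x + s" "h t = t + c *s ea" and st: "s \<in> tri_radical ea" "t \<in> tri_radical ea"
    for h c s t
  proof -
    obtain a B C a' B' C' where st: "s = herm a 0 0 0 B C" "t = herm a' 0 0 0 B' C'"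
      using st by (metis tri_radical_eaE)
    have "det_deriv x t = det_deriv (x + s) (t + c *s ea)"
      using SE6_det(2)[OF h(1), of x t] h by simp
    also have "\<dots> = det_deriv x t + c * det_deriv x ea + (det_deriv s t + c * det_deriv s ea) +
        (det_tri x s t + c * det_tri x s ea)"
      by (simp add: det_deriv_add det_deriv_linear det_tri_add det_tri_scale det_tri_commute(1)[of s] algebra_simps)
    also have "\<dots> = det_deriv x t + c * det_deriv x ea + det_tri x s t"
      by (simp add: st det_deriv_def det_tri_def)
    finally show ?thesis
      by (simp add: algebra_simps add_eq_0_iff)
  qed
  obtain c where c: "f z = z + c *s ea"
    using unipotent_on_radical[OF f rad(2)] by blast
  obtain d where d: "g y = y + d *s ea"
    using unipotent_on_radical[OF g rad(1)] by blast
  have "c * det_deriv x ea = d * det_deriv x ea"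
    using *[OF SE6(1) _ c rad] *[OF SE6(2) _ d rad(2,1)] det_tri_commute(2)[of x y z]
    by (simp add: y_def z_def)
  with x have "c = d"
    by simp
  have "f (g x) = f x + f z" "g (f x) = g x + g y"
    by (simp_all add: y_def z_def SE6_linear SE6)
  then have "f (g x) = (x + y) + (z + c *s ea)" "g (f x) = (x + z) + (y + d *s ea)"
    by (simp_all only: c d) (simp_all add: y_def z_def)
  then show ?thesis
    using \<open>c = d\<close> by (simp add: add_ac)
qed

text \<open>Both maps are linear, so they commute on a subspace. The vectors with
  \<open>det_deriv x ea \<noteq> 0\<close>, to which the preceding lemma applies, span the whole
  space over every field.\<close>

lemma unipotent_commute:
  assumes f: "f \<in> unipotent ea" and g: "g \<in> unipotent ea"
  shows "f \<circ> g = g \<circ> f"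
proof -
  have SE6: "f \<in> carrier SE6" "g \<in> carrier SE6"
    using f g by (auto simp: unipotent_def)
  define W where "W = {x. f (g x) = g (f x)}"
  have add: "x + y \<in> W" "x - y \<in> W" "r *s x \<in> W" if "x \<in> W" "y \<in> W" for x y r
    using that by (simp_all add: W_def SE6_linear SE6)
  have W: "x \<in> W" if "det_deriv x ea \<noteq> 0" for x
    using unipotent_commute_at[OF f g that] by (simp add: W_def)
  \<comment> \<open>\<open>det_deriv x ea\<close> is \<open>b * c - oct_norm A\<close>, and all
    vectors in these differences give -1.\<close>
  have "herm 0 1 0 (oct_scalar 1) 0 0 - herm 0 0 0 (oct_scalar 1) 0 0 \<in> W"
    "herm 0 0 1 (oct_scalar 1) 0 0 - herm 0 0 0 (oct_scalar 1) 0 0 \<in> W"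
    by (intro add W; simp add: det_deriv_def oct_norm_def sum_base oct_scalar_def axis_def)+
  then have e: "eb \<in> W" "ec \<in> W"
    by (simp_all add: herm_minus)
  have "x \<in> W" for x
  proof (cases x rule: herm_exhaust)
    case (1 a b c A B C)
    \<comment> \<open>With \<open>b = 1\<close> this choice of \<open>c\<close> makes the derivative
      equal to 1 whatever \<open>A\<close> is.\<close>
    have "herm a 1 (1 + oct_norm A) A B C \<in> W"
      by (rule W) (simp add: det_deriv_def)
    then have "herm a 1 (1 + oct_norm A) A B C + ((b - 1) *s eb + (c - (1 + oct_norm A)) *s ec) \<in> W"
      using e by (intro add)
    then show ?thesis
      by (simp add: 1 herm_linear)
  qed
  then show ?thesis
    by (auto simp: W_def)
qed

section \<open>Normal subgroups\<close>

lemma elementary_groupI: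
  assumes "subgroup H SE6"
    and "\<And>x. E12 x \<in> H" "\<And>x. E21 x \<in> H" "\<And>x. E23 x \<in> H" "\<And>x. E32 x \<in> H" "\<And>x. E31 x \<in> H" "\<And>x. E13 x \<in> H"
  shows "elementary_group H"
proof
  show "H \<subseteq> carrier SE6" "id \<in> H"
    using subgroup.subset[OF assms(1)] subgroup.one_closed[OF assms(1)] by simp_all
  show "f \<circ> g \<in> H" if "f \<in> H" "g \<in> H" for f g
    using subgroup.m_closed[OF assms(1) that] by simp
  show "finv f \<in> H" if "f \<in> H" for f
    using subgroup.m_inv_closed[OF assms(1) that] subgroup.subset[OF assms(1)] that
    by (simp add: SE6_inv subset_iff)
qed (use assms in auto)

lemma elementary_group_SE6: "elementary_group (carrier SE6)"
  by (intro elementary_groupI group.subgroup_self SE6_group elementary_SE6)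

lemma opposite_pair:
  assumes "white v" "white w" "w \<notin> tri_radical v"
  shows "\<exists>g\<in>carrier SE6. g v = ea \<and> g w = eb"
proof -
  interpret elementary_group "carrier SE6" by (rule elementary_group_SE6)
  obtain g where g: "g \<in> carrier SE6" "g v = ea"
    using white_transitive[OF assms(1)] by (auto simp: reach_def)
  have "g w \<notin> tri_radical ea"
    using tri_radical_SE6[OF SE6_inv_into(1)[OF g(1)], of "g w" ea] g assms(3)
    by (metis SE6_inv_into(2))
  obtain a b c A B C where w: "g w = herm a b c A B C"
    by (rule herm_exhaust)
  have "reach {ea} (g w) eb"
    using white_transitive_opposite[of a b c A B C] white_SE6[OF g(1) assms(2)] \<open>g w \<notin> tri_radical ea\<close>
    by (auto simp: w herm_in_tri_radical)
  then obtain h where "h \<in> carrier SE6" "h ea = ea" "h (g w) = eb"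
    by (auto simp: reach_def)
  with g show ?thesis
    by (intro bexI[of _ "h \<circ> g"]) (auto intro: SE6_comp)
qed

section \<open>Orbits of a normal subgroup on white vectors\<close>

locale normal_SE6 =
  fixes K :: "('a::field albert \<Rightarrow> 'a albert) set"
  assumes normal: "K \<lhd> SE6"
begin

lemma K_SE6: "k \<in> K \<Longrightarrow> k \<in> carrier SE6"
  using normal_imp_subgroup[OF normal] subgroup.subset by blast

lemma K_comp: "k \<in> K \<Longrightarrow> l \<in> K \<Longrightarrow> k \<circ> l \<in> K"
  using subgroup.m_closed[OF normal_imp_subgroup[OF normal]] by simp

lemma K_inv: "k \<in> K \<Longrightarrow> finv k \<in> K"
  using subgroup.m_inv_closed[OF normal_imp_subgroup[OF normal]] by (simp add: SE6_inv K_SE6)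

lemma K_conj: "g \<in> carrier SE6 \<Longrightarrow> k \<in> K \<Longrightarrow> g \<circ> k \<circ> finv g \<in> K"
  using normal.inv_op_closed2[OF normal, of g k] by (simp add: SE6_inv)

text \<open>Pairs in general position form one orbit, so some conjugate of \<open>k\<close> maps
  \<open>v\<close> to \<open>w\<close>.\<close>

lemma transitive_on_opposite_pairs:
  assumes k: "k \<in> K" "white p" "k p \<notin> tri_radical p"
    and vw: "white v" "white w" "w \<notin> tri_radical v"
  shows "\<exists>k\<in>K. k v = w"
proof -
  obtain h where h: "h \<in> carrier SE6" "h p = ea" "h (k p) = eb"
    using opposite_pair[OF k(2) white_SE6[OF K_SE6[OF k(1)] k(2)] k(3)] by blast
  obtain g where g: "g \<in> carrier SE6" "g v = ea" "g w = eb"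
    using opposite_pair[OF vw] by blast
  note inv = SE6_inv_into[OF g(1)] SE6_inv_into[OF h(1)]
  have "finv g \<circ> (h \<circ> k \<circ> finv h) \<circ> finv (finv g) \<in> K"
    by (intro K_conj h k inv)
  moreover have "finv (finv g) = g"
    using SE6_bij[OF g(1)] by (rule inv_inv_eq)
  moreover have "finv h ea = p" "finv g eb = w"
    using inv(5)[of p] inv(2)[of w] g h by simp_all
  ultimately show ?thesis
    using g h by (intro bexI[of _ "finv g \<circ> (h \<circ> k \<circ> finv h) \<circ> g"]) auto
qed

text \<open>If \<open>w\<close> is not in general position to \<open>ea\<close>, some white
  \<open>z\<close> is in general position to both, and two steps of the preceding lemma
  suffice.\<close>

lemma transitive_on_white:
  assumes k: "k \<in> K" "white p" "k p \<notin> tri_radical p" and w: "white w"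
  shows "\<exists>k\<in>K. k ea = w"
proof (cases "w \<in> tri_radical ea")
  case False
  then show ?thesis
    using transitive_on_opposite_pairs[OF k _ w] by (simp add: white_herm herm_eq_0_iff)
next
  case True
  then obtain a B C where eq: "w = herm a 0 0 0 B C"
    by (rule tri_radical_eaE)
  have "\<exists>z. white z \<and> z \<notin> tri_radical ea \<and> w \<notin> tri_radical z"
  proof -
    consider "C \<noteq> 0" | "B \<noteq> 0" | "B = 0" "C = 0" by blast
    then show ?thesis
    proof cases
      case 1
      then obtain x where x: "oct_inner x C = a + 1"
        using oct_inner_surj by blast
      \<comment> \<open>The vector is \<open>E12 x eb\<close>, and the choice of \<open>x\<close>
        makes this value -1. In the second case \<open>E13 x ec\<close> plays the same part.\<close>
      have "det_tri (herm (oct_norm x) 1 0 0 0 x) w ec \<noteq> 0"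
        by (simp add: eq det_tri_def x)
      then have "w \<notin> tri_radical (herm (oct_norm x) 1 0 0 0 x)"
        by (auto simp: tri_radical_def)
      moreover have "white (herm (oct_norm x) 1 0 0 0 x)"
        by (simp add: white_herm herm_eq_0_iff)
      ultimately show ?thesis
        by (intro exI[of _ "herm (oct_norm x) 1 0 0 0 x"]) (simp add: herm_in_tri_radical)
    next
      case 2
      then obtain x where x: "oct_inner x B = a + 1"
        using oct_inner_surj by blast
      have "det_tri (herm (oct_norm x) 0 1 0 x 0) w eb \<noteq> 0"
        by (simp add: eq det_tri_def x)
      then have "w \<notin> tri_radical (herm (oct_norm x) 0 1 0 x 0)"
        by (auto simp: tri_radical_def)
      moreover have "white (herm (oct_norm x) 0 1 0 x 0)"
        by (simp add: white_herm herm_eq_0_iff)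
      ultimately show ?thesis
        by (intro exI[of _ "herm (oct_norm x) 0 1 0 x 0"]) (simp add: herm_in_tri_radical)
    next
      case 3
      with w have "a \<noteq> 0"
        by (auto simp: eq white_def herm_eq_0_iff)
      then have "det_tri eb w ec \<noteq> 0"
        by (simp add: eq det_tri_def)
      then have "w \<notin> tri_radical eb"
        by (auto simp: tri_radical_def)
      moreover have "white eb"
        by (simp add: white_herm herm_eq_0_iff)
      ultimately show ?thesis
        by (intro exI[of _ "eb"]) (simp add: herm_in_tri_radical)
    qed
  qed
  then obtain z where z: "white z" "z \<notin> tri_radical ea" "w \<notin> tri_radical z"
    by blast
  have "white ea"
    by (simp add: white_herm herm_eq_0_iff)
  then obtain k1 k2 where "k1 \<in> K" "k1 ea = z" "k2 \<in> K" "k2 z = w"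
    using transitive_on_opposite_pairs[OF k _ z(1,2)] transitive_on_opposite_pairs[OF k z(1) w z(3)] by blast
  then show ?thesis
    by (intro bexI[of _ "k2 \<circ> k1"]) (auto intro: K_comp)
qed

text \<open>After conjugation \<open>p\<close> is \<open>ea\<close>. If \<open>l ea\<close> is still
  tangent at \<open>ea\<close>, some \<open>h\<close> that fixes the frame moves \<open>l ea\<close>
  to general position with itself. As \<open>h\<close> fixes \<open>ea\<close>, the commutator of
  \<open>h\<close> and \<open>l\<close> sends \<open>l ea\<close> to \<open>h (l ea)\<close>, and it
  lies in \<open>K\<close>.\<close>

lemma moves_to_opposite_if_moves:
  assumes k: "k \<in> K" and p: "white p" "\<nexists>c. k p = c *s p"
  shows "\<exists>k\<in>K. \<exists>p. white p \<and> k p \<notin> tri_radical p"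
proof -
  interpret G: elementary_group "carrier SE6" by (rule elementary_group_SE6)
  obtain g where g: "g \<in> carrier SE6" "g p = ea"
    using G.white_transitive[OF p(1)] by (auto simp: G.reach_def)
  define l where "l = g \<circ> k \<circ> finv g"
  have l: "l \<in> K"
    unfolding l_def by (rule K_conj[OF g(1) k])
  have "finv g ea = p"
    using SE6_inv_into(2)[OF g(1), of p] g by simp
  then have l_ea: "l ea = g (k p)"
    by (simp add: l_def)
  have "l ea \<noteq> c *s ea" for c
  proof
    assume "l ea = c *s ea"
    then have "g (k p) = g (c *s p)"
      by (simp add: l_ea g SE6_linear[OF g(1)] del: herm_eq_iff)
    then have "k p = c *s p"
      using SE6_inv_into(2)[OF g(1)] by metis
    with p(2) show False
      by blast
  qed
  note not_scalar = this
  have ea: "white ea"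
    by (simp add: white_herm herm_eq_0_iff)
  have white_l: "white (l ea)"
    by (rule white_SE6[OF K_SE6[OF l] ea])
  show ?thesis
  proof (cases "l ea \<in> tri_radical ea")
    case False
    then show ?thesis
      using l ea by blast
  next
    case True
    then obtain a B C where w: "l ea = herm a 0 0 0 B C"
      by (rule tri_radical_eaE)
    have "B \<noteq> 0 \<or> C \<noteq> 0"
      using not_scalar[of a] w by (auto simp: herm_linear)
    have "oct_norm B = 0" "oct_norm C = 0"
      using white_l by (simp_all add: w white_herm)
    have "\<exists>h\<in>carrier SE6. h ea = ea \<and> h (l ea) \<notin> tri_radical (l ea)"
    proof (cases "C = 0")
      case False
      then obtain i where i: "C $ i \<noteq> 0"
        by (auto simp: vec_eq_iff)
      \<comment> \<open>Singular nonzero vectors form one orbit of the frame stabilizer. The target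
        has label \<open>neg i\<close> so that its inner product with \<open>C\<close> is the
        nonzero number \<open>C $ i\<close>.\<close>
      have "G.reach G.frame (herm 0 0 0 0 0 C) (herm 0 0 0 0 0 (axis (neg i) 1))"
        using False \<open>oct_norm C = 0\<close>
        by (intro G.reach_trans[OF G.singular_reach_C G.reach_sym[OF G.singular_reach_C]]) auto
      then obtain h where h: "h \<in> carrier SE6" "h ea = ea" "h eb = eb" "h ec = ec"
        "h (herm 0 0 0 0 0 C) = herm 0 0 0 0 0 (axis (neg i) 1)"
        by (auto simp: G.reach_def G.frame_def)
      obtain \<alpha> \<beta> \<gamma> where "\<And>a b c A B C. h (herm a b c A B C) = herm a b c (\<alpha> A) (\<beta> B) (\<gamma> C)"
        using frame_stabilizer_triality[OF h(1-4)] by metis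
      with h(5) i have "det_tri (l ea) (h (l ea)) ec \<noteq> 0"
        by (simp add: w det_tri_def)
      then have "h (l ea) \<notin> tri_radical (l ea)"
        unfolding tri_radical_def by blast
      with h show ?thesis
        by blast
    next
      case True
      with \<open>B \<noteq> 0 \<or> C \<noteq> 0\<close> obtain i where i: "B $ i \<noteq> 0"
        by (auto simp: vec_eq_iff)
      have "G.reach G.frame (herm 0 0 0 0 B 0) (herm 0 0 0 0 (axis (neg i) 1) 0)"
        using True \<open>B \<noteq> 0 \<or> C \<noteq> 0\<close> \<open>oct_norm B = 0\<close>
        by (intro G.reach_trans[OF G.singular_reach_B G.reach_sym[OF G.singular_reach_B]]) auto
      then obtain h where h: "h \<in> carrier SE6" "h ea = ea" "h eb = eb" "h ec = ec"
        "h (herm 0 0 0 0 B 0) = herm 0 0 0 0 (axis (neg i) 1) 0"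
        by (auto simp: G.reach_def G.frame_def)
      obtain \<alpha> \<beta> \<gamma> where "\<And>a b c A B C. h (herm a b c A B C) = herm a b c (\<alpha> A) (\<beta> B) (\<gamma> C)"
        using frame_stabilizer_triality[OF h(1-4)] by metis
      with h(5) i have "det_tri (l ea) (h (l ea)) eb \<noteq> 0"
        by (simp add: w det_tri_def)
      then have "h (l ea) \<notin> tri_radical (l ea)"
        unfolding tri_radical_def by blast
      with h show ?thesis
        by blast
    qed
    then obtain h where h: "h \<in> carrier SE6" "h ea = ea" "h (l ea) \<notin> tri_radical (l ea)"
      by blast
    have "h \<circ> l \<circ> finv h \<circ> finv l \<in> K"
      by (intro K_comp K_conj K_inv h l)
    moreover have "finv h ea = ea"
      using SE6_inv_into(2)[OF h(1), of ea] h(2) by simp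
    then have "(h \<circ> l \<circ> finv h \<circ> finv l) (l ea) = h (l ea)"
      using SE6_inv_into(2)[OF K_SE6[OF l], of ea] by simp
    ultimately show ?thesis
      using white_l h(3) by metis
  qed
qed

end

text \<open>Two linearly independent eigenvectors whose sum is also an eigenvector have the same
  eigenvalue. White sums link \<open>ea\<close> to the basis vectors of parts \<open>B\<close> and
  \<open>C\<close>, these to \<open>ec\<close> and \<open>eb\<close>, and \<open>eb\<close> to part
  \<open>A\<close>.\<close>

lemma scalar_if_fixes_white_lines:
  assumes k: "k \<in> carrier SE6" and lines: "\<And>p. white p \<Longrightarrow> \<exists>c. k p = c *s p"
  shows "\<exists>c. k = (*s) c"
proof -
  have same: "k v = c *s v"
    if u: "k u = c *s u" and v: "white v" "white (u + v)" and ij: "u $ i \<noteq> 0" "v $ i = 0" "u $ j = 0" "v $ j \<noteq> 0" for u v c i j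
  proof -
    obtain d e where d: "k v = d *s v" and e: "k (u + v) = e *s (u + v)"
      using lines v by blast
    have "c *s u + d *s v = e *s (u + v)"
      using e by (simp add: SE6_linear[OF k] u d)
    from arg_cong[OF this, of "\<lambda>w. w $ i"] arg_cong[OF this, of "\<lambda>w. w $ j"]
    have "c * u $ i = e * u $ i" "d * v $ j = e * v $ j"
      using ij by simp_all
    with ij d show ?thesis
      by simp
  qed
  have "white ea"
    by (simp add: white_herm herm_eq_0_iff)
  then obtain c where a: "k ea = c *s ea"
    using lines by blast
  have C: "k (herm 0 0 0 0 0 (axis l 1)) = c *s herm 0 0 0 0 0 (axis l 1)" for l
    by (rule same[OF a, of _ Ca "CC l"]) (simp_all add: herm_linear white_herm herm_eq_0_iff)
  have B: "k (herm 0 0 0 0 (axis l 1) 0) = c *s herm 0 0 0 0 (axis l 1) 0" for l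
    by (rule same[OF a, of _ Ca "CB l"]) (simp_all add: herm_linear white_herm herm_eq_0_iff)
  have b: "k eb = c *s eb"
    by (rule same[OF C[of "Pos One"], of _ "CC (Pos One)" Cb]) (simp_all add: herm_linear white_herm herm_eq_0_iff)
  have c: "k ec = c *s ec"
    by (rule same[OF B[of "Pos One"], of _ "CB (Pos One)" Cc]) (simp_all add: herm_linear white_herm herm_eq_0_iff)
  have A: "k (herm 0 0 0 (axis l 1) 0 0) = c *s herm 0 0 0 (axis l 1) 0 0" for l
    by (rule same[OF b, of _ Cb "CA l"]) (simp_all add: herm_linear white_herm herm_eq_0_iff)
  have "k (axis i 1) = c *s axis i 1" for i
    using a b c A B C by (cases i) (simp_all add: axis_eq_herm)
  then have "k (axis j 1) $ i * x $ j = (if j = i then c * x $ j else 0)" for x i j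
    by (simp add: axis_def)
  then have "k x $ i = (c *s x) $ i" for x i
    by (simp add: albert_linear_expand[OF SE6_linear(1)[OF k], of x i])
  then have "k x = c *s x" for x
    by (simp add: vec_eq_iff)
  then show ?thesis
    by blast
qed

section \<open>Iwasawa's argument\<close>

lemma unipotent_subgroup: "subgroup (unipotent e) SE6"
proof (rule group.subgroupI[OF SE6_group])
  show "unipotent e \<subseteq> carrier SE6"
    by (auto simp: unipotent_def)
  have "id \<in> unipotent e"
    by (auto simp: unipotent_def SE6_id tri_radical_def intro: exI[of _ 0])
  then show "unipotent e \<noteq> {}"
    by blast
  show "inv\<^bsub>SE6\<^esub> f \<in> unipotent e" if "f \<in> unipotent e" for f
    using unipotent_inv[OF that] that by (auto simp: SE6_inv unipotent_def)
qed (auto intro: unipotent_comp)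

lemma rot_rot_rot [simp]: "rot (rot (rot v)) = v"
  by (simp add: rot_def)

lemma finv_rot: "finv rot = rot \<circ> rot" "finv (rot \<circ> rot) = rot"
  by (rule inv_unique_comp; auto)+

lemma elementary_rot:
  "E23 x = (rot \<circ> rot) \<circ> E12 x \<circ> finv (rot \<circ> rot)" "E31 x = rot \<circ> E12 x \<circ> finv rot"
  "E21 x = (rot \<circ> rot) \<circ> E13 x \<circ> finv (rot \<circ> rot)" "E32 x = rot \<circ> E13 x \<circ> finv rot"
  unfolding finv_rot by (simp_all add: E23_def E31_def E13_def E32_def fun_eq_iff)

text \<open>These are Steinberg relations for the matrix entries: 1 in position (1,3) and
  \<open>x\<close> in position (3,2) produce \<open>x\<close> in position (1,2). The conjugates come
  from the convention for the parameters.\<close>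

lemma elementary_commutators:
  "E13 (oct_scalar 1) \<circ> E32 (oct_conj x) = E12 x \<circ> (E32 (oct_conj x) \<circ> E13 (oct_scalar 1))"
  "E12 (oct_scalar 1) \<circ> E23 (oct_conj x) = E13 x \<circ> (E23 (oct_conj x) \<circ> E12 (oct_scalar 1))"
proof -
  have "(E13 (oct_scalar 1) \<circ> E32 (oct_conj x)) v = (E12 x \<circ> (E32 (oct_conj x) \<circ> E13 (oct_scalar 1))) v" for v
    by (cases v rule: herm_exhaust)
      (simp add: oct_eq_iff oct_mult_nth oct_conj_def oct_scalar_def axis_label_nth oct_inner_def
        oct_norm_def sum_label sum_base algebra_simps)
  then show "E13 (oct_scalar 1) \<circ> E32 (oct_conj x) = E12 x \<circ> (E32 (oct_conj x) \<circ> E13 (oct_scalar 1))"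
    by blast
  have "(E12 (oct_scalar 1) \<circ> E23 (oct_conj x)) v = (E13 x \<circ> (E23 (oct_conj x) \<circ> E12 (oct_scalar 1))) v" for v
    by (cases v rule: herm_exhaust)
      (simp add: oct_eq_iff oct_mult_nth oct_conj_def oct_scalar_def axis_label_nth oct_inner_def
        oct_norm_def sum_label sum_base algebra_simps)
  then show "E12 (oct_scalar 1) \<circ> E23 (oct_conj x) = E13 x \<circ> (E23 (oct_conj x) \<circ> E12 (oct_scalar 1))"
    by blast
qed

context normal_SE6
begin

theorem nonscalar_imp_full:
  assumes "k0 \<in> K" "\<nexists>c. k0 = (*s) c"
  shows "K = carrier SE6"
proof -
  obtain p where "white p" "\<nexists>c. k0 p = c *s p"
    using scalar_if_fixes_white_lines[OF K_SE6[OF assms(1)]] assms(2) by blast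
  then obtain k p where "k \<in> K" "white p" "k p \<notin> tri_radical p"
    using moves_to_opposite_if_moves[OF assms(1)] by blast
  note trans = transitive_on_white[OF this]
  let ?U = "unipotent ea" and ?H = "K <#>\<^bsub>SE6\<^esub> unipotent ea"
  have U: "f \<in> carrier SE6" if "f \<in> ?U" for f
    using that by (simp add: unipotent_def)
  have H_iff: "h \<in> ?H \<longleftrightarrow> (\<exists>k\<in>K. \<exists>f\<in>?U. h = k \<circ> f)" for h
    by (auto simp: set_mult_def)
  \<comment> \<open>\<open>g\<close> differs from some \<open>k\<close> in \<open>K\<close> by a map
    \<open>h\<close> fixing \<open>ea\<close>, and conjugation by \<open>h\<close> preserves
    \<open>unipotent ea\<close>. A conjugate of \<open>u\<close> by an element of \<open>K\<close>
    is then an element of \<open>K\<close> followed after \<open>u\<close>.\<close>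
  have conj_H: "g \<circ> f \<circ> finv g \<in> ?H" if g: "g \<in> carrier SE6" and f: "f \<in> ?U" for f g
  proof -
    have "white ea"
      by (simp add: white_herm herm_eq_0_iff)
    then obtain k where k: "k \<in> K" "k ea = g ea"
      using trans white_SE6[OF g] by blast
    note inv_k = SE6_inv_into[OF K_SE6[OF k(1)]] and inv_g = SE6_inv_into[OF g]
    define h where "h = finv k \<circ> g"
    have h: "h \<in> carrier SE6" "h ea = ea"
      using inv_k g k(2)[symmetric] by (simp_all add: h_def SE6_comp)
    define u where "u = h \<circ> f \<circ> finv h"
    have u: "u \<in> ?U"
      using unipotent_conj[OF h(1) f] by (simp add: u_def h(2))
    note inv_u = SE6_inv_into[OF U[OF u]]
    have "finv h (finv k x) = finv g x" for x
      using SE6_inv_into(2)[OF h(1), of "finv g x"] by (simp add: h_def inv_g)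
    then have "k (u (finv k x)) = g (f (finv g x))" for x
      by (simp add: u_def) (simp add: h_def inv_k)
    then have "g \<circ> f \<circ> finv g = k \<circ> (u \<circ> finv k \<circ> finv u) \<circ> u"
      by (simp add: fun_eq_iff inv_u)
    moreover have "k \<circ> (u \<circ> finv k \<circ> finv u) \<in> K"
      by (intro K_comp K_conj K_inv k U u)
    ultimately show ?thesis
      using u H_iff by blast
  qed
  have conj_H': "f \<in> ?H" if "f \<in> ?U" for f
    using conj_H[OF SE6_id that] by simp
  interpret H: elementary_group ?H
  proof (rule elementary_groupI)
    show "subgroup ?H SE6"
      by (rule group.mult_norm_subgroup[OF SE6_group normal unipotent_subgroup])
    show "E12 x \<in> ?H" "E13 x \<in> ?H" for x
      by (intro conj_H' E12_unipotent E13_unipotent)+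
    show "E21 x \<in> ?H" "E23 x \<in> ?H" "E32 x \<in> ?H" "E31 x \<in> ?H" for x
      unfolding elementary_rot by (intro conj_H SE6_comp rot_SE6 E12_unipotent E13_unipotent)+
  qed
  \<comment> \<open>Modulo \<open>K\<close> both maps come from the abelian group
    \<open>unipotent ea\<close>.\<close>
  have comm: "\<exists>l\<in>K. g \<circ> h = l \<circ> (h \<circ> g)" if gh: "g \<in> carrier SE6" "h \<in> carrier SE6" for g h
  proof -
    obtain k f where k: "k \<in> K" "f \<in> ?U" "g = k \<circ> f"
      using subsetD[OF H.SE6_subset gh(1)] unfolding H_iff by blast
    obtain k' f' where k': "k' \<in> K" "f' \<in> ?U" "h = k' \<circ> f'"
      using subsetD[OF H.SE6_subset gh(2)] unfolding H_iff by blast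
    note inv_f = SE6_inv_into[OF U[OF k(2)]] and inv_f' = SE6_inv_into[OF U[OF k'(2)]]
    define m m' where "m = k \<circ> (f \<circ> k' \<circ> finv f)" and "m' = k' \<circ> (f' \<circ> k \<circ> finv f')"
    have m: "m \<in> K" "m' \<in> K"
      unfolding m_def m'_def by (intro K_comp K_conj k k' U)+
    have "g \<circ> h = m \<circ> (f \<circ> f')" "h \<circ> g = m' \<circ> (f' \<circ> f)"
      by (simp_all add: fun_eq_iff k(3) k'(3) m_def m'_def inv_f inv_f')
    then have "g \<circ> h = (m \<circ> finv m') \<circ> (h \<circ> g)"
      by (simp add: fun_eq_iff SE6_inv_into[OF K_SE6[OF m(2)]] unipotent_commute[OF k(2) k'(2), THEN fun_cong, simplified])
    moreover have "m \<circ> finv m' \<in> K"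
      by (intro K_comp K_inv m)
    ultimately show ?thesis
      by blast
  qed
  have comm_K: "f \<in> K" if fgh: "f \<in> carrier SE6" "g \<in> carrier SE6" "h \<in> carrier SE6" "g \<circ> h = f \<circ> (h \<circ> g)" for f g h
  proof -
    obtain l where l: "l \<in> K" "g \<circ> h = l \<circ> (h \<circ> g)"
      using comm[OF fgh(2,3)] by blast
    have "f x = l x" for x
    proof -
      obtain y where "x = (h \<circ> g) y"
        using SE6_inv_into(3)[OF SE6_comp[OF fgh(3,2)], of x] by metis
      then show ?thesis
        using fun_cong[OF l(2), of y] fun_cong[OF fgh(4), of y] by simp
    qed
    then have "f = l"
      by blast
    with l show ?thesis
      by simp
  qed
  have E12_K: "E12 x \<in> K" for x
    by (rule comm_K[OF _ _ _ elementary_commutators(1)]) (rule elementary_SE6)+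
  have E13_K: "E13 x \<in> K" for x
    by (rule comm_K[OF _ _ _ elementary_commutators(2)]) (rule elementary_SE6)+
  interpret K: elementary_group K
  proof (rule elementary_groupI)
    show "subgroup K SE6"
      by (rule normal_imp_subgroup[OF normal])
    show "E21 x \<in> K" "E23 x \<in> K" "E32 x \<in> K" "E31 x \<in> K" for x
      unfolding elementary_rot by (intro K_conj SE6_comp rot_SE6 E12_K E13_K)+
  qed (rule E12_K E13_K)+
  show ?thesis
    using K.SE6_subset K_SE6 by blast
qed

end

section \<open>The quotient by the scalars\<close>

lemma SE6_scalars_normal: "SE6_scalars \<lhd> (SE6 :: ('a::field albert \<Rightarrow> 'a albert) monoid)"
proof (subst group.normal_inv_iff[OF SE6_group], intro conjI ballI)
  show "subgroup SE6_scalars (SE6 :: ('a albert \<Rightarrow> 'a albert) monoid)"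
  proof (rule group.subgroupI[OF SE6_group])
    show "SE6_scalars \<subseteq> carrier SE6"
      by (auto simp: SE6_scalars_def)
    have "id = (*s) (1 :: 'a)"
      by (auto simp: fun_eq_iff)
    then show "SE6_scalars \<noteq> ({} :: ('a albert \<Rightarrow> 'a albert) set)"
      using SE6_id by (auto simp: SE6_scalars_def)
    show "inv\<^bsub>SE6\<^esub> f \<in> SE6_scalars" if scalar: "f \<in> SE6_scalars" for f :: "'a albert \<Rightarrow> 'a albert"
    proof -
      obtain c where f: "f \<in> carrier SE6" "f = (*s) c"
        using scalar unfolding SE6_scalars_def by blast
      note inv = SE6_inv_into[OF f(1)]
      have "c \<noteq> 0"
        using inv(3)[of ea] f(2) by (auto simp: herm_eq_0_iff)
      then have "finv f x = (1 / c) *s x" for x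
        using inv(2)[of "(1 / c) *s x"] f(2) by (simp add: vec.scale_scale)
      then have "finv f = (*s) (1 / c)"
        by blast
      with inv(1) show ?thesis
        by (auto simp: SE6_inv[OF f(1)] SE6_scalars_def)
    qed
    show "f \<otimes>\<^bsub>SE6\<^esub> g \<in> SE6_scalars" if scalars: "f \<in> SE6_scalars" "g \<in> SE6_scalars" for f g :: "'a albert \<Rightarrow> 'a albert"
    proof -
      obtain c d where "f = (*s) c" "g = (*s) d"
        using scalars unfolding SE6_scalars_def by blast
      then have "f \<circ> g = (*s) (c * d)"
        by (auto simp: fun_eq_iff)
      moreover have "f \<circ> g \<in> carrier SE6"
        using scalars unfolding SE6_scalars_def by (blast intro: SE6_comp)
      ultimately show ?thesis
        unfolding SE6_mult SE6_scalars_def by blast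
    qed
  qed
next
  fix g f :: "'a albert \<Rightarrow> 'a albert"
  assume g: "g \<in> carrier SE6" and f: "f \<in> SE6_scalars"
  then obtain c where c: "f = (*s) c"
    unfolding SE6_scalars_def by blast
  have "g \<circ> f \<circ> finv g = f"
    by (auto simp: fun_eq_iff c SE6_linear[OF g] SE6_inv_into[OF g])
  with f show "g \<otimes>\<^bsub>SE6\<^esub> f \<otimes>\<^bsub>SE6\<^esub> inv\<^bsub>SE6\<^esub> g \<in> SE6_scalars"
    by (simp add: SE6_inv[OF g])
qed

text \<open>This provides the second element of the quotient, which simplicity requires.\<close>

lemma E12_not_scalar: "E12 (oct_scalar 1) \<noteq> ((*s) c :: 'a::field albert \<Rightarrow> _)"
proof
  assume "E12 (oct_scalar 1) = ((*s) c :: 'a albert \<Rightarrow> _)"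
  then have "E12 (oct_scalar 1) eb $ CC (Pos Zero) = (c *s (eb :: 'a albert)) $ CC (Pos Zero)"
    by simp
  then show False
    by (simp add: herm_linear oct_scalar_def axis_def)
qed


theorem mainTheorem2:
  fixes q :: nat
  assumes "primepow q" and "CARD('a::{field, finite}) = q"
  shows "simple_group (E6 :: ('a albert \<Rightarrow> 'a albert) set monoid)"
proof -
  let ?G = "SE6 :: ('a albert \<Rightarrow> 'a albert) monoid"
  let ?Z = "SE6_scalars :: ('a albert \<Rightarrow> 'a albert) set"
  interpret G: group ?G by (rule SE6_group)
  interpret Z: normal ?Z ?G by (rule SE6_scalars_normal)
  interpret \<pi>: group_hom ?G "?G Mod ?Z" "\<lambda>g. ?Z #>\<^bsub>?G\<^esub> g"
    by (intro group_hom.intro group_hom_axioms.intro G.is_group Z.factorgroup_is_group Z.r_coset_hom_Mod)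
  have one: "?Z #>\<^bsub>?G\<^esub> g = \<one>\<^bsub>?G Mod ?Z\<^esub> \<longleftrightarrow> g \<in> ?Z" if "g \<in> carrier ?G" for g
    using that Z.rcos_const G.rcos_self[OF that Z.is_subgroup] by (auto simp: FactGroup_def)
  have coset: "\<exists>g\<in>carrier ?G. X = ?Z #>\<^bsub>?G\<^esub> g" if "X \<in> carrier (?G Mod ?Z)" for X
    using that by (auto simp: FactGroup_def RCOSETS_def)
  have "simple_group (?G Mod ?Z)"
  proof (intro simple_group.intro simple_group_axioms.intro)
    show "group (?G Mod ?Z)"
      by (rule Z.factorgroup_is_group)
    have E: "E12 (oct_scalar 1) \<in> carrier ?G" "E12 (oct_scalar 1) \<notin> ?Z"
      using E12_not_scalar unfolding SE6_scalars_def by (blast intro: elementary_SE6)+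
    then have "card {\<one>\<^bsub>?G Mod ?Z\<^esub>, ?Z #>\<^bsub>?G\<^esub> E12 (oct_scalar 1)} = 2"
      using one[OF E(1)] by auto
    \<comment> \<open>\<open>Coset.order\<close> is a cardinality, which would be 0 for an infinite
      carrier; finiteness of \<open>'a\<close> makes the comparison valid.\<close>
    moreover have "card {\<one>\<^bsub>?G Mod ?Z\<^esub>, ?Z #>\<^bsub>?G\<^esub> E12 (oct_scalar 1)} \<le> Coset.order (?G Mod ?Z)"
      unfolding Coset.order_def using E \<pi>.hom_closed \<pi>.H.one_closed by (intro card_mono) auto
    ultimately show "1 < Coset.order (?G Mod ?Z)"
      by simp
  next
    fix N
    assume N: "N \<lhd> ?G Mod ?Z"
    interpret N: normal N "?G Mod ?Z" by (rule N)
    \<comment> \<open>Passing to the preimage reduces the claim to normal subgroups of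
      \<open>SE6\<close>: one inside the scalars gives a trivial \<open>N\<close>, any other is the
      whole group.\<close>
    define K where "K = {g \<in> carrier ?G. ?Z #>\<^bsub>?G\<^esub> g \<in> N}"
    have "K \<lhd> ?G"
    proof (subst G.normal_inv_iff, intro conjI ballI)
      show "subgroup K ?G"
      proof (rule G.subgroupI)
        show "K \<noteq> {}"
          using \<pi>.hom_one N.one_closed G.one_closed unfolding K_def by (auto simp del: SE6_one)
        show "inv\<^bsub>?G\<^esub> g \<in> K" if "g \<in> K" for g
          using that unfolding K_def by (auto simp del: SE6_mult)
        show "g \<otimes>\<^bsub>?G\<^esub> h \<in> K" if "g \<in> K" "h \<in> K" for g h
          using that N.m_closed[of "?Z #>\<^bsub>?G\<^esub> g" "?Z #>\<^bsub>?G\<^esub> h"] unfolding K_def by (auto simp del: SE6_mult)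
      qed (auto simp: K_def)
      show "g \<otimes>\<^bsub>?G\<^esub> k \<otimes>\<^bsub>?G\<^esub> inv\<^bsub>?G\<^esub> g \<in> K" if "g \<in> carrier ?G" "k \<in> K" for g k
        using that N.inv_op_closed2 unfolding K_def by (auto simp del: SE6_mult)
    qed
    then interpret K: normal_SE6 K
      by (rule normal_SE6.intro)
    show "N = carrier (?G Mod ?Z) \<or> N = {\<one>\<^bsub>?G Mod ?Z\<^esub>}"
    proof (cases "K \<subseteq> ?Z")
      case True
      have "X = \<one>\<^bsub>?G Mod ?Z\<^esub>" if X: "X \<in> N" for X
      proof -
        obtain g where "g \<in> carrier ?G" "X = ?Z #>\<^bsub>?G\<^esub> g"
          using coset[OF N.mem_carrier[OF X]] by blast
        with X True one[of g] show ?thesis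
          by (auto simp: K_def)
      qed
      then show ?thesis
        using N.one_closed by auto
    next
      case False
      then obtain k where "k \<in> K" "\<nexists>c. k = (*s) c"
        using K.K_SE6 unfolding SE6_scalars_def by blast
      then have K: "K = carrier ?G"
        by (rule K.nonscalar_imp_full)
      have "X \<in> N" if X: "X \<in> carrier (?G Mod ?Z)" for X
        using coset[OF X] K by (auto simp: K_def)
      then show ?thesis
        using N.subset by blast
    qed
  qed
  then show ?thesis
    by (simp add: E6_def)
qed

end
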